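(* Let $g \in C^2(\mathbb{R})$ satisfy $g''(t) > 0$ for all $t\in\mathbb{R}$ and $g(0)=g'(0)=0$, and let $K^g_{\mathrm{stat}} \subset \mathbb{R}^{6\times 2}$ be the set $$K^g_{\mathrm{stat}} = \left\{ \begin{pmatrix} X \\ g'(\det X)X \\ \big(g'(\det X)\det X - g(\det X)\big)J \end{pmatrix} : X \in \mathbb{R}^{2\times 2}\right\}, \qquad J = \begin{pmatrix} 0 & -1 \\ 1 & 0\end{pmatrix}.$$ Let $\Omega \subset \mathbb{R}^2$ be open, bounded and convex. Let $u_n : \Omega \to \mathbb{R}^6$, $n\in\mathbb{N}$, be an equi-Lipschitz sequence with $$\operatorname{dist}(Du_n(x), K^g_{\mathrm{stat}}) \to 0 \quad\text{in } L^1_{\mathrm{loc}}(\Omega).$$ Suppose moreover that $u_n$ converges weakly-$*$ in $W^{1,\infty}$ to a Lipschitz map $u : \Omega \to \mathbb{R}^6$. Then $\det_{12}(Du_n)$ converges strongly in $L^1_{\mathrm{loc}}(\Omega)$ to $\det_{12}(Du)$, and $Du(x) \in K^g_{\mathrm{stat}}$ for a.e. $x\in\Omega$.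
   Context: For $A\in\mathbb{R}^{6\times 2}$ and $1\le i<j\le 6$, $\det_{ij}(A)$ is the determinant of the $2\times 2$ submatrix of $A$ consisting of the $i$-th and $j$-th rows. Equi-Lipschitz means that the Lipschitz constants of the $u_n$ are bounded uniformly in $n$. $\operatorname{dist}$ is the Euclidean distance in $\mathbb{R}^{6\times 2}$. $(Du)_{ij} = \partial_j u_i$. *)

theory Defs
  imports "HOL-Analysis.Analysis"
begin

text \<open>The gradient matrix \<open>(Du)\<^sub>i\<^sub>j = \<partial>\<^sub>j u\<^sub>i\<close>, with classical partial derivatives. For a map that is
  Lipschitz on an open set these exist almost everywhere there (Rademacher) and coincide with
  the weak derivatives; the value of \<^const>\<open>deriv\<close> on the remaining null set is irrelevant.\<close>

definition Jac :: "(real^'m \<Rightarrow> real^'n) \<Rightarrow> real^'m \<Rightarrow> real^'m^'n" where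
  "Jac u x = (\<chi> i j. deriv (\<lambda>t. u (x + t *\<^sub>R axis j 1) $ i) 0)"

definition det_rows :: "'n \<Rightarrow> 'n \<Rightarrow> real^2^'n \<Rightarrow> real" where
  "det_rows i j A = det (vector [A $ i, A $ j] :: real^2^2)"

definition block3 :: "real^2^2 \<Rightarrow> real^2^2 \<Rightarrow> real^2^2 \<Rightarrow> real^2^6" where
  "block3 X Y Z = vector [X $ 1, X $ 2, Y $ 1, Y $ 2, Z $ 1, Z $ 2]"

lemma block3_rows:
  "block3 X Y Z $ 1 = X $ 1" "block3 X Y Z $ 2 = X $ 2"
  "block3 X Y Z $ 3 = Y $ 1" "block3 X Y Z $ 4 = Y $ 2"
  "block3 X Y Z $ 5 = Z $ 1" "block3 X Y Z $ 6 = Z $ 2"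
  by (simp_all add: block3_def vector_def)

definition J :: "real^2^2" where
  "J = vector [vector [0, -1], vector [1, 0]]"

definition K_stat :: "(real \<Rightarrow> real) \<Rightarrow> (real^2^6) set" where
  "K_stat g = {block3 X (deriv g (det X) *\<^sub>R X) ((deriv g (det X) * det X - g (det X)) *\<^sub>R J) | X. True}"

definition C2 :: "(real \<Rightarrow> real) \<Rightarrow> bool" where
  "C2 g \<longleftrightarrow> g C1_differentiable_on UNIV \<and> deriv g C1_differentiable_on UNIV"

definition L1loc :: "'a::euclidean_space set \<Rightarrow> ('a \<Rightarrow> real) \<Rightarrow> bool" where
  "L1loc \<Omega> f \<longleftrightarrow> (\<forall>C. compact C \<and> C \<subseteq> \<Omega> \<longrightarrow> set_integrable lebesgue C f)"

definition L1loc_tendsto ::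
    "'a::euclidean_space set \<Rightarrow> (nat \<Rightarrow> 'a \<Rightarrow> real) \<Rightarrow> ('a \<Rightarrow> real) \<Rightarrow> bool" where
  "L1loc_tendsto \<Omega> f F \<longleftrightarrow> (\<forall>n. L1loc \<Omega> (f n)) \<and> L1loc \<Omega> F \<and>
     (\<forall>C. compact C \<and> C \<subseteq> \<Omega> \<longrightarrow>
        (\<lambda>n. LINT x:C|lebesgue. \<bar>f n x - F x\<bar>) \<longlonglongrightarrow> 0)"

definition Linf :: "'a::euclidean_space set \<Rightarrow> ('a \<Rightarrow> 'b::euclidean_space) \<Rightarrow> bool" where
  "Linf \<Omega> f \<longleftrightarrow> set_borel_measurable lebesgue \<Omega> f \<and> (\<exists>B. AE x\<in>\<Omega> in lebesgue. norm (f x) \<le> B)"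

text \<open>Weak-* convergence in \<open>L\<^sup>\<infinity>(\<Omega>)\<close>, viewed as the dual of \<open>L\<^sup>1(\<Omega>)\<close> via
  \<open>(f, \<phi>) \<mapsto> \<integral>\<^sub>\<Omega> f \<bullet> \<phi>\<close>; for matrices the inner product is the Frobenius one.\<close>

definition Linf_weak_star ::
    "'a::euclidean_space set \<Rightarrow> (nat \<Rightarrow> 'a \<Rightarrow> 'b::euclidean_space) \<Rightarrow> ('a \<Rightarrow> 'b) \<Rightarrow> bool" where
  "Linf_weak_star \<Omega> f F \<longleftrightarrow> (\<forall>n. Linf \<Omega> (f n)) \<and> Linf \<Omega> F \<and>
     (\<forall>\<phi>. set_integrable lebesgue \<Omega> \<phi> \<longrightarrow>
        (\<lambda>n. LINT x:\<Omega>|lebesgue. f n x \<bullet> \<phi> x) \<longlonglongrightarrow> (LINT x:\<Omega>|lebesgue. F x \<bullet> \<phi> x))"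

text \<open>Meant for maps that are Lipschitz on the open set \<open>\<Omega>\<close>, whose weak gradient is \<^const>\<open>Jac\<close>.\<close>

definition W1inf_weak_star ::
    "(real^'m) set \<Rightarrow> (nat \<Rightarrow> real^'m \<Rightarrow> real^'n) \<Rightarrow> (real^'m \<Rightarrow> real^'n) \<Rightarrow> bool" where
  "W1inf_weak_star \<Omega> u v \<longleftrightarrow>
     Linf_weak_star \<Omega> u v \<and> Linf_weak_star \<Omega> (\<lambda>n. Jac (u n)) (Jac v)"

end

theory Submission
  imports Defs
begin

text \<open>
  On \<open>K_stat\<close> write \<open>t\<close> for the determinant of the first two rows and \<open>z = g'(t) t - g(t)\<close>. Polarising
  the Pluecker relation of the first four rows gives a form \<open>F(A, B)\<close>, bilinear in the minors, with
  \<open>F(A, A) = 0\<close> for every matrix and \<open>F(A, B) = t s (g'(t) - g'(s))\<^sup>2\<close> on \<open>K_stat\<close>, while the minor of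
  the last two rows of \<open>A - B\<close> is \<open>(z(t) - z(s))\<^sup>2\<close>. Strict convexity of \<open>g\<close> makes
  \<open>G = 2 \<Lambda> det\<^sub>5\<^sub>6(A - B) - F(A, B)\<close> nonnegative on bounded parts of \<open>K_stat\<close>, and zero only for
  \<open>t = s\<close>, when \<open>\<Lambda>\<close> is large. So, up to a small constant and multiples of the distances to
  \<open>K_stat\<close>, the function \<open>G\<close> bounds \<open>\<bar>t - s\<bar>\<close>. Minors are weakly continuous, hence
  \<open>\<integral>G(Du\<^sub>n, Du\<^sub>m)\<close> tends to \<open>\<integral>G(Du, Du) = 0\<close> when first \<open>m\<close> and then \<open>n\<close> tends to infinity, and the
  determinants converge strongly. The equations of \<open>K_stat\<close> are affine once \<open>t\<close> is known, so they
  pass to the limit.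

  Two analytic facts are needed along the way. A Lipschitz function on the line is differentiable almost
  everywhere: after adding a linear function it is increasing and bi-Lipschitz, and Vitali coverings
  show that it maps the set of points with slopes both below \<open>p\<close> and above \<open>q > p\<close> to a set of measure
  at most \<open>p\<close> times and at least \<open>q\<close> times as large. Fubini gives directional derivatives of Lipschitz
  functions of several variables. The weak continuity of minors comes from
  integration by parts, done for difference quotients, which commute.
\<close>

section \<open>Directional derivatives of Lipschitz functions\<close>

text \<open>Until the very end nothing places the limit gradient in \<open>K_stat\<close>, so the
  inequality that separates determinants can only be applied to two members of the sequence, never
  to a member and the limit. This dictates the form of \<open>G\<close>: with one argument frozen it
  is affine in the entries and minors of the other, with bounded coefficients, so the two indices
  can be sent to infinity one after the other. Neither term of \<open>G\<close> would do alone.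
  Since z' = t g'', the function z is monotone on each half line but takes equal values at points of
  opposite sign, which the minor of the last two rows cannot tell apart. Exactly there F = t s
  (g'(t) - g'(s))^2 is negative, so that -F separates them. For t, s of equal sign F has the wrong
  sign, and the square (z(t) - z(s))^2 has to absorb it; this is what fixes \<Lambda>. The maps are
  replaced by Lipschitz extensions of their components to the whole plane, so that difference
  quotients and translations make sense everywhere. Integration by parts uses only first difference
  quotients of Lipschitz functions: the symmetry of mixed derivatives is used at the discrete level,
  before any limit is taken.\<close>

lemma emeasure_UN_le_nn_integral:
  assumes C: "countable C" and I: "\<And>i. i \<in> C \<Longrightarrow> I i \<in> sets M"
  shows "emeasure M (\<Union>i\<in>C. I i) \<le> (\<integral>\<^sup>+i. emeasure M (I i) \<partial>count_space C)"
proof -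
  have "emeasure M (\<Union>i\<in>C. I i) = (\<integral>\<^sup>+x. indicator (\<Union>i\<in>C. I i) x \<partial>M)"
    using assms by (intro nn_integral_indicator[symmetric]) auto
  also have "\<dots> \<le> (\<integral>\<^sup>+x. (\<integral>\<^sup>+i. indicator (I i) x \<partial>count_space C) \<partial>M)"
  proof (rule nn_integral_mono)
    fix x
    show "indicator (\<Union>i\<in>C. I i) x \<le> (\<integral>\<^sup>+i. indicator (I i) x \<partial>count_space C)"
    proof (cases "x \<in> (\<Union>i\<in>C. I i)")
      case True
      then obtain i where "i \<in> C" "x \<in> I i" by auto
      then show ?thesis using nn_integral_ge_point[of i C "\<lambda>i. indicator (I i) x"] True by simp
    qed simp
  qed
  also have "\<dots> = (\<integral>\<^sup>+i. (\<integral>\<^sup>+x. indicator (I i) x \<partial>M) \<partial>count_space C)"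
    using assms by (intro nn_integral_count_space_nn_integral) auto
  also have "\<dots> = (\<integral>\<^sup>+i. emeasure M (I i) \<partial>count_space C)"
    using assms by (intro nn_integral_cong) auto
  finally show ?thesis .
qed

text \<open>Every point of \<open>S\<close> is an endpoint of arbitrarily short intervals that
  \<open>F\<close> stretches by at most the factor \<open>r\<close>. Vitali's theorem selects
  countably many disjoint ones inside an open set barely larger than \<open>S\<close>, and what they
  miss of \<open>S\<close> is null and has a null image because \<open>F\<close> is
  Lipschitz.\<close>

lemma vitali_image_le:
  fixes F :: "real \<Rightarrow> real"
  assumes S: "S \<in> lmeasurable" and mono: "mono F" and lip: "M-lipschitz_on UNIV F" and "0 \<le> r"
    and freq: "\<And>x. x \<in> S \<Longrightarrow> \<exists>\<^sub>F y in at x. (F y - F x) / (y - x) \<le> r"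
    and FS: "F ` S \<in> sets lebesgue"
  shows "emeasure lebesgue (F ` S) \<le> r * emeasure lebesgue S"
proof (rule ennreal_le_epsilon)
  fix e :: real assume "0 < e"
  \<comment> \<open>The denominator is \<open>r + 1\<close> because \<open>r\<close> may be
    zero.\<close>
  define e' where "e' = e / (r + 1)"
  have e': "0 < e'" "r * e' \<le> e" using \<open>0 < e\<close> \<open>0 \<le> r\<close> by (auto simp: e'_def field_simps)
  obtain U where U: "open U" "S \<subseteq> U" "U - S \<in> lmeasurable" "emeasure lebesgue (U - S) < ennreal e'"
    using sets_lebesgue_outer_open[of S e'] S e' by (metis fmeasurableD)
  define K where "K = {(a, \<rho>). 0 < \<rho> \<and> cball a \<rho> \<subseteq> U \<and> F (a + \<rho>) - F (a - \<rho>) \<le> r * (2 * \<rho>)}"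
  have K: "\<exists>i. i \<in> K \<and> x \<in> cball (fst i) (snd i) \<and> snd i < d" if x: "x \<in> S" and d: "0 < d" for x d
  proof -
    obtain \<eta> where \<eta>: "\<eta> > 0" "ball x \<eta> \<subseteq> U" using U x by (meson open_contains_ball subsetD)
    have "\<forall>\<^sub>F y in at x. y \<noteq> x \<and> dist y x < min d \<eta>"
      using d \<eta> by (auto simp: eventually_at intro!: exI[of _ "min d \<eta>"])
    from frequently_ex[OF frequently_eventually_conj[OF freq[OF x] this]]
    obtain y where y: "(F y - F x) / (y - x) \<le> r" "y \<noteq> x" "dist y x < min d \<eta>" by auto
    \<comment> \<open>The covering theorem wants balls, so the interval between \<open>x\<close> and
      \<open>y\<close> is written as a ball around its midpoint; \<open>x\<close> lies on the
      boundary of this closed ball.\<close>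
    define a \<rho> where "a = (x + y) / 2" and "\<rho> = \<bar>y - x\<bar> / 2"
    have "F (a + \<rho>) - F (a - \<rho>) = (if x < y then F y - F x else F x - F y)"
      using y(2) by (auto simp: a_def \<rho>_def field_simps abs_if)
    moreover have "(F y - F x) * (y - x) \<le> r * (y - x)\<^sup>2"
      using mult_right_mono[OF y(1), of "(y - x)\<^sup>2"] y(2) by (simp add: power2_eq_square)
    ultimately have 1: "F (a + \<rho>) - F (a - \<rho>) \<le> r * (2 * \<rho>)"
      using y(1,2) by (auto simp: \<rho>_def abs_if field_simps split: if_splits)
    have 2: "cball a \<rho> \<subseteq> U"
    proof
      fix z assume "z \<in> cball a \<rho>"
      then have "dist z x < \<eta>" using y(3) by (auto simp: a_def \<rho>_def dist_real_def abs_if field_simps split: if_splits)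
      then show "z \<in> U" using \<eta> by (auto simp: dist_commute)
    qed
    have "0 < \<rho>" "\<bar>a - x\<bar> \<le> \<rho>" "\<rho> < d"
      using y by (auto simp: a_def \<rho>_def dist_real_def abs_if field_simps split: if_splits)
    then show ?thesis
      using 1 2 by (intro exI[of _ "(a, \<rho>)"]) (auto simp: K_def dist_real_def)
  qed
  obtain C where C: "countable C" "C \<subseteq> K"
     "pairwise (\<lambda>i j. disjnt (cball (fst i) (snd i)) (cball (fst j) (snd j))) C"
     "negligible (S - (\<Union>i \<in> C. cball (fst i) (snd i)))"
  proof (rule Vitali_covering_theorem_cballs[of K snd S fst])
    show "0 < snd i" if "i \<in> K" for i using that by (auto simp: K_def)
    show "\<exists>i. i \<in> K \<and> x \<in> cball (fst i) (snd i) \<and> snd i < d" if "x \<in> S" "0 < d" for x d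
      by (rule K[OF that])
  qed (rule that; assumption)
  define N where "N = S - (\<Union>i \<in> C. cball (fst i) (snd i))"
  have FN: "negligible (F ` N)"
  proof (rule negligible_locally_Lipschitz_image)
    show "negligible N" using C(4) by (simp add: N_def)
    show "\<exists>T B. open T \<and> x \<in> T \<and> (\<forall>y\<in>N \<inter> T. norm (F y - F x) \<le> B * norm (y - x))" for x
      using lipschitz_onD[OF lip] by (intro exI[of _ UNIV] exI[of _ M]) (auto simp: dist_norm)
  qed simp
  define I where "I i = {F (fst i - snd i)..F (fst i + snd i)}" for i
  have "F ` S \<subseteq> F ` N \<union> (\<Union>i\<in>C. I i)"
  proof (rule image_subsetI)
    fix x assume "x \<in> S"
    show "F x \<in> F ` N \<union> (\<Union>i\<in>C. I i)"
    proof (cases "x \<in> N")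
      case False
      then obtain i where i: "i \<in> C" "x \<in> cball (fst i) (snd i)" using \<open>x \<in> S\<close> by (auto simp: N_def)
      then have "F x \<in> I i"
        using monoD[OF mono, of "fst i - snd i" x] monoD[OF mono, of x "fst i + snd i"]
        by (auto simp: I_def dist_real_def abs_le_iff)
      with i(1) show ?thesis by blast
    qed simp
  qed
  moreover have UI: "(\<Union>i\<in>C. I i) \<in> sets lebesgue"
    using C(1) by (intro sets.countable_UN') (auto simp: I_def)
  moreover have "F ` N \<in> null_sets lebesgue" using FN by (simp add: negligible_iff_null_sets)
  ultimately have "emeasure lebesgue (F ` S) \<le> emeasure lebesgue ((\<Union>i\<in>C. I i) \<union> F ` N)"
    by (intro emeasure_mono) auto
  also have "\<dots> = emeasure lebesgue (\<Union>i\<in>C. I i)"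
    using UI \<open>F ` N \<in> null_sets lebesgue\<close> by (rule emeasure_Un_null_set)
  \<comment> \<open>The image intervals may touch where \<open>F\<close> is constant, so
    subadditivity is used for them; the disjointness of the balls enters only later, where their
    measures are added up inside \<open>U\<close>.\<close>
  also have "\<dots> \<le> (\<integral>\<^sup>+i. emeasure lebesgue (I i) \<partial>count_space C)"
    using C(1) by (intro emeasure_UN_le_nn_integral) (auto simp: I_def)
  also have "\<dots> \<le> (\<integral>\<^sup>+i. r * emeasure lebesgue (cball (fst i) (snd i)) \<partial>count_space C)"
  proof (rule nn_integral_mono)
    fix i assume "i \<in> space (count_space C)"
    then have "i \<in> K" using C by auto
    then have 1: "0 < snd i" "F (fst i + snd i) - F (fst i - snd i) \<le> r * (2 * snd i)" by (auto simp: K_def)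
    have "emeasure lebesgue (I i) = ennreal (F (fst i + snd i) - F (fst i - snd i))"
      using 1 monoD[OF mono, of "fst i - snd i" "fst i + snd i"] by (simp add: I_def)
    also have "\<dots> \<le> ennreal (r * (2 * snd i))" using 1 by (intro ennreal_leI) auto
    also have "\<dots> = ennreal r * emeasure lebesgue (cball (fst i) (snd i))"
      using 1 \<open>0 \<le> r\<close> by (simp add: cball_eq_atLeastAtMost ennreal_mult)
    finally show "emeasure lebesgue (I i) \<le> r * emeasure lebesgue (cball (fst i) (snd i))" .
  qed
  also have "\<dots> = r * (\<integral>\<^sup>+i. emeasure lebesgue (cball (fst i) (snd i)) \<partial>count_space C)"
    by (intro nn_integral_cmult) simp
  also have "(\<integral>\<^sup>+i. emeasure lebesgue (cball (fst i) (snd i)) \<partial>count_space C) = emeasure lebesgue (\<Union>i\<in>C. cball (fst i) (snd i))"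
    using C by (intro emeasure_UN_countable[symmetric]) (auto simp: disjoint_family_on_def pairwise_def disjnt_def)
  also have "r * \<dots> \<le> r * emeasure lebesgue U"
  proof (intro mult_left_mono emeasure_mono UN_least)
    show "cball (fst i) (snd i) \<subseteq> U" if "i \<in> C" for i
      using subsetD[OF C(2) that] unfolding K_def by (auto simp del: mem_cball)
  qed (use U(1) in auto)
  also have "emeasure lebesgue U \<le> emeasure lebesgue S + emeasure lebesgue (U - S)"
    using emeasure_subadditive[of S lebesgue "U - S"] U S by (simp add: Un_absorb1)
  also have "\<dots> \<le> emeasure lebesgue S + e'"
    using U by (intro add_left_mono) simp
  finally have "emeasure lebesgue (F ` S) \<le> r * (emeasure lebesgue S + e')"
    by (simp add: mult_left_mono)
  also have "\<dots> \<le> r * emeasure lebesgue S + e"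
    using e' \<open>0 \<le> r\<close> by (simp add: distrib_left ennreal_mult[symmetric] add_left_mono ennreal_leI)
  finally show "emeasure lebesgue (F ` S) \<le> r * emeasure lebesgue S + e" .
qed


lemma negligible_oscillating_slopes:
  fixes F G :: "real \<Rightarrow> real"
  assumes "mono F" "mono G" "M-lipschitz_on UNIV F" "N-lipschitz_on UNIV G"
    and GF: "\<And>x. G (F x) = x" and FG: "\<And>y. F (G y) = y"
    and "0 \<le> p" "p < q" and S: "S \<in> sets borel" "S \<in> lmeasurable"
    and p: "\<And>x. x \<in> S \<Longrightarrow> \<exists>\<^sub>F y in at x. (F y - F x) / (y - x) < p"
    and q: "\<And>x. x \<in> S \<Longrightarrow> \<exists>\<^sub>F y in at x. q < (F y - F x) / (y - x)"
  shows "negligible S"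
proof -
  have contF: "continuous_on UNIV F" and contG: "continuous_on UNIV G"
    using assms lipschitz_on_continuous_on by blast+
  have FS: "F ` S = G -` S" using GF FG by (auto simp: image_iff) metis
  have "F ` S \<in> sets borel"
    unfolding FS using measurable_sets_borel[OF borel_measurable_continuous_onI[OF contG] S(1)] .
  then have FSm: "F ` S \<in> sets lebesgue" by auto
  have 1: "emeasure lebesgue (F ` S) \<le> p * emeasure lebesgue S"
  proof (rule vitali_image_le[OF S(2)])
    show "\<exists>\<^sub>F y in at x. (F y - F x) / (y - x) \<le> p" if "x \<in> S" for x
      using p[OF that] by (rule frequently_elim1) simp
  qed (use assms FSm in auto)
  also have "\<dots> < \<infinity>" using fmeasurableD2[OF S(2)] by (simp add: ennreal_mult_less_top top.not_eq_extremum)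
  finally have FSl: "F ` S \<in> lmeasurable" using FSm by (intro fmeasurableI) auto
  have GFS: "G ` F ` S = S" using GF by (auto simp: image_iff)
  have 2: "emeasure lebesgue (G ` F ` S) \<le> (1 / q) * emeasure lebesgue (F ` S)"
  proof (rule vitali_image_le[OF FSl])
    fix y assume "y \<in> F ` S"
    then obtain x where x: "x \<in> S" "y = F x" by auto
    have inj: "F z = F x \<longleftrightarrow> z = x" for z using GF by metis
    \<comment> \<open>Being continuous and injective, \<open>F\<close> maps punctured neighbourhoods
      of \<open>x\<close> into punctured neighbourhoods of \<open>F x\<close>; a property of slopes
      of \<open>G\<close> near \<open>F x\<close> thus becomes one of slopes of \<open>F\<close>
      near \<open>x\<close>.\<close>
    have lim: "filterlim F (at (F x)) (at x)"
      using contF by (auto simp: filterlim_at inj continuous_on_eq_continuous_at isCont_def eventually_at_filter)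
    show "\<exists>\<^sub>F w in at y. (G w - G y) / (w - y) \<le> 1 / q"
    proof (rule ccontr)
      assume "\<not> ?thesis"
      then have "\<forall>\<^sub>F w in at (F x). \<not> (G w - G (F x)) / (w - F x) \<le> 1 / q"
        by (simp add: not_frequently x)
      then have ev: "\<forall>\<^sub>F z in at x. \<not> (G (F z) - G (F x)) / (F z - F x) \<le> 1 / q"
        using lim by (rule eventually_compose_filterlim)
      obtain z where z: "q < (F z - F x) / (z - x)" "\<not> (z - x) / (F z - F x) \<le> 1 / q"
        using frequently_ex[OF frequently_eventually_conj[OF q[OF x(1)] ev]] by (auto simp: GF)
      then show False
        using \<open>0 \<le> p\<close> \<open>p < q\<close> frac_le[of 1 1 q "(F z - F x) / (z - x)"] by simp
    qed
  qed (use assms S GFS in auto)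
  have "measure lebesgue (F ` S) \<le> p * measure lebesgue S"
    using 1 FSl S(2) \<open>0 \<le> p\<close> by (simp add: emeasure_eq_measure2 ennreal_mult[symmetric])
  moreover have "measure lebesgue S \<le> (1 / q) * measure lebesgue (F ` S)"
    using 2 FSl S(2) \<open>0 \<le> p\<close> \<open>p < q\<close> by (simp add: GFS emeasure_eq_measure2 ennreal_mult[symmetric])
  ultimately have "q * measure lebesgue S \<le> p * measure lebesgue S"
    using \<open>0 \<le> p\<close> \<open>p < q\<close> by (auto simp: field_simps)
  then have "measure lebesgue S = 0"
    using \<open>p < q\<close> by (metis linorder_not_le measure_le_0_iff mult_right_le_imp_le)
  then show ?thesis using S(2) by (simp add: negligible_iff_measure)
qed

text \<open>A bounded difference quotient without a limit oscillates across some pair of rationals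
  \<open>p < q\<close>, so for Lipschitz \<open>f\<close> countably many of these sets contain all
  points without a derivative in direction \<open>e\<close>.\<close>

definition osc_set :: "('a::euclidean_space \<Rightarrow> real) \<Rightarrow> 'a \<Rightarrow> real \<Rightarrow> real \<Rightarrow> 'a set" where
  "osc_set f e p q =
     {x. (\<exists>\<^sub>F h in at 0. (f (x + h *\<^sub>R e) - f x) / h < p) \<and>
         (\<exists>\<^sub>F h in at 0. q < (f (x + h *\<^sub>R e) - f x) / h)}"

text \<open>Countably many scales replace the filter, which exhibits \<open>osc_set\<close> as a
  countable intersection of sets that are open for continuous \<open>f\<close>.\<close>

lemma frequently_at_0_iff:
  "(\<exists>\<^sub>F h in at (0::real). P h) \<longleftrightarrow> (\<forall>n. \<exists>h. h \<noteq> 0 \<and> \<bar>h\<bar> < 1 / real (Suc n) \<and> P h)"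
proof
  assume "\<exists>\<^sub>F h in at 0. P h"
  show "\<forall>n. \<exists>h. h \<noteq> 0 \<and> \<bar>h\<bar> < 1 / real (Suc n) \<and> P h"
  proof
    fix n
    have "\<forall>\<^sub>F h in at (0::real). h \<noteq> 0 \<and> \<bar>h\<bar> < 1 / real (Suc n)"
      by (auto simp: eventually_at intro!: exI[of _ "1 / real (Suc n)"])
    from frequently_ex[OF frequently_eventually_conj[OF \<open>\<exists>\<^sub>F h in at 0. P h\<close> this]]
    show "\<exists>h. h \<noteq> 0 \<and> \<bar>h\<bar> < 1 / real (Suc n) \<and> P h" by auto
  qed
next
  assume R: "\<forall>n. \<exists>h. h \<noteq> 0 \<and> \<bar>h\<bar> < 1 / real (Suc n) \<and> P h"
  show "\<exists>\<^sub>F h in at 0. P h"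
    unfolding frequently_def
  proof
    assume "\<forall>\<^sub>F h in at 0. \<not> P h"
    then obtain d where d: "d > 0" "\<And>h. h \<noteq> 0 \<Longrightarrow> \<bar>h\<bar> < d \<Longrightarrow> \<not> P h"
      by (auto simp: eventually_at)
    obtain n where "1 / real (Suc n) < d" using nat_approx_posE[OF d(1)] by metis
    then show False using R d(2) by (meson less_trans)
  qed
qed

lemma osc_set_borel:
  assumes "continuous_on UNIV f"
  shows "osc_set f e p q \<in> sets borel"
proof -
  define Q where "Q h x = (f (x + h *\<^sub>R e) - f x) / h" for h x
  define H where "H n = {h::real. h \<noteq> 0 \<and> \<bar>h\<bar> < 1 / real (Suc n)}" for n
  have Q: "continuous_on UNIV (Q h)" for h
    unfolding Q_def divide_inverse
    by (intro continuous_intros continuous_on_compose2[OF assms]) auto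
  \<comment> \<open>The union runs over uncountably many \<open>h\<close>; it is measurable because
    each member is open.\<close>
  have "open (\<Union>h\<in>H n. {x. Q h x < p})" "open (\<Union>h\<in>H n. {x. q < Q h x})" for n
    by (intro open_UN ballI open_Collect_less Q continuous_intros)+
  moreover have "osc_set f e p q = (\<Inter>n. \<Union>h\<in>H n. {x. Q h x < p}) \<inter> (\<Inter>n. \<Union>h\<in>H n. {x. q < Q h x})"
    unfolding osc_set_def frequently_at_0_iff Q_def H_def by (auto simp: Bex_def)
  ultimately show ?thesis by auto
qed

lemma frequently_slope_shift:
  fixes f :: "real \<Rightarrow> real"
  shows "(\<exists>\<^sub>F y in at x. P ((f y - f x) / (y - x))) \<longleftrightarrow> (\<exists>\<^sub>F h in at 0. P ((f (x + h) - f x) / h))"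
  by (subst at_to_0) (simp add: frequently_def eventually_filtermap add.commute)

lemma negligible_osc_set_real:
  fixes f :: "real \<Rightarrow> real"
  assumes f: "L-lipschitz_on UNIV f" and "p < q"
  shows "negligible (osc_set f 1 p q)"
proof -
  \<comment> \<open>Slope \<open>L\<close> would give monotonicity only; the extra 1 gives
    \<open>y - x \<le> F y - F x\<close> for \<open>x \<le> y\<close>, hence a 1-Lipschitz inverse.
    All slopes are shifted by \<open>L + 1\<close>.\<close>
  define F where "F x = f x + (L + 1) * x" for x
  define G where "G = inv F"
  have "0 \<le> L" using f by (rule lipschitz_on_nonneg)
  have Lf: "\<bar>f x - f y\<bar> \<le> L * \<bar>x - y\<bar>" for x y
    using lipschitz_onD[OF f] by (simp add: dist_real_def)
  have inc: "y - x \<le> F y - F x" if "x \<le> y" for x y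
    using Lf[of y x] that by (simp add: F_def algebra_simps abs_if split: if_splits)
  have lipF: "(2 * L + 1)-lipschitz_on UNIV F"
  proof (rule lipschitz_on_mono)
    show "(L + \<bar>L + 1\<bar> * 1)-lipschitz_on UNIV F"
      unfolding F_def by (rule lipschitz_on_add[OF f lipschitz_on_cmult_real[OF lipschitz_on_id]])
  qed (use \<open>0 \<le> L\<close> in auto)
  have monoF: "mono F"
  proof (rule monoI)
    show "F x \<le> F y" if "x \<le> y" for x y using inc[OF that] that by linarith
  qed
  have "inj F"
  proof (rule injI)
    show "x = y" if "F x = F y" for x y
      using inc[of x y] inc[of y x] that by linarith
  qed
  have "surj F"
    unfolding surj_def
  proof
    fix y
    define b where "b = \<bar>y - F 0\<bar>"
    have "F (- b) \<le> y" "y \<le> F b"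
      using inc[of "-b" 0] inc[of 0 b] by (auto simp: b_def)
    moreover have "continuous_on {-b..b} F"
      using lipschitz_on_continuous_on[OF lipF] continuous_on_subset by blast
    ultimately obtain x where "F x = y" using IVT'[of F "-b" y b] by (auto simp: b_def)
    then show "\<exists>x. y = F x" by blast
  qed
  have GF: "G (F x) = x" and FG: "F (G x) = x" for x
    using \<open>inj F\<close> \<open>surj F\<close> by (simp_all add: G_def surj_f_inv_f)
  have monoG: "mono G"
  proof (rule monoI)
    show "G x \<le> G y" if "x \<le> y" for x y
      using inc[of "G y" "G x"] that FG by (cases "G x \<le> G y") auto
  qed
  have lipG: "1-lipschitz_on UNIV G"
  proof (rule lipschitz_onI)
    show "dist (G x) (G y) \<le> 1 * dist x y" for x y
      using inc[of "G x" "G y"] inc[of "G y" "G x"] FG by (auto simp: dist_real_def abs_if)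
  qed simp
  have slope: "(F y - F x) / (y - x) = (f y - f x) / (y - x) + (L + 1)" if "y \<noteq> x" for x y
    using that by (simp add: F_def field_simps)
  define p' q' where "p' = p + (L + 1)" and "q' = q + (L + 1)"
  have ev: "\<forall>\<^sub>F y in at x. y \<noteq> x" for x :: real by (simp add: eventually_at_filter)
  have low: "\<exists>\<^sub>F y in at x. (F y - F x) / (y - x) < p'"
    and up: "\<exists>\<^sub>F y in at x. q' < (F y - F x) / (y - x)"
    if "x \<in> osc_set f 1 p q" for x
  proof -
    have "\<exists>\<^sub>F y in at x. (f y - f x) / (y - x) < p" "\<exists>\<^sub>F y in at x. q < (f y - f x) / (y - x)"
      using that by (simp_all add: osc_set_def frequently_slope_shift[where P = "\<lambda>s. s < p"] frequently_slope_shift[where P = "\<lambda>s. q < s"])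
    note fr = this[THEN frequently_eventually_conj, OF ev]
    show "\<exists>\<^sub>F y in at x. (F y - F x) / (y - x) < p'"
      using fr(1) by (rule frequently_elim1) (simp add: slope p'_def)
    show "\<exists>\<^sub>F y in at x. q' < (F y - F x) / (y - x)"
      using fr(2) by (rule frequently_elim1) (simp add: slope q'_def)
  qed
  show ?thesis
  proof (cases "0 \<le> p'")
    case True
    show ?thesis
    \<comment> \<open>Intersecting with a box makes the measure finite, without which comparing its
      \<open>p'\<close>-fold and \<open>q'\<close>-fold says nothing.\<close>
    proof (rule negligible_on_intervals[THEN iffD2], intro allI)
      fix a b :: real
      have B: "osc_set f 1 p q \<inter> cbox a b \<in> sets borel"
        by (intro sets.Int osc_set_borel[OF lipschitz_on_continuous_on[OF f]]) simp
      show "negligible (osc_set f 1 p q \<inter> cbox a b)"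
      proof (rule negligible_oscillating_slopes[OF monoF monoG lipF lipG GF FG True _ B])
        show "p' < q'" using \<open>p < q\<close> by (simp add: p'_def q'_def)
        show "osc_set f 1 p q \<inter> cbox a b \<in> lmeasurable"
          using B by (intro bounded_set_imp_lmeasurable) (auto simp: bounded_Int)
        show "\<exists>\<^sub>F y in at x. (F y - F x) / (y - x) < p'" if "x \<in> osc_set f 1 p q \<inter> cbox a b" for x
          using that by (intro low) simp
        show "\<exists>\<^sub>F y in at x. q' < (F y - F x) / (y - x)" if "x \<in> osc_set f 1 p q \<inter> cbox a b" for x
          using that by (intro up) simp
      qed
    qed
  next
    case False
    \<comment> \<open>Slopes of the increasing function \<open>F\<close> never fall below a negative
      \<open>p'\<close>.\<close>
    have "osc_set f 1 p q = {}"
    proof (rule ccontr)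
      assume "\<not> ?thesis"
      then obtain x where x: "x \<in> osc_set f 1 p q" by auto
      from frequently_ex[OF frequently_eventually_conj[OF low[OF x] ev]]
      obtain y where y: "(F y - F x) / (y - x) < p'" "y \<noteq> x" by auto
      have "0 \<le> (F y - F x) / (y - x)"
        using monoD[OF monoF, of x y] monoD[OF monoF, of y x]
        by (cases "x \<le> y") (auto simp: zero_le_divide_iff)
      with y False show False by simp
    qed
    then show ?thesis by simp
  qed
qed


text \<open>Translation invariance takes the place of a change of coordinates: the measure of
  \<open>N\<close> is its own average over the translates by \<open>t *\<^sub>R e\<close>,
  \<open>0 \<le> t \<le> 1\<close>, and exchanging the integrals turns this average into an integral
  over \<open>x\<close> of lengths of slices, all of them zero.\<close>

lemma null_sets_of_null_lines:
  fixes e :: "'a::euclidean_space"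
  assumes [measurable]: "N \<in> sets borel"
    and null: "\<And>x. emeasure lborel {t::real. x + t *\<^sub>R e \<in> N} = 0"
  shows "N \<in> null_sets lborel"
proof -
  have tr: "emeasure lborel N = (\<integral>\<^sup>+x. indicator N (x + t *\<^sub>R e) \<partial>lborel)" for t
  proof -
    have "emeasure lborel N = (\<integral>\<^sup>+x. indicator N x \<partial>distr lborel borel ((+) (t *\<^sub>R e)))"
      by (simp add: lborel_distr_plus)
    also have "\<dots> = (\<integral>\<^sup>+x. indicator N (t *\<^sub>R e + x) \<partial>lborel)"
      by (rule nn_integral_distr) measurable
    finally show ?thesis by (simp only: add.commute)
  qed
  have sl: "(\<integral>\<^sup>+t. indicator {0..1} t * indicator N (x + t *\<^sub>R e) \<partial>lborel) = 0" for x
  proof -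
    have [measurable]: "{t. x + t *\<^sub>R e \<in> N} \<in> sets borel"
      by measurable
    have "(\<integral>\<^sup>+t. indicator {0..1} t * indicator N (x + t *\<^sub>R e) \<partial>lborel)
        \<le> (\<integral>\<^sup>+t. indicator {t. x + t *\<^sub>R e \<in> N} t \<partial>lborel)"
      by (intro nn_integral_mono) (auto split: split_indicator)
    also have "\<dots> = 0" using null by simp
    finally show ?thesis by simp
  qed
  have "emeasure lborel N = (\<integral>\<^sup>+t. indicator {0..1::real} t * emeasure lborel N \<partial>lborel)"
    by (simp add: nn_integral_multc)
  also have "\<dots> = (\<integral>\<^sup>+t. (\<integral>\<^sup>+x. indicator {0..1::real} t * indicator N (x + t *\<^sub>R e) \<partial>lborel) \<partial>lborel)"
    by (intro nn_integral_cong) (simp add: nn_integral_cmult flip: tr)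
  also have "\<dots> = (\<integral>\<^sup>+x. (\<integral>\<^sup>+t. indicator {0..1::real} t * indicator N (x + t *\<^sub>R e) \<partial>lborel) \<partial>lborel)"
    by (rule lborel_pair.Fubini') measurable
  also have "\<dots> = 0" by (simp add: sl)
  finally show ?thesis by (simp add: null_sets_def)
qed

lemma null_osc_set:
  fixes f :: "'a::euclidean_space \<Rightarrow> real"
  assumes f: "L-lipschitz_on UNIV f" and "p < q"
  shows "osc_set f e p q \<in> null_sets lborel"
proof (rule null_sets_of_null_lines)
  show "osc_set f e p q \<in> sets borel"
    by (rule osc_set_borel[OF lipschitz_on_continuous_on[OF f]])
  fix x
  have l: "(L * norm e)-lipschitz_on UNIV (\<lambda>t. f (x + t *\<^sub>R e))"
  proof (rule lipschitz_onI)
    fix s t :: real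
    have "dist (f (x + s *\<^sub>R e)) (f (x + t *\<^sub>R e)) \<le> L * norm (s *\<^sub>R e - t *\<^sub>R e)"
      using lipschitz_onD[OF f, of "x + s *\<^sub>R e" "x + t *\<^sub>R e"] by (simp add: dist_norm)
    then show "dist (f (x + s *\<^sub>R e)) (f (x + t *\<^sub>R e)) \<le> L * norm e * dist s t"
      by (simp add: scaleR_left_diff_distrib[symmetric] dist_real_def mult_ac)
  qed (use lipschitz_on_nonneg[OF f] in auto)
  have "{t. x + t *\<^sub>R e \<in> osc_set f e p q} = osc_set (\<lambda>t. f (x + t *\<^sub>R e)) 1 p q"
    by (simp add: osc_set_def scaleR_left_distrib add.assoc)
  moreover have "osc_set (\<lambda>t. f (x + t *\<^sub>R e)) 1 p q \<in> sets borel"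
    by (rule osc_set_borel[OF lipschitz_on_continuous_on[OF l]])
  moreover have "osc_set (\<lambda>t. f (x + t *\<^sub>R e)) 1 p q \<in> null_sets lebesgue"
    using negligible_osc_set_real[OF l \<open>p < q\<close>] by (simp add: negligible_iff_null_sets)
  ultimately show "emeasure lborel {t. x + t *\<^sub>R e \<in> osc_set f e p q} = 0"
    by (auto simp: null_sets_def)
qed

text \<open>The limit is the supremum of the eventual lower bounds, that is, the lower limit. A
  rational \<open>p\<close> above it is not an eventual lower bound, so every rational
  \<open>q > p\<close> is an eventual upper bound.\<close>

lemma tendsto_if_no_oscillation:
  fixes Q :: "real \<Rightarrow> real"
  assumes bdd: "\<forall>\<^sub>F h in at 0. \<bar>Q h\<bar> \<le> B"
    and no: "\<And>p q. p \<in> \<rat> \<Longrightarrow> q \<in> \<rat> \<Longrightarrow> p < q \<Longrightarrow>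
      (\<forall>\<^sub>F h in at 0. p \<le> Q h) \<or> (\<forall>\<^sub>F h in at 0. Q h \<le> q)"
  shows "\<exists>D. (Q \<longlongrightarrow> D) (at 0)"
proof
  define A where "A = {a. \<forall>\<^sub>F h in at 0. a \<le> Q h}"
  have "- B \<in> A" unfolding A_def using bdd by (auto elim!: eventually_mono)
  have ub: "a \<le> B" if "a \<in> A" for a
  proof -
    have "\<forall>\<^sub>F h in at (0::real). a \<le> B"
      using bdd that[unfolded A_def mem_Collect_eq] by eventually_elim linarith
    then show ?thesis by simp
  qed
  then have bA: "bdd_above A" by (auto simp: bdd_above_def)
  show "(Q \<longlongrightarrow> Sup A) (at 0)"
  proof (rule order_tendstoI)
    fix y assume "y < Sup A"
    then obtain a where "a \<in> A" "y < a" using less_cSup_iff[OF _ bA] \<open>- B \<in> A\<close> by auto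
    then show "\<forall>\<^sub>F h in at 0. y < Q h" unfolding A_def by (auto elim!: eventually_mono)
  next
    fix y assume "Sup A < y"
    then obtain q where q: "q \<in> \<rat>" "Sup A < q" "q < y" using Rats_dense_in_real by blast
    then obtain p where p: "p \<in> \<rat>" "Sup A < p" "p < q" using Rats_dense_in_real by blast
    have "p \<notin> A" using cSup_upper[OF _ bA, of p] p by auto
    then have "\<forall>\<^sub>F h in at 0. Q h \<le> q" using no[OF p(1) q(1) p(3)] by (auto simp: A_def)
    then show "\<forall>\<^sub>F h in at 0. Q h < y" using q by (auto elim!: eventually_mono)
  qed
qed

lemma AE_directional_derivative:
  fixes f :: "'a::euclidean_space \<Rightarrow> real"
  assumes f: "L-lipschitz_on UNIV f"
  shows "AE x in lborel. ((\<lambda>t. f (x + t *\<^sub>R e)) has_field_derivative deriv (\<lambda>t. f (x + t *\<^sub>R e)) 0) (at 0)"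
proof -
  have "AE x in lborel. \<forall>p\<in>\<rat>. \<forall>q\<in>\<rat>. p < q \<longrightarrow> x \<notin> osc_set f e p q"
    using null_osc_set[OF f] by (auto simp: AE_ball_countable countable_rat intro: AE_not_in)
  then show ?thesis
  proof (rule AE_mp, intro AE_I2 impI)
    fix x assume x: "\<forall>p\<in>\<rat>. \<forall>q\<in>\<rat>. p < q \<longrightarrow> x \<notin> osc_set f e p q"
    have "\<exists>D. ((\<lambda>h. (f (x + h *\<^sub>R e) - f x) / h) \<longlongrightarrow> D) (at 0)"
    proof (rule tendsto_if_no_oscillation)
      have "\<bar>(f (x + h *\<^sub>R e) - f x) / h\<bar> \<le> L * norm e" if "h \<noteq> 0" for h
        using lipschitz_onD[OF f, of "x + h *\<^sub>R e" x] that
        by (simp add: dist_norm field_simps)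
      then show "\<forall>\<^sub>F h in at 0. \<bar>(f (x + h *\<^sub>R e) - f x) / h\<bar> \<le> L * norm e"
        by (simp add: eventually_at_filter)
    next
      fix p q :: real assume "p \<in> \<rat>" "q \<in> \<rat>" "p < q"
      then have "x \<notin> osc_set f e p q" using x by blast
      then show "(\<forall>\<^sub>F h in at 0. p \<le> (f (x + h *\<^sub>R e) - f x) / h) \<or> (\<forall>\<^sub>F h in at 0. (f (x + h *\<^sub>R e) - f x) / h \<le> q)"
        by (simp add: osc_set_def not_frequently not_less)
    qed
    then obtain D where "((\<lambda>t. f (x + t *\<^sub>R e)) has_field_derivative D) (at 0)"
      by (auto simp: has_field_derivative_iff)
    then show "((\<lambda>t. f (x + t *\<^sub>R e)) has_field_derivative deriv (\<lambda>t. f (x + t *\<^sub>R e)) 0) (at 0)"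
      by (metis DERIV_imp_deriv)
  qed
qed

section \<open>Integration by parts for minors\<close>

text \<open>Lebesgue measure is complete: the preimages under \<open>f\<close> and \<open>g\<close>
  differ only inside a null set.\<close>

lemma borel_measurable_lebesgue_AE:
  fixes f g :: "'a::euclidean_space \<Rightarrow> real"
  assumes g: "g \<in> borel_measurable lebesgue" and eq: "AE x in lebesgue. f x = g x"
  shows "f \<in> borel_measurable lebesgue"
proof (rule measurableI)
  fix A :: "real set" assume A: "A \<in> sets borel"
  obtain N where N: "N \<in> null_sets lebesgue" "{x. f x \<noteq> g x} \<subseteq> N"
    using eq unfolding eventually_ae_filter by auto
  have "g -` A \<in> sets lebesgue" using measurable_sets[OF g A] by simp
  moreover have "f -` A \<inter> N \<in> sets lebesgue"
    using null_sets_completion_subset[OF Int_lower2 N(1)] by (rule null_setsD2)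
  moreover have "f -` A = (g -` A - N) \<union> (f -` A \<inter> N)" using N(2) by auto
  ultimately have "f -` A \<in> sets lebesgue"
    using sets.Un[OF sets.Diff[OF _ null_setsD2[OF N(1)]]] by metis
  then show "f -` A \<inter> space lebesgue \<in> sets lebesgue" by simp
qed simp

section \<open>Difference quotients and directional derivatives\<close>

definition dq :: "real \<Rightarrow> 'a::euclidean_space \<Rightarrow> ('a \<Rightarrow> real) \<Rightarrow> 'a \<Rightarrow> real" where
  "dq h e f x = (f (x + h *\<^sub>R e) - f x) / h"

definition dderiv :: "'a::euclidean_space \<Rightarrow> ('a \<Rightarrow> real) \<Rightarrow> 'a \<Rightarrow> real" where
  "dderiv e f x = deriv (\<lambda>t. f (x + t *\<^sub>R e)) 0"

text \<open>A directional derivative depends on the germ of the function alone. This permits passing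
  to extensions of maps given on an open set, and shows that derivatives vanish off a closed set
  that carries the function.\<close>

lemma dderiv_cong:
  assumes "open U" "x \<in> U" "\<And>y. y \<in> U \<Longrightarrow> f y = g y"
  shows "dderiv e f x = dderiv e g x"
proof -
  have "((\<lambda>t. x + t *\<^sub>R e) \<longlongrightarrow> x + 0 *\<^sub>R e) (nhds 0)"
    by (intro tendsto_intros filterlim_ident)
  then have "\<forall>\<^sub>F t in nhds 0. x + t *\<^sub>R e \<in> U"
    using assms(1,2) by (intro topological_tendstoD) auto
  then have "\<forall>\<^sub>F t in nhds 0. f (x + t *\<^sub>R e) = g (x + t *\<^sub>R e)"
    by eventually_elim (rule assms(3))
  then show ?thesis unfolding dderiv_def by (intro deriv_cong_ev) auto
qed

lemma dderiv_const: "dderiv e (\<lambda>_. c) x = 0"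
  by (simp add: dderiv_def)

lemma continuous_on_dq:
  assumes "continuous_on UNIV f" shows "continuous_on UNIV (dq h e f)"
  unfolding dq_def[abs_def] divide_inverse
  by (intro continuous_intros continuous_on_compose2[OF assms]) auto

lemma integrable_continuous_bounded_support:
  fixes f :: "'a::euclidean_space \<Rightarrow> real"
  assumes f: "continuous_on UNIV f" and "bounded {x. f x \<noteq> 0}"
  shows "integrable lborel f"
proof -
  obtain R where R: "{x. f x \<noteq> 0} \<subseteq> cball 0 R"
    using bounded_subset_ballD[OF assms(2), of 0] ball_subset_cball by (metis order_trans)
  have "integrable lborel (\<lambda>x. indicator (cball 0 R) x *\<^sub>R f x)"
    by (intro borel_integrable_compact continuous_on_subset[OF f]) auto
  moreover have "indicator (cball 0 R) x *\<^sub>R f x = f x" for x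
    using R by (auto simp: indicator_def)
  ultimately show ?thesis by (simp only:)
qed

lemma integral_shift:
  fixes f :: "'a::euclidean_space \<Rightarrow> real"
  assumes f: "f \<in> borel_measurable borel"
  shows "(\<integral>x. f (x + c) \<partial>lborel) = (\<integral>x. f x \<partial>lborel)"
proof -
  have "(\<integral>x. f x \<partial>lborel) = (\<integral>x. f x \<partial>distr lborel borel ((+) c))" by (simp add: lborel_distr_plus)
  also have "\<dots> = (\<integral>x. f (c + x) \<partial>lborel)" using f by (intro integral_distr) auto
  finally show ?thesis by (simp add: add.commute)
qed

lemma bounded_support_shift:
  fixes f :: "'a::euclidean_space \<Rightarrow> real"
  assumes "bounded {x. f x \<noteq> 0}" shows "bounded {x. f (x + c) \<noteq> 0}"
proof -
  have "{x. f (x + c) \<noteq> 0} = (\<lambda>y. y - c) ` {x. f x \<noteq> 0}" by (auto simp: image_iff algebra_simps intro!: exI[of _ "_ + c"])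
  then show ?thesis using bounded_translation_minus[OF assms] by simp
qed

lemma bounded_support_dq:
  fixes f :: "'a::euclidean_space \<Rightarrow> real"
  assumes "bounded {x. f x \<noteq> 0}" shows "bounded {x. dq h e f x \<noteq> 0}"
  by (rule bounded_subset[OF bounded_Un[THEN iffD2, OF conjI, OF assms bounded_support_shift[OF assms]]])
    (auto simp: dq_def)

text \<open>The shift by \<open>k *\<^sub>R e\<close> moves from \<open>F\<close> to
  \<open>G\<close> by translation invariance and thereby turns into a shift by
  \<open>- k *\<^sub>R e\<close>, whence the step \<open>- k\<close> on the right.\<close>

lemma summation_by_parts_dq:
  fixes F G :: "'a::euclidean_space \<Rightarrow> real"
  assumes F: "continuous_on UNIV F" and G: "continuous_on UNIV G" "bounded {x. G x \<noteq> 0}"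
  shows "(\<integral>x. dq k e F x * G x \<partial>lborel) = - (\<integral>x. F x * dq (- k) e G x \<partial>lborel)"
proof -
  have FG: "integrable lborel (\<lambda>x. F (x + a) * G (x + b))" for a b
  proof (rule integrable_continuous_bounded_support)
    show "continuous_on UNIV (\<lambda>x. F (x + a) * G (x + b))"
      by (intro continuous_intros continuous_on_compose2[OF F] continuous_on_compose2[OF G(1)]) auto
    show "bounded {x. F (x + a) * G (x + b) \<noteq> 0}"
      by (rule bounded_subset[OF bounded_support_shift[OF G(2)]]) auto
  qed
  note FG' = FG[of _ 0, simplified] FG[of 0, simplified] FG[of 0 0, simplified]
  have "(\<lambda>x. F x * G (x - k *\<^sub>R e)) \<in> borel_measurable borel"
    using borel_measurable_integrable[OF FG[of 0 "- k *\<^sub>R e"]] by simp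
  from integral_shift[OF this, of "k *\<^sub>R e"]
  have sh: "(\<integral>x. F (x + k *\<^sub>R e) * G x \<partial>lborel) = (\<integral>x. F x * G (x - k *\<^sub>R e) \<partial>lborel)" by simp
  have "(\<integral>x. dq k e F x * G x \<partial>lborel) = (\<integral>x. (F (x + k *\<^sub>R e) * G x - F x * G x) / k \<partial>lborel)"
    by (simp add: dq_def algebra_simps)
  also have "\<dots> = ((\<integral>x. F (x + k *\<^sub>R e) * G x \<partial>lborel) - (\<integral>x. F x * G x \<partial>lborel)) / k"
    using FG' by simp
  also have "\<dots> = ((\<integral>x. F x * G (x - k *\<^sub>R e) \<partial>lborel) - (\<integral>x. F x * G x \<partial>lborel)) / k"
    by (simp only: sh)
  also have "\<dots> = (\<integral>x. (F x * G (x - k *\<^sub>R e) - F x * G x) / k \<partial>lborel)"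
    using FG'(2)[of "- k *\<^sub>R e"] FG' by simp
  also have "\<dots> = - (\<integral>x. F x * dq (- k) e G x \<partial>lborel)"
    unfolding integral_minus[symmetric] by (intro Bochner_Integration.integral_cong) (auto simp: dq_def algebra_simps minus_divide_left)
  finally show ?thesis .
qed

lemma dq_commute: "dq h e (dq k e' f) = dq k e' (dq h e f)"
  by (rule ext) (simp add: dq_def diff_divide_distrib add_ac mult.commute)

text \<open>Moving the quotient from \<open>b\<close> onto \<open>P\<close> produces a mixed second
  quotient of \<open>P\<close>, which is symmetric in \<open>e1\<close> and \<open>e2\<close>. The
  result mentions first quotients only, so it survives the limit for Lipschitz functions, which have
  no second derivatives in general.\<close>

lemma integral_dq_dq_swap:
  fixes P b :: "'a::euclidean_space \<Rightarrow> real"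
  assumes P: "continuous_on UNIV P" "bounded {x. P x \<noteq> 0}" and b: "continuous_on UNIV b"
  shows "(\<integral>x. dq (- h) e2 b x * dq h e1 P x \<partial>lborel) = (\<integral>x. dq (- h) e1 b x * dq h e2 P x \<partial>lborel)"
  using summation_by_parts_dq[OF b continuous_on_dq[OF P(1)] bounded_support_dq[OF P(2)], of "- h" e2 h e1]
    summation_by_parts_dq[OF b continuous_on_dq[OF P(1)] bounded_support_dq[OF P(2)], of "- h" e1 h e2]
  by (simp add: dq_commute)

lemma AE_dderiv:
  fixes f :: "'a::euclidean_space \<Rightarrow> real"
  assumes "L-lipschitz_on UNIV f"
  shows "AE x in lebesgue. ((\<lambda>t. f (x + t *\<^sub>R e)) has_field_derivative dderiv e f x) (at 0)"
  using AE_completion[OF AE_directional_derivative[OF assms, of e]] by (simp add: dderiv_def)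

lemma dq_tendsto_dderiv:
  assumes "((\<lambda>t. f (x + t *\<^sub>R e)) has_field_derivative dderiv e f x) (at 0)"
    and "h \<longlonglongrightarrow> 0" "\<And>n. h n \<noteq> 0"
  shows "(\<lambda>n. dq (h n) e f x) \<longlonglongrightarrow> dderiv e f x"
proof -
  have "((\<lambda>h. dq h e f x) \<longlongrightarrow> dderiv e f x) (at 0)"
    using assms(1) by (simp add: has_field_derivative_iff dq_def)
  then show ?thesis
    by (rule filterlim_compose) (use assms in \<open>auto simp: filterlim_at\<close>)
qed

lemma dq_bound:
  assumes "L-lipschitz_on UNIV f"
  shows "\<bar>dq h e f x\<bar> \<le> L * norm e"
proof (cases "h = 0")
  case False
  then show ?thesis
    using lipschitz_onD[OF assms, of "x + h *\<^sub>R e" x] by (simp add: dq_def dist_norm field_simps)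
qed (use lipschitz_on_nonneg[OF assms] in \<open>auto simp: dq_def\<close>)

lemma borel_measurable_dq:
  assumes "L-lipschitz_on UNIV f"
  shows "dq h e f \<in> borel_measurable lebesgue"
  using borel_measurable_continuous_onI[OF continuous_on_dq[OF lipschitz_on_continuous_on[OF assms]]]
  by (intro measurable_completion) simp

text \<open>Almost everywhere it is the limit of the continuous quotients with steps
  1/(n+1).\<close>

lemma borel_measurable_dderiv:
  fixes f :: "'a::euclidean_space \<Rightarrow> real"
  assumes "L-lipschitz_on UNIV f"
  shows "dderiv e f \<in> borel_measurable lebesgue"
proof (rule borel_measurable_lebesgue_AE)
  show "(\<lambda>x. lim (\<lambda>n. dq (1 / real (Suc n)) e f x)) \<in> borel_measurable lebesgue"
    using borel_measurable_dq[OF assms] by (intro borel_measurable_lim_metric)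
  have "(\<lambda>n. 1 / real (Suc n)) \<longlonglongrightarrow> 0" using LIMSEQ_inverse_real_of_nat by (simp add: inverse_eq_divide)
  then have lim: "(\<lambda>n. dq (1 / real (Suc n)) e f x) \<longlonglongrightarrow> dderiv e f x"
    if "((\<lambda>t. f (x + t *\<^sub>R e)) has_field_derivative dderiv e f x) (at 0)" for x
    by (intro dq_tendsto_dderiv that) auto
  show "AE x in lebesgue. dderiv e f x = lim (\<lambda>n. dq (1 / real (Suc n)) e f x)"
    using AE_dderiv[OF assms, of e] by eventually_elim (rule limI[OF lim, symmetric])
qed

lemma dderiv_bound:
  assumes "L-lipschitz_on UNIV f"
    and "((\<lambda>t. f (x + t *\<^sub>R e)) has_field_derivative dderiv e f x) (at 0)"
  shows "\<bar>dderiv e f x\<bar> \<le> L * norm e"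
proof -
  have "(\<lambda>n. 1 / real (Suc n)) \<longlonglongrightarrow> 0" using LIMSEQ_inverse_real_of_nat by (simp add: inverse_eq_divide)
  then have "(\<lambda>n. \<bar>dq (1 / real (Suc n)) e f x\<bar>) \<longlonglongrightarrow> \<bar>dderiv e f x\<bar>"
    by (intro tendsto_rabs dq_tendsto_dderiv assms(2)) auto
  then show ?thesis by (rule LIMSEQ_le_const2) (use dq_bound[OF assms(1)] in auto)
qed

lemma integral_dderiv_swap:
  fixes P b :: "'a::euclidean_space \<Rightarrow> real"
  assumes P: "L-lipschitz_on UNIV P" "bounded {x. P x \<noteq> 0}" and b: "M-lipschitz_on UNIV b"
  shows "(\<integral>x. dderiv e2 b x * dderiv e1 P x \<partial>lebesgue) = (\<integral>x. dderiv e1 b x * dderiv e2 P x \<partial>lebesgue)"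
proof -
  define h where "h n = 1 / real (Suc n)" for n
  have h: "h \<longlonglongrightarrow> 0" "(\<lambda>n. - h n) \<longlonglongrightarrow> 0" "h n \<noteq> 0" "\<bar>h n\<bar> \<le> 1" for n
  proof -
    show "h \<longlonglongrightarrow> 0" using LIMSEQ_inverse_real_of_nat by (simp add: h_def[abs_def] inverse_eq_divide)
    from tendsto_minus[OF this] show "(\<lambda>n. - h n) \<longlonglongrightarrow> 0" by simp
  qed (auto simp: h_def)
  obtain R where R: "\<And>x. P x \<noteq> 0 \<Longrightarrow> norm x \<le> R" using P(2) by (auto simp: bounded_iff)
  \<comment> \<open>The steps are at most 1 in size, so the quotient of \<open>P\<close> is
    supported in the ball enlarged by \<open>norm e'\<close>; there the Lipschitz constants bound
    both factors, and dominated convergence applies.\<close>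
  have lim: "(\<lambda>n. \<integral>x. dq (- h n) e b x * dq (h n) e' P x \<partial>lebesgue)
      \<longlonglongrightarrow> (\<integral>x. dderiv e b x * dderiv e' P x \<partial>lebesgue)" for e e'
  proof (rule integral_dominated_convergence[where w = "\<lambda>x. (M * norm e * (L * norm e')) * indicator (cball 0 (R + norm e')) x"])
    show "(\<lambda>x. dderiv e b x * dderiv e' P x) \<in> borel_measurable lebesgue"
      using borel_measurable_dderiv[OF P(1)] borel_measurable_dderiv[OF b] by auto
    show "(\<lambda>x. dq (- h n) e b x * dq (h n) e' P x) \<in> borel_measurable lebesgue" for n
      using borel_measurable_dq[OF P(1)] borel_measurable_dq[OF b] by auto
    show "integrable lebesgue (\<lambda>x. (M * norm e * (L * norm e')) * indicator (cball 0 (R + norm e')) x)"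
      using fmeasurableD2[OF lmeasurable_cball] by (intro integrable_mult_right integrable_real_indicator) (auto simp: less_top)
    show "AE x in lebesgue. (\<lambda>n. dq (- h n) e b x * dq (h n) e' P x) \<longlonglongrightarrow> dderiv e b x * dderiv e' P x"
      using AE_dderiv[OF b, of e] AE_dderiv[OF P(1), of e']
      by eventually_elim (intro tendsto_mult dq_tendsto_dderiv; use h in simp)
    show "AE x in lebesgue. norm (dq (- h n) e b x * dq (h n) e' P x)
        \<le> (M * norm e * (L * norm e')) * indicator (cball 0 (R + norm e')) x" for n
    proof (rule AE_I2)
      fix x
      show "norm (dq (- h n) e b x * dq (h n) e' P x)
        \<le> (M * norm e * (L * norm e')) * indicator (cball 0 (R + norm e')) x"
      proof (cases "norm x \<le> R + norm e'")
        case True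
        have "\<bar>dq (- h n) e b x\<bar> * \<bar>dq (h n) e' P x\<bar> \<le> (M * norm e) * (L * norm e')"
          using lipschitz_on_nonneg[OF b] by (intro mult_mono dq_bound P(1) b) auto
        with True show ?thesis by (simp add: abs_mult)
      next
        case False
        have "norm x \<le> norm (x + h n *\<^sub>R e') + norm (h n *\<^sub>R e')"
          using norm_triangle_ineq4[of "x + h n *\<^sub>R e'" "h n *\<^sub>R e'"] by simp
        also have "norm (h n *\<^sub>R e') \<le> norm e'" using h(4)[of n] by (simp add: mult_left_le_one_le)
        finally have "\<not> norm (x + h n *\<^sub>R e') \<le> R" using False by simp
        moreover have "\<not> norm x \<le> R" using False norm_ge_zero[of e'] by linarith
        ultimately have "P (x + h n *\<^sub>R e') = 0" "P x = 0" using R by blast+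
        with False show ?thesis by (simp add: dq_def)
      qed
    qed
  qed
  have c: "continuous_on UNIV P" "continuous_on UNIV b"
    using P(1) b lipschitz_on_continuous_on by blast+
  have "(\<integral>x. dq k e b x * dq l e' P x \<partial>lebesgue) = (\<integral>x. dq k e b x * dq l e' P x \<partial>lborel)" for k l e e'
    using continuous_on_dq[OF c(1)] continuous_on_dq[OF c(2)]
    by (intro integral_completion borel_measurable_times) (auto intro: borel_measurable_continuous_onI)
  then have "(\<lambda>n. \<integral>x. dq (- h n) e2 b x * dq (h n) e1 P x \<partial>lebesgue)
      = (\<lambda>n. \<integral>x. dq (- h n) e1 b x * dq (h n) e2 P x \<partial>lebesgue)"
    using integral_dq_dq_swap[OF c(1) P(2) c(2)] by simp
  with lim[of e2 e1] lim[of e1 e2] show ?thesis using LIMSEQ_unique by fastforce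
qed

section \<open>Products of Lipschitz functions and integration by parts\<close>

lemma bounded_range_if_bounded_support:
  fixes \<phi> :: "'a::euclidean_space \<Rightarrow> real"
  assumes "continuous_on UNIV \<phi>" "bounded {x. \<phi> x \<noteq> 0}"
  obtains B where "\<And>x. \<bar>\<phi> x\<bar> \<le> B"
proof -
  obtain R where R: "{x. \<phi> x \<noteq> 0} \<subseteq> cball 0 R" using bounded_subset_ballD[OF assms(2), of 0] ball_subset_cball by (metis order_trans)
  have "compact (\<phi> ` cball 0 R)"
    by (intro compact_continuous_image continuous_on_subset[OF assms(1)]) auto
  then obtain B where B: "\<And>x. x \<in> cball 0 R \<Longrightarrow> \<bar>\<phi> x\<bar> \<le> B"
    by (fastforce dest!: compact_imp_bounded simp: bounded_iff)
  have "\<bar>\<phi> x\<bar> \<le> max 0 B" for x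
    using B[of x] R by (cases "\<phi> x = 0") auto
  then show thesis by (rule that)
qed

text \<open>A product of Lipschitz functions is Lipschitz once the factors are bounded, but
  \<open>a\<close> is bounded only near the support of \<open>\<phi>\<close>.\<close>

lemma lipschitz_on_mult_bounded_support:
  fixes \<phi> a :: "'a::euclidean_space \<Rightarrow> real"
  assumes \<phi>: "L-lipschitz_on UNIV \<phi>" "bounded {x. \<phi> x \<noteq> 0}" and a: "M-lipschitz_on UNIV a"
  shows "\<exists>K. K-lipschitz_on UNIV (\<lambda>x. \<phi> x * a x)"
proof -
  obtain R where R: "\<And>x. \<phi> x \<noteq> 0 \<Longrightarrow> norm x \<le> R" using \<phi>(2) by (auto simp: bounded_iff)
  have "compact (a ` cball 0 R)"
    by (intro compact_continuous_image continuous_on_subset[OF lipschitz_on_continuous_on[OF a]]) auto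
  then obtain A where A: "\<And>x. x \<in> cball 0 R \<Longrightarrow> \<bar>a x\<bar> \<le> A"
    by (fastforce dest!: compact_imp_bounded simp: bounded_iff)
  obtain B' where B': "\<And>x. \<bar>\<phi> x\<bar> \<le> B'"
    using bounded_range_if_bounded_support[OF lipschitz_on_continuous_on[OF \<phi>(1)] \<phi>(2)] by blast
  define A' where "A' = max 0 A"
  have A': "\<phi> x \<noteq> 0 \<Longrightarrow> \<bar>a x\<bar> \<le> A'" for x
    using A[of x] R[of x] by (auto simp: A'_def)
  have "0 \<le> B'" using B'[of 0] by linarith
  have nn: "0 \<le> L" "0 \<le> M" "0 \<le> A'" "0 \<le> B'"
    using lipschitz_on_nonneg[OF \<phi>(1)] lipschitz_on_nonneg[OF a] \<open>0 \<le> B'\<close> by (auto simp: A'_def)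
  \<comment> \<open>The splitting evaluates \<open>a\<close> only at \<open>x\<close>, where
    \<open>\<phi> x \<noteq> 0\<close> makes it bounded; at \<open>y\<close> only the bound on
    \<open>\<phi>\<close> is used. By symmetry one of the two points being in the support
    suffices.\<close>
  have main: "\<bar>\<phi> x * a x - \<phi> y * a y\<bar> \<le> (L * A' + B' * M) * dist x y" if "\<phi> x \<noteq> 0" for x y
  proof -
    have "\<bar>\<phi> x * a x - \<phi> y * a y\<bar> = \<bar>(\<phi> x - \<phi> y) * a x + \<phi> y * (a x - a y)\<bar>" by (simp add: algebra_simps)
    also have "\<dots> \<le> \<bar>\<phi> x - \<phi> y\<bar> * \<bar>a x\<bar> + \<bar>\<phi> y\<bar> * \<bar>a x - a y\<bar>"
      by (metis abs_mult abs_triangle_ineq)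
    also have "\<dots> \<le> (L * dist x y) * A' + B' * (M * dist x y)"
      using lipschitz_onD[OF \<phi>(1), of x y] lipschitz_onD[OF a, of x y] A'[OF that] B'[of y] nn
      by (intro add_mono mult_mono) (auto simp: dist_real_def)
    finally show ?thesis by (simp add: algebra_simps)
  qed
  have "(L * A' + B' * M)-lipschitz_on UNIV (\<lambda>x. \<phi> x * a x)"
  proof (rule lipschitz_onI)
    fix x y
    consider "\<phi> x \<noteq> 0" | "\<phi> y \<noteq> 0" | "\<phi> x = 0" "\<phi> y = 0" by blast
    then show "dist (\<phi> x * a x) (\<phi> y * a y) \<le> (L * A' + B' * M) * dist x y"
    proof cases
      case 2
      then show ?thesis using main[of y x] by (simp add: dist_real_def dist_commute abs_minus_commute)
    qed (use main[of x y] nn in \<open>auto simp: dist_real_def\<close>)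
  qed (use nn in auto)
  then show ?thesis by blast
qed

lemma dderiv_mult:
  assumes "((\<lambda>t. f (x + t *\<^sub>R e)) has_field_derivative dderiv e f x) (at 0)"
    and "((\<lambda>t. g (x + t *\<^sub>R e)) has_field_derivative dderiv e g x) (at 0)"
  shows "dderiv e (\<lambda>y. f y * g y) x = f x * dderiv e g x + dderiv e f x * g x"
proof -
  have "((\<lambda>t. f (x + t *\<^sub>R e) * g (x + t *\<^sub>R e)) has_field_derivative
      f x * dderiv e g x + dderiv e f x * g x) (at 0)"
    using DERIV_mult[OF assms] by (simp add: add.commute mult.commute)
  then show ?thesis by (subst dderiv_def) (rule DERIV_imp_deriv)
qed

lemma integrable_lebesgue_bounded_support:
  fixes f :: "'a::euclidean_space \<Rightarrow> real"
  assumes f: "f \<in> borel_measurable lebesgue" and B: "AE x in lebesgue. \<bar>f x\<bar> \<le> B"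
    and R: "\<And>x. norm x > R \<Longrightarrow> f x = 0"
  shows "integrable lebesgue f"
proof (rule Bochner_Integration.integrable_bound)
  show "integrable lebesgue (\<lambda>x. B * indicator (cball 0 R) x :: real)"
    using fmeasurableD2[OF lmeasurable_cball] by (intro integrable_mult_right integrable_real_indicator) (auto simp: less_top)
  show "AE x in lebesgue. norm (f x) \<le> norm (B * indicator (cball 0 R) x :: real)"
    using B by eventually_elim (use R in \<open>auto simp: indicator_def not_le\<close>)
qed (rule f)

text \<open>\<open>integral_dderiv_swap\<close> for the product of \<open>\<phi>\<close> and
  \<open>a\<close>, expanded by the product rule. On the right \<open>a\<close> appears
  undifferentiated, so a weakly convergent derivative will only be multiplied by factors that
  converge strongly or stay fixed.\<close>

lemma integral_minor_by_parts:
  fixes \<phi> a b :: "'a::euclidean_space \<Rightarrow> real"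
  assumes \<phi>: "L-lipschitz_on UNIV \<phi>" "bounded {x. \<phi> x \<noteq> 0}"
    and a: "M-lipschitz_on UNIV a" and b: "N-lipschitz_on UNIV b"
  shows "(\<integral>x. \<phi> x * (dderiv e1 a x * dderiv e2 b x - dderiv e2 a x * dderiv e1 b x) \<partial>lebesgue)
    = - (\<integral>x. a x * (dderiv e1 \<phi> x * dderiv e2 b x - dderiv e2 \<phi> x * dderiv e1 b x) \<partial>lebesgue)"
proof -
  obtain K where P: "K-lipschitz_on UNIV (\<lambda>x. \<phi> x * a x)"
    using lipschitz_on_mult_bounded_support[OF \<phi> a] by blast
  have bP: "bounded {x. \<phi> x * a x \<noteq> 0}" by (rule bounded_subset[OF \<phi>(2)]) auto
  obtain R where R: "\<And>x. \<phi> x \<noteq> 0 \<Longrightarrow> norm x \<le> R" using \<phi>(2) by (auto simp: bounded_iff)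
  note m = borel_measurable_dderiv[OF \<phi>(1)] borel_measurable_dderiv[OF a] borel_measurable_dderiv[OF b]
    borel_measurable_dderiv[OF P]
  have m0: "\<phi> \<in> borel_measurable lebesgue" "a \<in> borel_measurable lebesgue"
    using lipschitz_on_continuous_on[OF \<phi>(1)] lipschitz_on_continuous_on[OF a]
    by (auto intro!: measurable_completion borel_measurable_continuous_onI)
  have i: "integrable lebesgue (\<lambda>x. dderiv e b x * dderiv e' (\<lambda>x. \<phi> x * a x) x)" for e e'
  proof (rule integrable_lebesgue_bounded_support[where R = R and B = "(N * norm e) * (K * norm e')"])
    show "AE x in lebesgue. \<bar>dderiv e b x * dderiv e' (\<lambda>x. \<phi> x * a x) x\<bar> \<le> (N * norm e) * (K * norm e')"
      using AE_dderiv[OF b, of e] AE_dderiv[OF P, of e']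
    proof eventually_elim
      case (elim x)
      show ?case unfolding abs_mult
        using lipschitz_on_nonneg[OF b] by (intro mult_mono dderiv_bound b P elim) auto
    qed
    show "dderiv e b x * dderiv e' (\<lambda>x. \<phi> x * a x) x = 0" if "R < norm x" for x
      using dderiv_cong[of "{y. R < norm y}" x "\<lambda>x. \<phi> x * a x" "\<lambda>_. 0" e'] R that by (force simp: dderiv_const open_Collect_less continuous_intros)
  qed (intro borel_measurable_times m)
  obtain B where B: "\<And>x. \<bar>\<phi> x\<bar> \<le> B"
    using bounded_range_if_bounded_support[OF lipschitz_on_continuous_on[OF \<phi>(1)] \<phi>(2)] by blast
  have j: "integrable lebesgue (\<lambda>x. \<phi> x * (dderiv e a x * dderiv e' b x))" for e e'
  proof (rule integrable_lebesgue_bounded_support[where R = R and B = "B * ((M * norm e) * (N * norm e'))"])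
    show "AE x in lebesgue. \<bar>\<phi> x * (dderiv e a x * dderiv e' b x)\<bar> \<le> B * ((M * norm e) * (N * norm e'))"
      using AE_dderiv[OF b, of e'] AE_dderiv[OF a, of e]
    proof eventually_elim
      case (elim x)
      have "0 \<le> B" using B[of 0] by linarith
      then show ?case unfolding abs_mult
        using lipschitz_on_nonneg[OF a] by (intro mult_mono dderiv_bound b a elim B) auto
    qed
    show "\<phi> x * (dderiv e a x * dderiv e' b x) = 0" if "R < norm x" for x
      using that R[of x] by force
  qed (intro borel_measurable_times m m0)
  \<comment> \<open>\<open>S\<close> is the integrand whose integral vanishes by the swap; by the
    product rule \<open>S - T\<close> is the integrand on the right-hand side of the claim.\<close>
  define T where "T x = \<phi> x * (dderiv e1 a x * dderiv e2 b x - dderiv e2 a x * dderiv e1 b x)" for x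
  define S where "S x = dderiv e2 b x * dderiv e1 (\<lambda>x. \<phi> x * a x) x - dderiv e1 b x * dderiv e2 (\<lambda>x. \<phi> x * a x) x" for x
  have T: "integrable lebesgue T"
    unfolding T_def[abs_def] right_diff_distrib by (intro Bochner_Integration.integrable_diff j)
  have S: "integrable lebesgue S"
    unfolding S_def[abs_def] by (intro Bochner_Integration.integrable_diff i)
  have "(\<integral>x. S x \<partial>lebesgue) = 0"
    unfolding S_def using integral_dderiv_swap[OF P bP b, of e2 e1] i by simp
  moreover have "(\<integral>x. a x * (dderiv e1 \<phi> x * dderiv e2 b x - dderiv e2 \<phi> x * dderiv e1 b x) \<partial>lebesgue) = (\<integral>x. S x - T x \<partial>lebesgue)"
  proof (rule integral_cong_AE)
    show "AE x in lebesgue. a x * (dderiv e1 \<phi> x * dderiv e2 b x - dderiv e2 \<phi> x * dderiv e1 b x) = S x - T x"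
      using AE_dderiv[OF a, of e1] AE_dderiv[OF \<phi>(1), of e1] AE_dderiv[OF a, of e2] AE_dderiv[OF \<phi>(1), of e2]
      by eventually_elim (simp add: S_def T_def dderiv_mult algebra_simps)
  qed (use S T in \<open>auto intro!: borel_measurable_times borel_measurable_diff m m0\<close>)
  ultimately show ?thesis using S T by (simp add: T_def[symmetric])
qed

section \<open>Weak-* convergence of minors\<close>

text \<open>McShane's extension, the infimum of the cones \<open>f y + L * dist x y\<close>. It
  keeps the constant \<open>L\<close>, so one constant still serves a whole sequence.\<close>

lemma lipschitz_extension:
  fixes f :: "'a::metric_space \<Rightarrow> real"
  assumes f: "L-lipschitz_on S f"
  obtains F where "L-lipschitz_on UNIV F" "\<And>x. x \<in> S \<Longrightarrow> F x = f x"
proof (cases "S = {}")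
  case True
  then show ?thesis
    using that[of "\<lambda>_. 0"] lipschitz_on_nonneg[OF f] by (auto simp: lipschitz_on_def)
next
  case False
  then obtain z where z: "z \<in> S" by auto
  have L: "0 \<le> L" using f by (rule lipschitz_on_nonneg)
  have fd: "f x \<le> f y + L * dist x y" if "x \<in> S" "y \<in> S" for x y
    using lipschitz_onD[OF f that] by (simp add: dist_real_def)
  define F where "F x = (INF y\<in>S. f y + L * dist x y)" for x
  have bdd: "bdd_below ((\<lambda>y. f y + L * dist x y) ` S)" for x
  proof (rule bdd_belowI2)
    fix y assume "y \<in> S"
    have "f z \<le> f y + L * dist z y" using fd z \<open>y \<in> S\<close> by blast
    also have "\<dots> \<le> f y + L * (dist x z + dist x y)"
      using L dist_triangle2[of z y x] by (simp add: mult_left_mono dist_commute)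
    finally show "f z - L * dist x z \<le> f y + L * dist x y" by (simp add: algebra_simps)
  qed
  have le: "F x \<le> F x' + L * dist x x'" for x x'
  proof -
    have "F x - L * dist x x' \<le> F x'"
      unfolding F_def[of x']
    proof (rule cINF_greatest[OF False])
      fix y assume "y \<in> S"
      then have "F x \<le> f y + L * dist x y" unfolding F_def by (intro cINF_lower bdd)
      also have "\<dots> \<le> f y + L * (dist x x' + dist x' y)"
        using L by (intro add_left_mono mult_left_mono dist_triangle)
      finally show "F x - L * dist x x' \<le> f y + L * dist x' y" by (simp add: algebra_simps)
    qed
    then show ?thesis by simp
  qed
  show ?thesis
  proof (rule that)
    show "L-lipschitz_on UNIV F"
    proof (rule lipschitz_onI)
      show "dist (F x) (F y) \<le> L * dist x y" for x y
        using le[of x y] le[of y x] by (auto simp: dist_real_def dist_commute abs_le_iff)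
    qed (rule L)
    show "F x = f x" if "x \<in> S" for x
    proof (rule antisym)
      show "F x \<le> f x" using cINF_lower[OF bdd that, of x] by (simp add: F_def)
      show "f x \<le> F x" unfolding F_def using fd that by (intro cINF_greatest[OF False]) auto
    qed
  qed
qed

text \<open>Weak-* convergence on \<open>\<Omega>\<close> phrased with integrals over the whole
  space: the test functions vanish off \<open>\<Omega>\<close>, so globally defined extensions can
  be inserted without truncation.\<close>

definition wconv :: "'a::euclidean_space set \<Rightarrow> (nat \<Rightarrow> 'a \<Rightarrow> real) \<Rightarrow> ('a \<Rightarrow> real) \<Rightarrow> bool" where
  "wconv \<Omega> f F \<longleftrightarrow> (\<forall>\<psi>. integrable lebesgue \<psi> \<longrightarrow> (\<forall>x. x \<notin> \<Omega> \<longrightarrow> \<psi> x = 0) \<longrightarrow>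
     (\<lambda>n. \<integral>x. \<psi> x * f n x \<partial>lebesgue) \<longlonglongrightarrow> (\<integral>x. \<psi> x * F x \<partial>lebesgue))"

section \<open>Bounded sequences tested against a dense class\<close>

lemma integrable_mult_bounded:
  fixes \<psi> f :: "'a \<Rightarrow> real"
  assumes "integrable M \<psi>" "f \<in> borel_measurable M" "AE x in M. \<bar>f x\<bar> \<le> B"
  shows "integrable M (\<lambda>x. \<psi> x * f x)"
proof (rule Bochner_Integration.integrable_bound)
  show "integrable M (\<lambda>x. B * \<psi> x)" using assms(1) by simp
  show "AE x in M. norm (\<psi> x * f x) \<le> norm (B * \<psi> x)"
    using assms(3)
  proof eventually_elim
    case (elim x)
    then have "\<bar>\<psi> x\<bar> * \<bar>f x\<bar> \<le> \<bar>\<psi> x\<bar> * \<bar>B\<bar>" by (intro mult_left_mono) auto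
    then show ?case by (simp add: abs_mult mult.commute)
  qed
qed (use assms in auto)

text \<open>Under a common essential bound on \<open>D\<close>, the integrable functions whose
  pairing with \<open>D n\<close> tends to zero form a closed subspace of L^1. Convergence therefore
  has to be verified on a dense class only.\<close>

locale bounded_sequence =
  fixes M :: "'a measure" and D :: "nat \<Rightarrow> 'a \<Rightarrow> real" and B :: real
  assumes meas: "\<And>n. D n \<in> borel_measurable M" and bound: "\<And>n. AE x in M. \<bar>D n x\<bar> \<le> B"
    and B: "0 \<le> B"
begin

definition annihilator :: "('a \<Rightarrow> real) set" where
  "annihilator = {\<psi>. integrable M \<psi> \<and> (\<lambda>n. \<integral>x. \<psi> x * D n x \<partial>M) \<longlonglongrightarrow> 0}"

lemma integrable_D: "integrable M \<psi> \<Longrightarrow> integrable M (\<lambda>x. \<psi> x * D n x)"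
  by (rule integrable_mult_bounded[OF _ meas bound])

lemma annihilator_scale: "\<psi> \<in> annihilator \<Longrightarrow> (\<lambda>x. c * \<psi> x) \<in> annihilator"
  using tendsto_mult_right_zero[of _ sequentially c] by (auto simp: annihilator_def mult.assoc)

lemma annihilator_add: "\<psi> \<in> annihilator \<Longrightarrow> \<eta> \<in> annihilator \<Longrightarrow> (\<lambda>x. \<psi> x + \<eta> x) \<in> annihilator"
  using tendsto_add[of _ 0 sequentially _ 0]
  by (auto simp: annihilator_def distrib_right integrable_D)

text \<open>Replacing \<open>\<psi>\<close> by \<open>\<phi>\<close> changes the pairing with
  \<open>D n\<close> by at most \<open>B\<close> times their L^1 distance, uniformly in
  \<open>n\<close>.\<close>

lemma annihilator_closed:
  assumes \<psi>: "integrable M \<psi>"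
    and appr: "\<And>e. 0 < e \<Longrightarrow> \<exists>\<phi>\<in>annihilator. (\<integral>x. \<bar>\<psi> x - \<phi> x\<bar> \<partial>M) < e"
  shows "\<psi> \<in> annihilator"
proof -
  have "(\<lambda>n. \<integral>x. \<psi> x * D n x \<partial>M) \<longlonglongrightarrow> 0"
  proof (rule LIMSEQ_I)
    fix e :: real assume "0 < e"
    define e' where "e' = e / (2 * (B + 1))"
    have e': "0 < e'" "B * e' < e / 2" using \<open>0 < e\<close> B by (auto simp: e'_def field_simps)
    obtain \<phi> where \<phi>: "\<phi> \<in> annihilator" "(\<integral>x. \<bar>\<psi> x - \<phi> x\<bar> \<partial>M) < e'" using appr[OF e'(1)] by auto
    then have i\<phi>: "integrable M \<phi>" by (simp add: annihilator_def)
    obtain N where N: "\<And>n. n \<ge> N \<Longrightarrow> \<bar>\<integral>x. \<phi> x * D n x \<partial>M\<bar> < e / 2"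
      using \<phi>(1) \<open>0 < e\<close> LIMSEQ_D[of "\<lambda>n. \<integral>x. \<phi> x * D n x \<partial>M" 0 "e / 2"] by (auto simp: annihilator_def)
    have "norm ((\<integral>x. \<psi> x * D n x \<partial>M) - 0) < e" if "n \<ge> N" for n
    proof -
      have "(\<integral>x. \<psi> x * D n x \<partial>M) - (\<integral>x. \<phi> x * D n x \<partial>M) = (\<integral>x. (\<psi> x - \<phi> x) * D n x \<partial>M)"
        using integrable_D[OF \<psi>] integrable_D[OF i\<phi>] by (simp add: left_diff_distrib)
      moreover have "\<bar>\<integral>x. (\<psi> x - \<phi> x) * D n x \<partial>M\<bar> \<le> (\<integral>x. \<bar>(\<psi> x - \<phi> x) * D n x\<bar> \<partial>M)"
        by (rule integral_abs_bound)
      moreover have "(\<integral>x. \<bar>(\<psi> x - \<phi> x) * D n x\<bar> \<partial>M) \<le> (\<integral>x. B * \<bar>\<psi> x - \<phi> x\<bar> \<partial>M)"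
      proof (rule integral_mono_AE)
        show "integrable M (\<lambda>x. \<bar>(\<psi> x - \<phi> x) * D n x\<bar>)"
          using \<psi> i\<phi> by (intro integrable_abs integrable_D) auto
        show "AE x in M. \<bar>(\<psi> x - \<phi> x) * D n x\<bar> \<le> B * \<bar>\<psi> x - \<phi> x\<bar>"
          using bound[of n] by eventually_elim (simp add: abs_mult mult.commute mult_right_mono)
      qed (use \<psi> i\<phi> in auto)
      moreover have "(\<integral>x. B * \<bar>\<psi> x - \<phi> x\<bar> \<partial>M) \<le> B * e'"
        using \<phi>(2) B by (simp add: mult_left_mono)
      ultimately show ?thesis using N[OF that] e'(2) unfolding real_norm_def by linarith
    qed
    then show "\<exists>N. \<forall>n\<ge>N. norm ((\<integral>x. \<psi> x * D n x \<partial>M) - 0) < e" by blast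
  qed
  then show ?thesis using \<psi> by (simp add: annihilator_def)
qed

lemma annihilator_dominated:
  assumes "\<And>k. s k \<in> annihilator" "\<psi> \<in> borel_measurable M" "integrable M w"
    and lim: "\<And>x. x \<in> space M \<Longrightarrow> (\<lambda>k. s k x) \<longlonglongrightarrow> \<psi> x"
    and dom: "\<And>k x. x \<in> space M \<Longrightarrow> \<bar>s k x\<bar> \<le> w x"
  shows "\<psi> \<in> annihilator"
proof (rule annihilator_closed)
  have s: "integrable M (s k)" for k using assms(1) by (simp add: annihilator_def)
  show i: "integrable M \<psi>"
    by (rule integrable_dominated_convergence[where s = s and w = w]) (use assms s in auto)
  have "(\<lambda>k. \<integral>x. \<bar>\<psi> x - s k x\<bar> \<partial>M) \<longlonglongrightarrow> (\<integral>x. 0 \<partial>M)"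
  proof (rule integral_dominated_convergence[where w = "\<lambda>x. \<bar>\<psi> x\<bar> + w x"])
    show "AE x in M. (\<lambda>k. \<bar>\<psi> x - s k x\<bar>) \<longlonglongrightarrow> 0"
    proof (rule AE_I2)
      fix x assume "x \<in> space M"
      from tendsto_rabs[OF tendsto_diff[OF tendsto_const[of "\<psi> x"] lim[OF this]]]
      show "(\<lambda>k. \<bar>\<psi> x - s k x\<bar>) \<longlonglongrightarrow> 0" by simp
    qed
    show "AE x in M. norm \<bar>\<psi> x - s k x\<bar> \<le> \<bar>\<psi> x\<bar> + w x" for k
    proof (rule AE_I2)
      fix x assume "x \<in> space M"
      from dom[OF this, of k] show "norm \<bar>\<psi> x - s k x\<bar> \<le> \<bar>\<psi> x\<bar> + w x" by simp
    qed
  qed (use i s assms(3) borel_measurable_integrable in auto)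
  then have "(\<lambda>k. \<integral>x. \<bar>\<psi> x - s k x\<bar> \<partial>M) \<longlonglongrightarrow> 0" by simp
  show "\<exists>\<phi>\<in>annihilator. (\<integral>x. \<bar>\<psi> x - \<phi> x\<bar> \<partial>M) < e" if "0 < e" for e
    using eventually_happens[OF order_tendstoD(2)[OF \<open>(\<lambda>k. \<integral>x. \<bar>\<psi> x - s k x\<bar> \<partial>M) \<longlonglongrightarrow> 0\<close> that]] assms(1)
    by auto
qed

end

text \<open>The tent equal to 1 on \<open>K\<close> and, for nonempty \<open>K\<close> and
  \<open>c > 0\<close>, to 0 from distance 1/c onwards; with growing \<open>c\<close> these
  functions decrease to the indicator of a compact \<open>K\<close>.\<close>

lemma lipschitz_cutoff:
  fixes K :: "'a::euclidean_space set"
  assumes "0 \<le> c"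
  shows "c-lipschitz_on UNIV (\<lambda>x. max 0 (1 - c * infdist x K))"
proof (rule lipschitz_onI)
  fix x y
  have "\<bar>c * infdist x K - c * infdist y K\<bar> \<le> c * dist x y"
    using infdist_triangle_abs[of x K y] assms by (simp add: right_diff_distrib[symmetric] abs_mult mult_left_mono)
  then show "dist (max 0 (1 - c * infdist x K)) (max 0 (1 - c * infdist y K)) \<le> c * dist x y"
    by (auto simp: dist_real_def abs_if max_def split: if_splits)
qed (rule assms)

text \<open>The annihilator is enlarged step by step: from Lipschitz cutoffs to indicators of
  compact sets by dominated convergence, to measurable subsets of \<open>\<Omega>\<close> by inner
  regularity, and to integrable functions by linearity and limits.\<close>

lemma annihilator_dense:
  fixes \<Omega> :: "'a::euclidean_space set"
  assumes "bounded_sequence lebesgue D B" and \<Omega>: "open \<Omega>" "bounded \<Omega>"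
    and test: "\<And>\<phi> L K. L-lipschitz_on UNIV \<phi> \<Longrightarrow> compact K \<Longrightarrow> K \<subseteq> \<Omega> \<Longrightarrow> (\<And>x. x \<notin> K \<Longrightarrow> \<phi> x = 0) \<Longrightarrow>
      (\<lambda>n. \<integral>x. \<phi> x * D n x \<partial>lebesgue) \<longlonglongrightarrow> 0"
    and \<psi>: "integrable lebesgue \<psi>" "\<And>x. x \<notin> \<Omega> \<Longrightarrow> \<psi> x = 0"
  shows "(\<lambda>n. \<integral>x. \<psi> x * D n x \<partial>lebesgue) \<longlonglongrightarrow> 0"
proof -
  interpret bounded_sequence lebesgue D B by fact
  have cpt: "(indicator K :: 'a \<Rightarrow> real) \<in> annihilator" if K: "compact K" "K \<subseteq> \<Omega>" for K
  proof (cases "K = {}")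
    case True
    then show ?thesis by (simp add: annihilator_def)
  next
    case False
    obtain d where d: "d > 0" "(\<Union>x\<in>K. ball x d) \<subseteq> \<Omega>"
      using compact_subset_open_imp_ball_epsilon_subset[OF K(1) \<Omega>(1) K(2)] by blast
    \<comment> \<open>Slopes at least \<open>2 / d\<close> confine all cutoffs to the compact
      \<open>d / 2\<close>-neighbourhood \<open>T\<close> of \<open>K\<close>, which lies in
      \<open>\<Omega>\<close>; slopes tending to infinity shrink them to \<open>K\<close>.\<close>
    define c where "c k = real (Suc k) * (2 / d)" for k
    define \<phi> where "\<phi> k x = max 0 (1 - c k * infdist x K)" for k x
    define T where "T = {x. infdist x K \<le> d / 2}"
    have "closed T" unfolding T_def by (intro closed_Collect_le continuous_intros)
    have attained: "\<exists>y\<in>K. infdist x K = dist x y" for x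
      using infdist_attains_inf[OF compact_imp_closed[OF K(1)] False] by blast
    have "T \<subseteq> \<Omega>"
    proof
      fix x assume "x \<in> T"
      then obtain y where "y \<in> K" "dist x y \<le> d / 2" using attained[of x] by (auto simp: T_def)
      then have "x \<in> ball y d" using d(1) by (simp add: dist_commute)
      then show "x \<in> \<Omega>" using d(2) \<open>y \<in> K\<close> by blast
    qed
    then have "compact T" using \<open>closed T\<close> \<Omega>(2) bounded_subset compact_eq_bounded_closed by blast
    have c: "2 / d \<le> c k" "0 < c k" for k
      using d(1) by (auto simp: c_def field_simps)
    have off: "\<phi> k x = 0" if "x \<notin> T" for k x
    proof -
      have "1 \<le> (2 / d) * infdist x K" using that d(1) by (simp add: T_def field_simps)
      also have "\<dots> \<le> c k * infdist x K" using c by (intro mult_right_mono infdist_nonneg)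
      finally show ?thesis by (simp add: \<phi>_def)
    qed
    have lip: "(c k)-lipschitz_on UNIV (\<phi> k)" for k
      unfolding \<phi>_def[abs_def] using c(2)[of k] by (intro lipschitz_cutoff) simp
    have bd: "\<bar>\<phi> k x\<bar> \<le> 1" for k x
      using c(2)[of k] infdist_nonneg[of x K] by (simp add: \<phi>_def)
    have w: "integrable lebesgue (indicator T :: 'a \<Rightarrow> real)"
      using lmeasurable_compact[OF \<open>compact T\<close>] by (intro integrable_real_indicator) (auto simp: fmeasurable_def)
    have dom: "\<bar>\<phi> k x\<bar> \<le> indicator T x" for k x
      using bd off by (auto simp: indicator_def)
    show ?thesis
    proof (rule annihilator_dominated[where s = \<phi> and w = "indicator T"])
      fix k
      have "\<phi> k \<in> borel_measurable lebesgue"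
        using lipschitz_on_continuous_on[OF lip] by (intro measurable_completion) (auto intro: borel_measurable_continuous_onI)
      then have "integrable lebesgue (\<phi> k)"
        by (rule Bochner_Integration.integrable_bound[OF w]) (use dom in auto)
      then show "\<phi> k \<in> annihilator"
        unfolding annihilator_def using test[OF lip \<open>compact T\<close> \<open>T \<subseteq> \<Omega>\<close> off] by simp
    next
      show "(indicator K :: 'a \<Rightarrow> real) \<in> borel_measurable lebesgue"
        using K(1) by (auto intro!: borel_measurable_indicator borel_compact)
      fix x
      show "(\<lambda>k. \<phi> k x) \<longlonglongrightarrow> indicator K x"
      proof (cases "x \<in> K")
        case True
        then show ?thesis by (simp add: \<phi>_def)
      next
        case False
        then have "0 < infdist x K"
          using infdist_pos_not_in_closed[OF compact_imp_closed[OF K(1)] \<open>K \<noteq> {}\<close>] by simp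
        define \<eta> where "\<eta> = (2 / d) * infdist x K"
        have "0 < \<eta>" using \<open>0 < infdist x K\<close> d(1) by (simp add: \<eta>_def)
        then obtain k0 :: nat where k0: "1 / \<eta> < real k0" using reals_Archimedean2 by blast
        have "\<phi> k x = 0" if "k \<ge> k0" for k
        proof -
          have "1 < real k0 * \<eta>" using k0 \<open>0 < \<eta>\<close> by (simp add: field_simps)
          also have "\<dots> \<le> real (Suc k) * \<eta>" using that \<open>0 < \<eta>\<close> by (intro mult_right_mono) auto
          finally have "1 < c k * infdist x K" by (simp only: c_def \<eta>_def mult.assoc)
          then show ?thesis by (simp add: \<phi>_def)
        qed
        then have "(\<lambda>k. \<phi> k x) \<longlonglongrightarrow> 0"
          by (intro tendsto_eventually) (auto simp: eventually_sequentially)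
        then show ?thesis using False by simp
      qed
    qed (use w dom in auto)
  qed
  have ind: "(indicator A :: 'a \<Rightarrow> real) \<in> annihilator" if A: "A \<in> sets lebesgue" "A \<subseteq> \<Omega>" for A
  proof (rule annihilator_closed)
    have Al: "A \<in> lmeasurable" using A \<Omega>(2) bounded_set_imp_lmeasurable bounded_subset by blast
    then show "integrable lebesgue (indicator A :: 'a \<Rightarrow> real)"
      by (intro integrable_real_indicator) (auto simp: fmeasurable_def)
    fix e :: real assume "0 < e"
    obtain T where T: "closed T" "T \<subseteq> A" "A - T \<in> lmeasurable" "emeasure lebesgue (A - T) < ennreal e"
      using sets_lebesgue_inner_closed[OF A(1) \<open>0 < e\<close>] by blast
    have "compact T" using T(1,2) A(2) \<Omega>(2) bounded_subset compact_eq_bounded_closed by blast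
    moreover have "(\<integral>x. \<bar>indicator A x - indicator T x :: real\<bar> \<partial>lebesgue) = (\<integral>x. indicator (A - T) x \<partial>lebesgue)"
      using T(2) by (intro Bochner_Integration.integral_cong) (auto simp: indicator_def)
    moreover have "measure lebesgue (A - T) < e"
      using T(3,4) by (simp add: emeasure_eq_measure2 ennreal_less_iff)
    ultimately show "\<exists>\<phi>\<in>annihilator. (\<integral>x. \<bar>indicator A x - \<phi> x\<bar> \<partial>lebesgue) < e"
      using cpt[of T] T(2,3) A(2) by (intro bexI[of _ "indicator T"]) (auto simp: fmeasurable_def)
  qed
  \<comment> \<open>The induction over integrable functions passes through functions that do not
    vanish off \<open>\<Omega>\<close>; the factor \<open>indicator \<Omega>\<close> restores this
    at every stage.\<close>
  have "(\<lambda>x. \<psi> x * indicator \<Omega> x) \<in> annihilator"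
    using \<psi>(1)
  proof (induction rule: integrable_induct)
    case (base A c)
    have "(\<lambda>x. c * indicator (A \<inter> \<Omega>) x) \<in> annihilator"
      using base \<Omega>(1) by (intro annihilator_scale ind) auto
    moreover have "c * indicator (A \<inter> \<Omega>) x = (indicator A x *\<^sub>R c) * indicator \<Omega> x" for x
      by (simp add: indicator_def)
    ultimately show ?case by simp
  next
    case (add f g)
    then show ?case using annihilator_add[OF add(3,4)] by (simp add: distrib_right)
  next
    case (lim f s)
    have i: "integrable lebesgue (\<lambda>x. 2 * \<bar>f x\<bar>)" using lim(4) by simp
    show ?case
    proof (rule annihilator_dominated[OF lim.IH _ i])
      show "(\<lambda>k. s k x * indicator \<Omega> x) \<longlonglongrightarrow> f x * indicator \<Omega> x" if "x \<in> space lebesgue" for x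
        by (intro tendsto_mult lim(2)[OF that] tendsto_const)
      show "\<bar>s k x * indicator \<Omega> x\<bar> \<le> 2 * \<bar>f x\<bar>" if "x \<in> space lebesgue" for k x
        using lim(3)[OF that, of k] by (auto simp: indicator_def)
      show "(\<lambda>x. f x * indicator \<Omega> x) \<in> borel_measurable lebesgue"
        using borel_measurable_integrable[OF lim(4)] \<Omega>(1) by (intro borel_measurable_times borel_measurable_indicator) auto
    qed
  qed
  moreover have "\<psi> x * indicator \<Omega> x = \<psi> x" for x by (cases "x \<in> \<Omega>") (simp_all add: \<psi>(2))
  ultimately show ?thesis by (simp add: annihilator_def)
qed

text \<open>Averages over a small ball converge by weak convergence, and the common Lipschitz
  constant keeps the difference of \<open>a n\<close> and \<open>A\<close> within
  \<open>2 * L * r\<close> of its value at the centre.\<close>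

lemma wconv_pointwise:
  fixes \<Omega> :: "'a::euclidean_space set"
  assumes a: "\<And>n. L-lipschitz_on UNIV (a n)" and A: "L-lipschitz_on UNIV A"
    and w: "wconv \<Omega> a A" and \<Omega>: "open \<Omega>" "x \<in> \<Omega>"
  shows "(\<lambda>n. a n x) \<longlonglongrightarrow> A x"
proof (rule LIMSEQ_I)
  fix e :: real assume "0 < e"
  have L: "0 \<le> L" using A by (rule lipschitz_on_nonneg)
  obtain r0 where r0: "r0 > 0" "cball x r0 \<subseteq> \<Omega>" using \<Omega> open_contains_cball by blast
  \<comment> \<open>This gives \<open>2 * L * r \<le> e / 2\<close>; \<open>e / 4\<close> goes to
    the averages, and the remaining slack makes the estimate strict. The \<open>L + 1\<close> covers
    \<open>L = 0\<close>.\<close>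
  define r where "r = min r0 (e / (4 * (L + 1)))"
  have r: "0 < r" "cball x r \<subseteq> \<Omega>" "2 * L * r < e / 2 + e / 4"
  proof -
    show "0 < r" using r0 \<open>0 < e\<close> L by (simp add: r_def)
    show "cball x r \<subseteq> \<Omega>" using r0(2) by (auto simp: r_def)
    have "2 * L * r \<le> 2 * L * (e / (4 * (L + 1)))" using L by (intro mult_left_mono) (auto simp: r_def)
    also have "\<dots> \<le> e / 2" using L \<open>0 < e\<close> by (simp add: field_simps)
    finally show "2 * L * r < e / 2 + e / 4" using \<open>0 < e\<close> by simp
  qed
  define V where "V = measure lebesgue (cball x r)"
  have V: "0 < V" unfolding V_def using content_cball_pos[OF r(1)] by simp
  define \<psi> where "\<psi> y = (indicator (cball x r) y :: real)" for y
  have \<psi>: "integrable lebesgue \<psi>"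
    unfolding \<psi>_def[abs_def] using lmeasurable_cball[of x r] by (intro integrable_real_indicator) (auto simp: fmeasurable_def)
  have conv: "(\<lambda>n. (\<integral>y. \<psi> y * a n y \<partial>lebesgue) - (\<integral>y. \<psi> y * A y \<partial>lebesgue)) \<longlonglongrightarrow> 0"
  proof -
    have "(\<lambda>n. \<integral>y. \<psi> y * a n y \<partial>lebesgue) \<longlonglongrightarrow> (\<integral>y. \<psi> y * A y \<partial>lebesgue)"
      by (rule w[unfolded wconv_def, rule_format, OF \<psi>]) (use r(2) in \<open>auto simp: \<psi>_def indicator_def\<close>)
    then show ?thesis by (simp add: LIM_zero)
  qed
  have int: "integrable lebesgue (\<lambda>y. \<psi> y * f y)" if "L-lipschitz_on UNIV f" for f
  proof -
    have "integrable lborel (\<lambda>y. \<psi> y * f y)"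
      using borel_integrable_compact[of "cball x r" f] lipschitz_on_continuous_on[OF that] continuous_on_subset
      by (auto simp: \<psi>_def)
    then show ?thesis using integrable_completion borel_measurable_integrable by blast
  qed
  have key: "V * \<bar>a n x - A x\<bar> \<le> \<bar>(\<integral>y. \<psi> y * a n y \<partial>lebesgue) - (\<integral>y. \<psi> y * A y \<partial>lebesgue)\<bar> + 2 * L * r * V" for n
  proof -
    define d where "d y = a n y - A y" for y
    have dd: "\<bar>d y - d x\<bar> \<le> 2 * L * r" if "y \<in> cball x r" for y
    proof -
      have "\<bar>a n y - a n x\<bar> \<le> L * dist y x" "\<bar>A y - A x\<bar> \<le> L * dist y x"
        using lipschitz_onD[OF a, of y x n] lipschitz_onD[OF A, of y x] by (auto simp: dist_real_def)
      moreover have "L * dist y x \<le> L * r" using that L by (intro mult_left_mono) (auto simp: dist_commute)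
      ultimately show ?thesis unfolding d_def by linarith
    qed
    have i: "integrable lebesgue (\<lambda>y. \<psi> y * d y)" "integrable lebesgue (\<lambda>y. \<psi> y * d x)"
      using int[OF a] int[OF A] \<psi> by (auto simp: d_def right_diff_distrib)
    have eq: "(\<integral>y. \<psi> y * d y \<partial>lebesgue) = (\<integral>y. \<psi> y * a n y \<partial>lebesgue) - (\<integral>y. \<psi> y * A y \<partial>lebesgue)"
      using int[OF a] int[OF A] by (simp add: d_def right_diff_distrib)
    have V': "(\<integral>y. \<psi> y \<partial>lebesgue) = V" by (simp add: \<psi>_def V_def)
    have "V * d x - (\<integral>y. \<psi> y * d y \<partial>lebesgue) = (\<integral>y. \<psi> y * d x - \<psi> y * d y \<partial>lebesgue)"
      using i by (simp add: V')
    also have "\<bar>\<dots>\<bar> \<le> (\<integral>y. \<bar>\<psi> y * d x - \<psi> y * d y\<bar> \<partial>lebesgue)" by (rule integral_abs_bound)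
    also have "\<dots> \<le> (\<integral>y. 2 * L * r * \<psi> y \<partial>lebesgue)"
    proof (rule integral_mono)
      show "\<bar>\<psi> y * d x - \<psi> y * d y\<bar> \<le> 2 * L * r * \<psi> y" for y
        using dd[of y] by (auto simp: \<psi>_def indicator_def abs_minus_commute)
      show "integrable lebesgue (\<lambda>y. \<bar>\<psi> y * d x - \<psi> y * d y\<bar>)" using i by auto
      show "integrable lebesgue (\<lambda>y. 2 * L * r * \<psi> y)" using \<psi> by auto
    qed
    also have "\<dots> = 2 * L * r * V" by (simp add: V')
    finally have "\<bar>V * d x\<bar> \<le> \<bar>(\<integral>y. \<psi> y * d y \<partial>lebesgue)\<bar> + 2 * L * r * V" by linarith
    then show ?thesis using V unfolding eq by (simp add: abs_mult) (simp add: d_def)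
  qed
  have "0 < V * (e / 4)" using V \<open>0 < e\<close> by simp
  from LIMSEQ_D[OF conv this] obtain N where
    N: "\<And>n. n \<ge> N \<Longrightarrow> \<bar>(\<integral>y. \<psi> y * a n y \<partial>lebesgue) - (\<integral>y. \<psi> y * A y \<partial>lebesgue)\<bar> < V * (e / 4)" by auto
  have "norm (a n x - A x) < e" if "n \<ge> N" for n
  proof -
    have "V * \<bar>a n x - A x\<bar> < V * (e / 4) + 2 * L * r * V" using key[of n] N[OF that] by linarith
    also have "\<dots> < V * (e / 4) + (e / 2 + e / 4) * V" using r(3) V by (intro add_strict_left_mono mult_strict_right_mono)
    also have "\<dots> = V * e" by (simp add: field_simps)
    finally show ?thesis using V by simp
  qed
  then show "\<exists>N. \<forall>n\<ge>N. norm (a n x - A x) < e" by blast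
qed

text \<open>Write \<open>a n\<close> as \<open>A\<close> plus the difference \<open>a n - A\<close>.
  The first part is weak convergence of \<open>h\<close> tested with \<open>A\<close> times
  \<open>g\<close>; the second tends to zero by dominated convergence, as \<open>h\<close> is
  bounded.\<close>

lemma wconv_mult_strong:
  fixes \<Omega> :: "'a::euclidean_space set"
  assumes K: "compact K" "K \<subseteq> \<Omega>"
    and g: "g \<in> borel_measurable lebesgue" "AE x in lebesgue. \<bar>g x\<bar> \<le> G" "\<And>x. x \<notin> K \<Longrightarrow> g x = 0"
    and a: "\<And>n. L-lipschitz_on UNIV (a n)" and A: "L-lipschitz_on UNIV A"
    and lim: "\<And>x. x \<in> K \<Longrightarrow> (\<lambda>n. a n x) \<longlonglongrightarrow> A x"
    and h: "\<And>n. h n \<in> borel_measurable lebesgue" "\<And>n. AE x in lebesgue. \<bar>h n x\<bar> \<le> N"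
    and w: "wconv \<Omega> h H"
  shows "(\<lambda>n. \<integral>x. a n x * (g x * h n x) \<partial>lebesgue) \<longlonglongrightarrow> (\<integral>x. A x * (g x * H x) \<partial>lebesgue)"
proof (cases "K = {}")
  case True
  then have "g = (\<lambda>_. 0)" using g(3) by auto
  then show ?thesis by simp
next
  case False
  then obtain x0 where x0: "x0 \<in> K" by auto
  have L: "0 \<le> L" using A by (rule lipschitz_on_nonneg)
  have "Bseq (\<lambda>n. a n x0 - A x0)" using lim[OF x0] LIM_zero convergentI Bseq_conv_Bfun convergent_imp_Bseq by blast
  then obtain C where C: "\<And>n. \<bar>a n x0 - A x0\<bar> \<le> C" by (auto simp: Bseq_def)
  obtain R where R: "\<And>x. x \<in> K \<Longrightarrow> dist x x0 \<le> R"
    using compact_imp_bounded[OF K(1)] unfolding bounded_any_center[where a = x0] by (auto simp: dist_commute)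
  \<comment> \<open>Convergence at the single point \<open>x0\<close> bounds the differences there,
    and the common Lipschitz constant spreads the bound over \<open>K\<close>.\<close>
  define W where "W = C + 2 * L * R"
  have d: "\<bar>a n x - A x\<bar> \<le> W" if "x \<in> K" for n x
  proof -
    have "\<bar>a n x - a n x0\<bar> \<le> L * dist x x0" "\<bar>A x - A x0\<bar> \<le> L * dist x x0"
      using lipschitz_onD[OF a, of x x0 n] lipschitz_onD[OF A, of x x0] by (auto simp: dist_real_def)
    moreover have "L * dist x x0 \<le> L * R" using R[OF that] L by (intro mult_left_mono)
    ultimately show ?thesis using C[of n] unfolding W_def by linarith
  qed
  have "\<exists>B. \<forall>x\<in>K. \<bar>A x\<bar> \<le> B"
    using compact_imp_bounded[OF compact_continuous_image[OF continuous_on_subset[OF lipschitz_on_continuous_on[OF A]] K(1)]]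
    by (auto simp: bounded_iff)
  then obtain B where B: "\<And>x. x \<in> K \<Longrightarrow> \<bar>A x\<bar> \<le> B" by auto
  have m: "a n \<in> borel_measurable lebesgue" "A \<in> borel_measurable lebesgue" for n
    using lipschitz_on_continuous_on[OF a] lipschitz_on_continuous_on[OF A]
    by (auto intro!: measurable_completion borel_measurable_continuous_onI simp: borel_measurable_continuous_onI)
  have iK: "integrable lebesgue (indicator K :: 'a \<Rightarrow> real)"
    using lmeasurable_compact[OF K(1)] by (intro integrable_real_indicator) (auto simp: fmeasurable_def)
  have "0 \<le> B" using B[OF x0] by linarith
  have "0 \<le> W" using d[OF x0, of 0] by linarith
  have iAg: "integrable lebesgue (\<lambda>x. A x * g x)"
  proof (rule Bochner_Integration.integrable_bound)
    show "integrable lebesgue (\<lambda>x. B * G * indicator K x :: real)" using iK by simp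
    show "AE x in lebesgue. norm (A x * g x) \<le> norm (B * G * indicator K x :: real)"
      using g(2)
    proof eventually_elim
      case (elim x)
      show ?case
      proof (cases "x \<in> K")
        case True
        then have "\<bar>A x\<bar> * \<bar>g x\<bar> \<le> B * G" using B elim \<open>0 \<le> B\<close> by (intro mult_mono) auto
        also have "\<dots> \<le> \<bar>B * G\<bar>" by simp
        finally show ?thesis using True by (simp add: abs_mult)
      qed (simp add: g(3))
    qed
  qed (use m g(1) in auto)
  have 1: "(\<lambda>n. \<integral>x. A x * g x * h n x \<partial>lebesgue) \<longlonglongrightarrow> (\<integral>x. A x * g x * H x \<partial>lebesgue)"
    by (rule w[unfolded wconv_def, rule_format, OF iAg]) (use g(3) K(2) in auto)
  have iW: "integrable lebesgue (\<lambda>x. W * G * N * indicator K x :: real)" using iK by simp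
  have ev: "AE x in lebesgue. \<bar>(a n x - A x) * (g x * h n x)\<bar> \<le> W * G * N * indicator K x" for n
    using g(2) h(2)[of n]
  proof eventually_elim
    case (elim x)
    show ?case
    proof (cases "x \<in> K")
      case True
      have "\<bar>a n x - A x\<bar> * (\<bar>g x\<bar> * \<bar>h n x\<bar>) \<le> W * (G * N)"
        using d[OF True] elim \<open>0 \<le> W\<close> by (intro mult_mono) auto
      then show ?thesis using True by (simp add: abs_mult mult.assoc)
    qed (simp add: g(3))
  qed
  have "(\<lambda>n. \<integral>x. (a n x - A x) * (g x * h n x) \<partial>lebesgue) \<longlonglongrightarrow> (\<integral>x. 0 \<partial>(lebesgue :: 'a measure))"
  proof (rule integral_dominated_convergence[where w = "\<lambda>x. W * G * N * indicator K x"])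
    show "integrable lebesgue (\<lambda>x. W * G * N * indicator K x :: real)" by (rule iW)
    show "AE x in lebesgue. (\<lambda>n. (a n x - A x) * (g x * h n x)) \<longlonglongrightarrow> 0"
    proof -
      have "AE x in lebesgue. \<forall>n. \<bar>h n x\<bar> \<le> N" using h(2) by (simp add: AE_all_countable)
      then show ?thesis
      proof eventually_elim
        case (elim x)
        show ?case
        proof (cases "x \<in> K")
          case True
          have "(\<lambda>n. a n x - A x) \<longlonglongrightarrow> 0" using lim[OF True] by (simp add: LIM_zero)
          then show ?thesis
          proof (rule tendsto_0_le[where K = "\<bar>g x\<bar> * N"])
            show "\<forall>\<^sub>F n in sequentially. norm ((a n x - A x) * (g x * h n x)) \<le> norm (a n x - A x) * (\<bar>g x\<bar> * N)"
              using elim by (intro always_eventually allI) (simp add: abs_mult mult_left_mono)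
          qed
        qed (simp add: g(3))
      qed
    qed
    show "AE x in lebesgue. norm ((a n x - A x) * (g x * h n x)) \<le> W * G * N * indicator K x" for n
      using ev[of n] by simp
  qed (use m g(1) h(1) in auto)
  then have 2: "(\<lambda>n. \<integral>x. (a n x - A x) * (g x * h n x) \<partial>lebesgue) \<longlonglongrightarrow> 0" by simp
  have "(\<integral>x. a n x * (g x * h n x) \<partial>lebesgue)
      = (\<integral>x. (a n x - A x) * (g x * h n x) \<partial>lebesgue) + (\<integral>x. A x * g x * h n x \<partial>lebesgue)" for n
  proof -
    have "integrable lebesgue (\<lambda>x. (a n x - A x) * (g x * h n x))"
      by (rule Bochner_Integration.integrable_bound[OF iW]) (use ev[of n] m g(1) h(1) in \<open>auto elim!: eventually_mono\<close>)
    moreover have "integrable lebesgue (\<lambda>x. A x * g x * h n x)"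
      by (rule integrable_mult_bounded[OF iAg h])
    ultimately show ?thesis by (subst Bochner_Integration.integral_add[symmetric]) (auto simp: algebra_simps)
  qed
  then show ?thesis using tendsto_add[OF 2 1] by (simp add: mult.assoc)
qed

section \<open>Weak continuity of the minors of a gradient\<close>

definition minor :: "'a::euclidean_space \<Rightarrow> 'a \<Rightarrow> ('a \<Rightarrow> real) \<Rightarrow> ('a \<Rightarrow> real) \<Rightarrow> 'a \<Rightarrow> real" where
  "minor e1 e2 a b x = dderiv e1 a x * dderiv e2 b x - dderiv e2 a x * dderiv e1 b x"

lemma AE_dderiv_bound:
  fixes f :: "'a::euclidean_space \<Rightarrow> real"
  assumes "L-lipschitz_on UNIV f"
  shows "AE x in lebesgue. \<bar>dderiv e f x\<bar> \<le> L * norm e"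
  using AE_dderiv[OF assms, of e] by eventually_elim (rule dderiv_bound[OF assms])

lemma borel_measurable_minor:
  fixes a b :: "'a::euclidean_space \<Rightarrow> real"
  assumes "L-lipschitz_on UNIV a" "M-lipschitz_on UNIV b"
  shows "minor e1 e2 a b \<in> borel_measurable lebesgue"
  unfolding minor_def[abs_def]
  by (intro borel_measurable_diff borel_measurable_times borel_measurable_dderiv[OF assms(1)] borel_measurable_dderiv[OF assms(2)])

lemma AE_minor_bound:
  fixes a b :: "'a::euclidean_space \<Rightarrow> real"
  assumes a: "L-lipschitz_on UNIV a" and b: "L-lipschitz_on UNIV b"
  shows "AE x in lebesgue. \<bar>minor e1 e2 a b x\<bar> \<le> 2 * L\<^sup>2 * norm e1 * norm e2"
  using AE_dderiv_bound[OF a, of e1] AE_dderiv_bound[OF a, of e2] AE_dderiv_bound[OF b, of e1] AE_dderiv_bound[OF b, of e2]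
proof eventually_elim
  case (elim x)
  have L: "0 \<le> L" using a by (rule lipschitz_on_nonneg)
  have "\<bar>dderiv e1 a x\<bar> * \<bar>dderiv e2 b x\<bar> \<le> (L * norm e1) * (L * norm e2)"
    "\<bar>dderiv e2 a x\<bar> * \<bar>dderiv e1 b x\<bar> \<le> (L * norm e2) * (L * norm e1)"
    using elim L by (auto intro!: mult_mono)
  moreover have "\<bar>minor e1 e2 a b x\<bar> \<le> \<bar>dderiv e1 a x\<bar> * \<bar>dderiv e2 b x\<bar> + \<bar>dderiv e2 a x\<bar> * \<bar>dderiv e1 b x\<bar>"
    unfolding minor_def abs_mult[symmetric] by linarith
  ultimately show ?case by (simp add: power2_eq_square mult_ac)
qed

text \<open>For a Lipschitz test function, integration by parts leaves products of three factors:
  \<open>a n\<close>, which converges pointwise, a fixed bounded derivative of the test function,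
  and a weakly convergent derivative of \<open>b n\<close>. The uniform bound on minors then admits
  all integrable test functions.\<close>

lemma minor_wconv:
  fixes \<Omega> :: "'a::euclidean_space set"
  assumes \<Omega>: "open \<Omega>" "bounded \<Omega>"
    and a: "\<And>n. L-lipschitz_on UNIV (a n)" and A: "L-lipschitz_on UNIV A"
    and b: "\<And>n. L-lipschitz_on UNIV (b n)" and B: "L-lipschitz_on UNIV B"
    and w: "wconv \<Omega> a A"
    and w1: "wconv \<Omega> (\<lambda>n. dderiv e1 (b n)) (dderiv e1 B)"
    and w2: "wconv \<Omega> (\<lambda>n. dderiv e2 (b n)) (dderiv e2 B)"
  shows "wconv \<Omega> (\<lambda>n. minor e1 e2 (a n) (b n)) (minor e1 e2 A B)"
proof -
  define C where "C = 2 * L\<^sup>2 * norm e1 * norm e2"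
  define D where "D n x = minor e1 e2 (a n) (b n) x - minor e1 e2 A B x" for n x
  have mD: "minor e1 e2 (a n) (b n) \<in> borel_measurable lebesgue" "minor e1 e2 A B \<in> borel_measurable lebesgue" for n
    using borel_measurable_minor[OF a b] borel_measurable_minor[OF A B] by auto
  have bD: "AE x in lebesgue. \<bar>minor e1 e2 (a n) (b n) x\<bar> \<le> C" "AE x in lebesgue. \<bar>minor e1 e2 A B x\<bar> \<le> C" for n
    using AE_minor_bound[OF a b] AE_minor_bound[OF A B] by (auto simp: C_def)
  have split: "(\<integral>x. \<psi> x * D n x \<partial>lebesgue) = (\<integral>x. \<psi> x * minor e1 e2 (a n) (b n) x \<partial>lebesgue) - (\<integral>x. \<psi> x * minor e1 e2 A B x \<partial>lebesgue)"
    if "integrable lebesgue \<psi>" for \<psi> n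
    using integrable_mult_bounded[OF that mD(1) bD(1)] integrable_mult_bounded[OF that mD(2) bD(2)]
    by (simp add: D_def right_diff_distrib)
  have "bounded_sequence lebesgue D (2 * C)"
  proof
    show "D n \<in> borel_measurable lebesgue" for n unfolding D_def[abs_def] by (intro borel_measurable_diff mD)
    show "AE x in lebesgue. \<bar>D n x\<bar> \<le> 2 * C" for n
      using bD(1)[of n] bD(2) by eventually_elim (simp add: D_def abs_le_iff)
    show "0 \<le> 2 * C" by (simp add: C_def)
  qed
  then have "(\<lambda>n. \<integral>x. \<psi> x * D n x \<partial>lebesgue) \<longlonglongrightarrow> 0"
    if \<psi>: "integrable lebesgue \<psi>" "\<And>x. x \<notin> \<Omega> \<Longrightarrow> \<psi> x = 0" for \<psi>
  proof (rule annihilator_dense[OF _ \<Omega> _ \<psi>])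
    fix \<phi> :: "'a \<Rightarrow> real" and M K
    assume \<phi>: "M-lipschitz_on UNIV \<phi>" and K: "compact K" "K \<subseteq> \<Omega>" and off: "\<And>x. x \<notin> K \<Longrightarrow> \<phi> x = 0"
    have bs: "bounded {x. \<phi> x \<noteq> 0}"
      by (rule bounded_subset[OF compact_imp_bounded[OF K(1)]]) (use off in auto)
    have d0: "dderiv e \<phi> x = 0" if "x \<notin> K" for e x
      using dderiv_cong[of "- K" x \<phi> "\<lambda>_. 0" e] compact_imp_closed[OF K(1)] that off
      by (simp add: dderiv_const open_Compl)
    have lim: "(\<lambda>n. a n x) \<longlonglongrightarrow> A x" if "x \<in> K" for x
      using wconv_pointwise[OF a A w \<Omega>(1)] that K(2) by blast
    have t: "(\<lambda>n. \<integral>x. a n x * (dderiv e \<phi> x * dderiv e' (b n) x) \<partial>lebesgue)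
      \<longlonglongrightarrow> (\<integral>x. A x * (dderiv e \<phi> x * dderiv e' B x) \<partial>lebesgue)"
      if "wconv \<Omega> (\<lambda>n. dderiv e' (b n)) (dderiv e' B)" for e e'
      by (rule wconv_mult_strong[OF K borel_measurable_dderiv[OF \<phi>] AE_dderiv_bound[OF \<phi>] d0 a A lim
            borel_measurable_dderiv[OF b] AE_dderiv_bound[OF b] that])
    \<comment> \<open>A Lipschitz \<open>f\<close> need not be integrable; the indicator of
      \<open>K\<close> may be inserted because the derivative of the test function vanishes off
      \<open>K\<close>.\<close>
    have ii: "integrable lebesgue (\<lambda>x. f x * (dderiv e \<phi> x * dderiv e' h x))"
      if f: "L-lipschitz_on UNIV f" and h: "L-lipschitz_on UNIV h" for f h e e'
    proof -
      have "integrable lebesgue (\<lambda>x. indicator K x * f x)"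
      proof -
        have "integrable lborel (\<lambda>x. indicator K x * f x)"
          using borel_integrable_compact[OF K(1) continuous_on_subset[OF lipschitz_on_continuous_on[OF f]]] by auto
        then show ?thesis using integrable_completion borel_measurable_integrable by blast
      qed
      from integrable_mult_bounded[OF integrable_mult_bounded[OF this borel_measurable_dderiv[OF \<phi>] AE_dderiv_bound[OF \<phi>]]
          borel_measurable_dderiv[OF h] AE_dderiv_bound[OF h], of e e']
      have "integrable lebesgue (\<lambda>x. indicator K x * f x * dderiv e \<phi> x * dderiv e' h x)" .
      moreover have "indicator K x * f x * dderiv e \<phi> x * dderiv e' h x = f x * (dderiv e \<phi> x * dderiv e' h x)" for x
        using d0[of x e] by (auto simp: indicator_def)
      ultimately show ?thesis by simp
    qed
    have parts: "(\<integral>x. \<phi> x * minor e1 e2 f h x \<partial>lebesgue)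
      = - ((\<integral>x. f x * (dderiv e1 \<phi> x * dderiv e2 h x) \<partial>lebesgue) - (\<integral>x. f x * (dderiv e2 \<phi> x * dderiv e1 h x) \<partial>lebesgue))"
      if f: "L-lipschitz_on UNIV f" and h: "L-lipschitz_on UNIV h" for f h
      unfolding minor_def integral_minor_by_parts[OF \<phi> bs f h]
      using ii[OF f h] by (simp add: right_diff_distrib)
    have "(\<lambda>n. \<integral>x. \<phi> x * minor e1 e2 (a n) (b n) x \<partial>lebesgue) \<longlonglongrightarrow> (\<integral>x. \<phi> x * minor e1 e2 A B x \<partial>lebesgue)"
      unfolding parts[OF a b] parts[OF A B] by (intro tendsto_minus tendsto_diff t w1 w2)
    moreover have "integrable lebesgue \<phi>"
      using integrable_continuous_bounded_support[OF lipschitz_on_continuous_on[OF \<phi>] bs]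
      using integrable_completion borel_measurable_integrable by blast
    ultimately show "(\<lambda>n. \<integral>x. \<phi> x * D n x \<partial>lebesgue) \<longlonglongrightarrow> 0"
      by (simp add: split LIM_zero)
  qed
  then show ?thesis unfolding wconv_def using split by (simp add: LIM_zero_iff)
qed

text \<open>A penalty argument: on the compact part of \<open>S\<close> where
  \<open>f \<ge> e\<close>, the function \<open>h\<close> has a positive minimum, and the maximum of
  \<open>f\<close> divided by it serves as \<open>C\<close>. It is what turns exact statements on
  \<open>K_stat\<close> into estimates near it.\<close>

lemma compact_control:
  fixes f h :: "'a::topological_space \<Rightarrow> real"
  assumes S: "compact S" and f: "continuous_on S f" and h: "continuous_on S h"
    and h0: "\<And>x. x \<in> S \<Longrightarrow> 0 \<le> h x" and z: "\<And>x. x \<in> S \<Longrightarrow> h x = 0 \<Longrightarrow> f x < e" and "0 \<le> e"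
  shows "\<exists>C\<ge>0. \<forall>x\<in>S. f x \<le> e + C * h x"
proof -
  define T where "T = S \<inter> f -` {e..}"
  have T: "compact T"
  proof -
    have "closedin (top_of_set S) T" unfolding T_def using f continuous_closedin_preimage closed_atLeast by blast
    then show ?thesis using S closedin_compact by blast
  qed
  show ?thesis
  proof (cases "T = {}")
    case True
    then have "f x \<le> e + 0 * h x" if "x \<in> S" for x using that by (force simp: T_def)
    then show ?thesis by blast
  next
    case False
    have TS: "T \<subseteq> S" by (auto simp: T_def)
    obtain y where y: "y \<in> T" "\<And>x. x \<in> T \<Longrightarrow> h y \<le> h x"
      using continuous_attains_inf[OF T False continuous_on_subset[OF h TS]] by blast
    obtain w where w: "w \<in> T" "\<And>x. x \<in> T \<Longrightarrow> f x \<le> f w"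
      using continuous_attains_sup[OF T False continuous_on_subset[OF f TS]] by blast
    have "h y \<noteq> 0" using z[of y] y(1) TS by (force simp: T_def)
    then have hy: "0 < h y" using h0[of y] y(1) TS by force
    have fw: "0 \<le> f w" using w(1) \<open>0 \<le> e\<close> by (simp add: T_def)
    have "f x \<le> e + f w / h y * h x" if x: "x \<in> S" for x
    proof (cases "x \<in> T")
      case True
      have "f w = f w / h y * h y" using hy by simp
      also have "\<dots> \<le> f w / h y * h x" using fw hy y(2)[OF True] by (intro mult_left_mono) auto
      finally show ?thesis using w(2)[OF True] \<open>0 \<le> e\<close> by linarith
    next
      case False
      have "0 \<le> f w / h y * h x" using fw hy h0[OF x] by simp
      then show ?thesis using False x by (auto simp: T_def)
    qed
    then show ?thesis using fw hy by (intro exI[of _ "f w / h y"]) auto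
  qed
qed

section \<open>Separation of the determinants by a null Lagrangian\<close>

lemma exhaust_6:
  fixes x :: 6
  shows "x = 1 \<or> x = 2 \<or> x = 3 \<or> x = 4 \<or> x = 5 \<or> x = 6"
proof (induct x)
  case (of_int z)
  then have "0 \<le> z" and "z < 6" by simp_all
  then have "z = 0 \<or> z = 1 \<or> z = 2 \<or> z = 3 \<or> z = 4 \<or> z = 5" by arith
  then show ?case by auto
qed

lemma forall_6: "(\<forall>i::6. P i) \<longleftrightarrow> P 1 \<and> P 2 \<and> P 3 \<and> P 4 \<and> P 5 \<and> P 6"
  by (metis exhaust_6)

lemma det_rows_eq: "det_rows i j A = A $ i $ 1 * A $ j $ 2 - A $ i $ 2 * A $ j $ 1"
  by (simp add: det_rows_def det_2)

lemma component_bound: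
  fixes X :: "real^2^6"
  assumes "norm X \<le> R" shows "\<bar>X $ i $ j\<bar> \<le> R"
proof -
  have "\<bar>X $ i $ j\<bar> \<le> norm (X $ i)" by (rule component_le_norm_cart)
  also have "\<dots> \<le> norm X" by (rule Finite_Cartesian_Product.norm_nth_le)
  finally show ?thesis using assms by simp
qed

lemma det_rows_bound:
  fixes X :: "real^2^6"
  assumes X: "norm X \<le> R" shows "\<bar>det_rows i j X\<bar> \<le> 2 * R\<^sup>2"
proof -
  have "0 \<le> R" using X norm_ge_zero order_trans by blast
  then have "\<bar>X $ i $ 1\<bar> * \<bar>X $ j $ 2\<bar> \<le> R * R" "\<bar>X $ i $ 2\<bar> * \<bar>X $ j $ 1\<bar> \<le> R * R"
    using component_bound[OF X] by (auto intro!: mult_mono)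
  then show ?thesis unfolding det_rows_eq power2_eq_square abs_mult[symmetric] by linarith
qed

text \<open>The coefficient of \<open>J\<close> in the third block; for convex \<open>g\<close> it
  is the Legendre transform of \<open>g\<close> at the slope \<open>deriv g t\<close>.\<close>

definition zval :: "(real \<Rightarrow> real) \<Rightarrow> real \<Rightarrow> real" where
  "zval g t = deriv g t * t - g t"

text \<open>The matrix \<open>X\<close> in \<open>K_stat\<close> can only consist of the first two
  rows, so the existential disappears and scalar equations between entries remain. Closedness and
  the passage to the limit are read off from them.\<close>

lemma K_stat_iff:
  fixes A :: "real^2^6"
  defines "t \<equiv> det_rows 1 2 A"
  shows "A \<in> K_stat g \<longleftrightarrow>
    (\<forall>j. A $ 3 $ j = deriv g t * A $ 1 $ j \<and> A $ 4 $ j = deriv g t * A $ 2 $ j) \<and>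
    A $ 5 $ 1 = 0 \<and> A $ 5 $ 2 = - zval g t \<and> A $ 6 $ 1 = zval g t \<and> A $ 6 $ 2 = 0"
proof
  assume "A \<in> K_stat g"
  then obtain X where A: "A = block3 X (deriv g (det X) *\<^sub>R X) ((deriv g (det X) * det X - g (det X)) *\<^sub>R J)"
    by (auto simp: K_stat_def)
  have "t = det X" by (simp add: t_def det_rows_eq A block3_rows det_2)
  then show "(\<forall>j. A $ 3 $ j = deriv g t * A $ 1 $ j \<and> A $ 4 $ j = deriv g t * A $ 2 $ j) \<and>
    A $ 5 $ 1 = 0 \<and> A $ 5 $ 2 = - zval g t \<and> A $ 6 $ 1 = zval g t \<and> A $ 6 $ 2 = 0"
    by (simp add: A block3_rows J_def zval_def)
next
  assume R: "(\<forall>j. A $ 3 $ j = deriv g t * A $ 1 $ j \<and> A $ 4 $ j = deriv g t * A $ 2 $ j) \<and>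
    A $ 5 $ 1 = 0 \<and> A $ 5 $ 2 = - zval g t \<and> A $ 6 $ 1 = zval g t \<and> A $ 6 $ 2 = 0"
  define X :: "real^2^2" where "X = vector [A $ 1, A $ 2]"
  have t: "t = det X" by (simp add: t_def det_rows_def X_def)
  have "A = block3 X (deriv g (det X) *\<^sub>R X) ((deriv g (det X) * det X - g (det X)) *\<^sub>R J)"
    unfolding vec_eq_iff forall_6 forall_2 block3_rows t[symmetric]
    using R by (simp add: X_def J_def zval_def forall_2)
  then show "A \<in> K_stat g" by (auto simp: K_stat_def)
qed

text \<open>The polarised Pluecker relation between the minors of the first four rows: it vanishes
  identically for \<open>A = B\<close>.\<close>

definition pluecker :: "real^2^6 \<Rightarrow> real^2^6 \<Rightarrow> real" where
  "pluecker A B = det_rows 1 2 A * det_rows 3 4 B + det_rows 3 4 A * det_rows 1 2 B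
    - det_rows 1 3 A * det_rows 2 4 B - det_rows 2 4 A * det_rows 1 3 B
    + det_rows 1 4 A * det_rows 2 3 B + det_rows 2 3 A * det_rows 1 4 B"

text \<open>The factor of \<open>2 * \<Lambda>\<close> is \<open>det_rows 5 6 (A - B)\<close>, expanded so that every term is a minor or
  an entry of \<open>A\<close> times a minor or an entry of \<open>B\<close>.\<close>

definition gap :: "real \<Rightarrow> real^2^6 \<Rightarrow> real^2^6 \<Rightarrow> real" where
  "gap \<Lambda> A B = 2 * \<Lambda> * (det_rows 5 6 A + det_rows 5 6 B
      - (A $ 5 $ 1 * B $ 6 $ 2 - A $ 5 $ 2 * B $ 6 $ 1 + A $ 6 $ 2 * B $ 5 $ 1 - A $ 6 $ 1 * B $ 5 $ 2))
    - pluecker A B"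

text \<open>The mixed term is twice the minor of rows 5 and 6, and \<open>pluecker A A\<close> is
  twice det12 det34 - det13 det24 + det14 det23, which is zero for any matrix with two
  columns.\<close>

lemma gap_self: "gap \<Lambda> A A = 0"
  by (simp add: gap_def pluecker_def det_rows_eq algebra_simps)

lemma gap_commute: "gap \<Lambda> A B = gap \<Lambda> B A"
  by (simp add: gap_def pluecker_def algebra_simps)

lemma continuous_on_det_rows [continuous_intros]:
  fixes f :: "'a::topological_space \<Rightarrow> real^2^6"
  assumes "continuous_on S f"
  shows "continuous_on S (\<lambda>x. det_rows i j (f x))"
  unfolding det_rows_eq by (intro continuous_intros assms)

lemma continuous_on_gap [continuous_intros]:
  fixes f h :: "'a::topological_space \<Rightarrow> real^2^6"
  assumes "continuous_on S f" "continuous_on S h"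
  shows "continuous_on S (\<lambda>x. gap \<Lambda> (f x) (h x))"
  unfolding gap_def pluecker_def by (intro continuous_intros assms)

text \<open>Rows 3 and 4 are \<open>p\<close> times rows 1 and 2, so the minors 13 and 24 vanish and
  the others are multiples of \<open>t\<close>: the polarised relation collapses to t s (p^2 + q^2 -
  2 p q). The multiple of \<open>J\<close> makes the other minor a perfect square.\<close>

lemma gap_on_K_stat:
  fixes A B :: "real^2^6"
  assumes A: "A \<in> K_stat g" and B: "B \<in> K_stat g"
  defines "t \<equiv> det_rows 1 2 A" and "s \<equiv> det_rows 1 2 B"
  shows "gap \<Lambda> A B = 2 * \<Lambda> * (zval g t - zval g s)\<^sup>2 - t * s * (deriv g t - deriv g s)\<^sup>2"
proof -
  define p q where "p = deriv g t" and "q = deriv g s"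
  have a: "A $ 3 $ j = p * A $ 1 $ j" "A $ 4 $ j = p * A $ 2 $ j" "A $ 5 $ 1 = 0" "A $ 5 $ 2 = - zval g t"
    "A $ 6 $ 1 = zval g t" "A $ 6 $ 2 = 0" for j
    using A unfolding K_stat_iff p_def t_def by auto
  have b: "B $ 3 $ j = q * B $ 1 $ j" "B $ 4 $ j = q * B $ 2 $ j" "B $ 5 $ 1 = 0" "B $ 5 $ 2 = - zval g s"
    "B $ 6 $ 1 = zval g s" "B $ 6 $ 2 = 0" for j
    using B unfolding K_stat_iff q_def s_def by auto
  have minors: "det_rows 3 4 A = p\<^sup>2 * t" "det_rows 1 3 A = 0" "det_rows 2 4 A = 0" "det_rows 1 4 A = p * t"
    "det_rows 2 3 A = - (p * t)" "det_rows 5 6 A = (zval g t)\<^sup>2"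
    "det_rows 3 4 B = q\<^sup>2 * s" "det_rows 1 3 B = 0" "det_rows 2 4 B = 0" "det_rows 1 4 B = q * s"
    "det_rows 2 3 B = - (q * s)" "det_rows 5 6 B = (zval g s)\<^sup>2"
    unfolding t_def s_def det_rows_eq a b by (simp_all add: algebra_simps power2_eq_square)
  show ?thesis
    unfolding gap_def pluecker_def minors t_def[symmetric] s_def[symmetric] a b p_def[symmetric] q_def[symmetric]
    by (simp add: algebra_simps power2_eq_square)
qed

lemma closed_K_stat:
  assumes g: "continuous_on UNIV g" "continuous_on UNIV (deriv g)"
  shows "closed (K_stat g)"
proof -
  have c: "continuous_on UNIV (\<lambda>A::real^2^6. deriv g (det_rows 1 2 A))" "continuous_on UNIV (\<lambda>A::real^2^6. g (det_rows 1 2 A))"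
    by (intro continuous_on_compose2[OF g(1)] continuous_on_compose2[OF g(2)] continuous_intros; simp)+
  have "K_stat g = {A. (\<forall>j. A $ 3 $ j = deriv g (det_rows 1 2 A) * A $ 1 $ j \<and> A $ 4 $ j = deriv g (det_rows 1 2 A) * A $ 2 $ j) \<and>
    A $ 5 $ 1 = 0 \<and> A $ 5 $ 2 = - zval g (det_rows 1 2 A) \<and> A $ 6 $ 1 = zval g (det_rows 1 2 A) \<and> A $ 6 $ 2 = 0}"
    using K_stat_iff by blast
  also have "closed \<dots>"
    unfolding zval_def
    by (intro closed_Collect_conj closed_Collect_all closed_Collect_eq continuous_intros c)
  finally show ?thesis .
qed

text \<open>Makes \<open>K_stat\<close> nonempty, so that zero distance means membership, and bounds
  the distance of a matrix to it by the norm.\<close>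

lemma zero_in_K_stat: "g 0 = 0 \<Longrightarrow> 0 \<in> K_stat g"
  by (simp add: K_stat_iff det_rows_eq zval_def)

section \<open>Consequences of strict convexity\<close>

context
  fixes g :: "real \<Rightarrow> real"
  assumes C2: "C2 g" and pos: "\<And>t. 0 < deriv (deriv g) t"
begin

lemma C2_derivs:
  "(g has_field_derivative deriv g t) (at t)"
  "(deriv g has_field_derivative deriv (deriv g) t) (at t)"
  "continuous_on UNIV (deriv (deriv g))"
proof -
  have "f differentiable (at x)" "continuous_on UNIV (deriv f)" if f: "f C1_differentiable_on UNIV" for f :: "real \<Rightarrow> real" and x
  proof -
    obtain D where D: "\<And>x. (f has_vector_derivative D x) (at x)" "continuous_on UNIV D"
      using f by (auto simp: C1_differentiable_on_def)
    have "deriv f = D"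
      using D(1) by (auto simp: has_real_derivative_iff_has_vector_derivative[symmetric] intro: DERIV_imp_deriv)
    then show "f differentiable (at x)" "continuous_on UNIV (deriv f)"
      using D by (auto intro: differentiableI_vector)
  qed
  then show "(g has_field_derivative deriv g t) (at t)"
    "(deriv g has_field_derivative deriv (deriv g) t) (at t)" "continuous_on UNIV (deriv (deriv g))"
    using C2 unfolding C2_def by (auto simp: DERIV_deriv_iff_real_differentiable)
qed

lemma continuous_derivs: "continuous_on UNIV g" "continuous_on UNIV (deriv g)" "continuous_on UNIV (zval g)"
proof -
  show 1: "continuous_on UNIV g" using DERIV_continuous_on[of UNIV g "deriv g"] C2_derivs(1) by simp
  show 2: "continuous_on UNIV (deriv g)"
    using DERIV_continuous_on[of UNIV "deriv g" "deriv (deriv g)"] C2_derivs(2) by simp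
  show "continuous_on UNIV (zval g)" unfolding zval_def by (intro continuous_intros 1 2)
qed

lemma deriv_strict_mono: "strict_mono (deriv g)"
proof (rule strict_monoI)
  show "deriv g x < deriv g y" if "x < y" for x y
    using C2_derivs(2) pos by (intro DERIV_pos_imp_increasing[OF that]) blast
qed

lemma zval_deriv: "(zval g has_field_derivative deriv (deriv g) t * t) (at t)"
  unfolding zval_def[abs_def] by (rule derivative_eq_intros C2_derivs refl)+ simp

text \<open>The derivative of \<open>zval g r - m / 2 * r\<^sup>2\<close> is
  \<open>(deriv (deriv g) r - m) * r\<close>, which has the sign of \<open>r\<close>, so this
  difference does not decrease when moving away from 0. The condition \<open>0 \<le> t * s\<close>
  puts both points on the same side of 0.\<close>

lemma zval_growth:
  assumes m: "\<And>r. \<bar>r\<bar> \<le> T \<Longrightarrow> m \<le> deriv (deriv g) r" and ts: "0 \<le> t * s" "\<bar>t\<bar> \<le> T" "\<bar>s\<bar> \<le> T" and "0 \<le> m"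
  shows "m / 2 * \<bar>t\<^sup>2 - s\<^sup>2\<bar> \<le> \<bar>zval g t - zval g s\<bar>"
proof -
  define w where "w r = zval g r - m / 2 * r\<^sup>2" for r
  have w: "(w has_field_derivative (deriv (deriv g) r - m) * r) (at r)" for r
    unfolding w_def[abs_def] by (rule derivative_eq_intros zval_deriv refl)+ (simp add: algebra_simps)
  have up: "m / 2 * (b\<^sup>2 - a\<^sup>2) \<le> zval g b - zval g a" if "0 \<le> a" "a \<le> b" "b \<le> T" for a b
  proof -
    have "w a \<le> w b"
    proof (rule DERIV_nonneg_imp_nondecreasing[OF that(2)])
      fix x assume "a \<le> x" "x \<le> b"
      then show "\<exists>y. (w has_real_derivative y) (at x) \<and> 0 \<le> y"
        using that m[of x] by (intro exI[of _ "(deriv (deriv g) x - m) * x"] conjI w) auto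
    qed
    then show ?thesis by (simp add: w_def algebra_simps)
  qed
  have down: "m / 2 * (a\<^sup>2 - b\<^sup>2) \<le> zval g a - zval g b" if "b \<le> 0" "a \<le> b" "- T \<le> a" for a b
  proof -
    have "w b \<le> w a"
    proof (rule DERIV_nonpos_imp_nonincreasing[OF that(2)])
      fix x assume "a \<le> x" "x \<le> b"
      then show "\<exists>y. (w has_real_derivative y) (at x) \<and> y \<le> 0"
        using that m[of x] by (intro exI[of _ "(deriv (deriv g) x - m) * x"] conjI w) (auto simp: mult_nonneg_nonpos)
    qed
    then show ?thesis by (simp add: w_def algebra_simps)
  qed
  have main: "m / 2 * \<bar>b\<^sup>2 - a\<^sup>2\<bar> \<le> \<bar>zval g b - zval g a\<bar>" if "\<bar>a\<bar> \<le> T" "\<bar>b\<bar> \<le> T" "0 \<le> a \<and> a \<le> b \<or> b \<le> a \<and> a \<le> 0" for a b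
  proof -
    have "a\<^sup>2 \<le> b\<^sup>2" using that(3) by (auto simp: power2_le_iff_abs_le intro: power2_le_imp_le abs_le_square_iff[THEN iffD1])
    moreover have "m / 2 * (b\<^sup>2 - a\<^sup>2) \<le> zval g b - zval g a" using that up[of a b] down[of a b] by auto
    moreover have "\<bar>b\<^sup>2 - a\<^sup>2\<bar> = b\<^sup>2 - a\<^sup>2" using \<open>a\<^sup>2 \<le> b\<^sup>2\<close> by simp
    ultimately show ?thesis by (metis abs_ge_self order_trans)
  qed
  have "0 \<le> s \<and> s \<le> t \<or> t \<le> s \<and> s \<le> 0 \<or> 0 \<le> t \<and> t \<le> s \<or> s \<le> t \<and> t \<le> 0"
    using ts(1) by (auto simp: zero_le_mult_iff)
  then show ?thesis using main[of s t] main[of t s] ts by (auto simp: abs_minus_commute)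
qed

text \<open>With \<open>m \<le> g'' \<le> M\<close> on \<open>[-T, T]\<close>, the choice \<open>\<Lambda> = (M / m)\<^sup>2\<close> makes the square in
  \<open>gap_on_K_stat\<close> dominate the product.\<close>

lemma gap_nonneg:
  assumes "0 < T"
  obtains \<Lambda> where "\<And>A B. A \<in> K_stat g \<Longrightarrow> B \<in> K_stat g \<Longrightarrow> \<bar>det_rows 1 2 A\<bar> \<le> T \<Longrightarrow> \<bar>det_rows 1 2 B\<bar> \<le> T \<Longrightarrow> 0 \<le> gap \<Lambda> A B"
    and "\<And>A B. A \<in> K_stat g \<Longrightarrow> B \<in> K_stat g \<Longrightarrow> \<bar>det_rows 1 2 A\<bar> \<le> T \<Longrightarrow> \<bar>det_rows 1 2 B\<bar> \<le> T \<Longrightarrow> gap \<Lambda> A B = 0 \<Longrightarrow>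
      det_rows 1 2 A = det_rows 1 2 B"
proof -
  have ne: "{-T..T} \<noteq> {}" and c: "continuous_on {-T..T} (deriv (deriv g))"
    using \<open>0 < T\<close> C2_derivs(3) continuous_on_subset by auto
  obtain r1 where r1: "\<And>r. r \<in> {-T..T} \<Longrightarrow> deriv (deriv g) r1 \<le> deriv (deriv g) r"
    using continuous_attains_inf[OF compact_Icc ne c] by blast
  obtain r2 where r2: "\<And>r. r \<in> {-T..T} \<Longrightarrow> deriv (deriv g) r \<le> deriv (deriv g) r2"
    using continuous_attains_sup[OF compact_Icc ne c] by blast
  define m M where "m = deriv (deriv g) r1" and "M = deriv (deriv g) r2"
  have m: "m \<le> deriv (deriv g) r" and M: "deriv (deriv g) r \<le> M" if "\<bar>r\<bar> \<le> T" for r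
    using r1[of r] r2[of r] that by (auto simp: m_def M_def abs_le_iff)
  have "0 < m" "0 < M" using pos by (auto simp: m_def M_def)
  define \<Lambda> where "\<Lambda> = (M / m)\<^sup>2"
  have "0 < \<Lambda>" using \<open>0 < m\<close> \<open>0 < M\<close> by (simp add: \<Lambda>_def)
  have lipg: "\<bar>deriv g t - deriv g s\<bar> \<le> M * \<bar>t - s\<bar>" if "\<bar>t\<bar> \<le> T" "\<bar>s\<bar> \<le> T" for t s
  proof -
    have "norm (deriv g t - deriv g s) \<le> M * norm (t - s)"
    proof (rule field_differentiable_bound[where S = "{-T..T}" and f' = "deriv (deriv g)"])
      show "norm (deriv (deriv g) x) \<le> M" if "x \<in> {-T..T}" for x
        using M[of x] pos[of x] that by (auto simp: abs_le_iff)
    qed (use that C2_derivs(2) in \<open>auto intro: has_field_derivative_at_within\<close>)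
    then show ?thesis by simp
  qed
  have key: "t * s * (deriv g t - deriv g s)\<^sup>2 \<le> \<Lambda> * (zval g t - zval g s)\<^sup>2" if "\<bar>t\<bar> \<le> T" "\<bar>s\<bar> \<le> T" for t s
  proof (cases "0 \<le> t * s")
    case True
    have "(deriv g t - deriv g s)\<^sup>2 \<le> (M * \<bar>t - s\<bar>)\<^sup>2"
      using power_mono[OF lipg[OF that], of 2] by simp
    then have "t * s * (deriv g t - deriv g s)\<^sup>2 \<le> t * s * (M * \<bar>t - s\<bar>)\<^sup>2"
      using True by (intro mult_left_mono)
    also have "\<dots> \<le> (M / 2)\<^sup>2 * (t\<^sup>2 - s\<^sup>2)\<^sup>2"
    proof -
      \<comment> \<open>This inequality converts t s (t - s)^2 into (t^2 - s^2)^2 / 4, the quantity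
        that \<open>zval_growth\<close> controls.\<close>
      have "4 * (t * s) \<le> (t + s)\<^sup>2" using zero_le_power2[of "t - s"] by (simp add: power2_eq_square algebra_simps)
      then have "(M\<^sup>2 * (t - s)\<^sup>2 / 4) * (4 * (t * s)) \<le> (M\<^sup>2 * (t - s)\<^sup>2 / 4) * (t + s)\<^sup>2"
        by (intro mult_left_mono) auto
      moreover have "t * s * (M * \<bar>t - s\<bar>)\<^sup>2 = (M\<^sup>2 * (t - s)\<^sup>2 / 4) * (4 * (t * s))"
        by (simp add: power_mult_distrib)
      moreover have "(M / 2)\<^sup>2 * (t\<^sup>2 - s\<^sup>2)\<^sup>2 = (M\<^sup>2 * (t - s)\<^sup>2 / 4) * (t + s)\<^sup>2"
      proof -
        have "t\<^sup>2 - s\<^sup>2 = (t - s) * (t + s)" by (simp add: power2_eq_square algebra_simps)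
        then show ?thesis by (simp add: power_mult_distrib power_divide)
      qed
      ultimately show ?thesis by linarith
    qed
    also have "\<dots> = \<Lambda> * (m / 2 * \<bar>t\<^sup>2 - s\<^sup>2\<bar>)\<^sup>2"
      using \<open>0 < m\<close> by (simp add: \<Lambda>_def power_mult_distrib power_divide)
    also have "\<dots> \<le> \<Lambda> * (zval g t - zval g s)\<^sup>2"
      using power_mono[OF zval_growth[OF m True that], of 2] \<open>0 < m\<close> \<open>0 < \<Lambda>\<close> by (intro mult_left_mono) auto
    finally show ?thesis .
  next
    case False
    then have "t * s * (deriv g t - deriv g s)\<^sup>2 \<le> 0"
      using mult_nonpos_nonneg[of "t * s" "(deriv g t - deriv g s)\<^sup>2"] by simp
    then show ?thesis using \<open>0 < \<Lambda>\<close> by (meson mult_nonneg_nonneg order_trans less_imp_le zero_le_power2)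
  qed
  show thesis
  proof (rule that)
    fix A B :: "real^2^6"
    assume AB: "A \<in> K_stat g" "B \<in> K_stat g" "\<bar>det_rows 1 2 A\<bar> \<le> T" "\<bar>det_rows 1 2 B\<bar> \<le> T"
    define t s where "t = det_rows 1 2 A" and "s = det_rows 1 2 B"
    \<comment> \<open>The factor 2 in \<open>gap\<close> leaves one square to spare: both summands
      are nonnegative, so a vanishing gap forces the square and then the product term to vanish
      separately.\<close>
    have gap: "gap \<Lambda> A B = \<Lambda> * (zval g t - zval g s)\<^sup>2 + (\<Lambda> * (zval g t - zval g s)\<^sup>2 - t * s * (deriv g t - deriv g s)\<^sup>2)"
      unfolding t_def s_def gap_on_K_stat[OF AB(1,2)] by simp
    have bounds: "\<bar>t\<bar> \<le> T" "\<bar>s\<bar> \<le> T" using AB by (simp_all add: t_def s_def)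
    have nn: "0 \<le> \<Lambda> * (zval g t - zval g s)\<^sup>2" using \<open>0 < \<Lambda>\<close> by simp
    show "0 \<le> gap \<Lambda> A B" unfolding gap using key[OF bounds] nn by linarith
    assume "gap \<Lambda> A B = 0"
    then have *: "\<Lambda> * (zval g t - zval g s)\<^sup>2 = 0" "t * s * (deriv g t - deriv g s)\<^sup>2 = 0"
      unfolding gap using key[OF bounds] nn by linarith+
    \<comment> \<open>For equal signs the square decides, since it yields t^2 = s^2; for opposite
      signs t s is nonzero and the product term yields equal values of the injective
      \<open>deriv g\<close>.\<close>
    have "t = s"
    proof (cases "0 \<le> t * s")
      case True
      have "m / 2 * \<bar>t\<^sup>2 - s\<^sup>2\<bar> \<le> 0"
        using zval_growth[OF m True bounds] \<open>0 < m\<close> *(1) \<open>0 < \<Lambda>\<close> by auto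
      then have "t\<^sup>2 = s\<^sup>2" using \<open>0 < m\<close> by (simp add: mult_le_0_iff)
      then show ?thesis using True by (auto simp: power2_eq_iff zero_le_mult_iff)
    next
      case False
      then have "deriv g t = deriv g s" using *(2) by auto
      then show ?thesis using strict_mono_eq[OF deriv_strict_mono] by blast
    qed
    then show "det_rows 1 2 A = det_rows 1 2 B" by (simp add: t_def s_def)
  qed
qed

text \<open>Off \<open>K_stat\<close> the gap has no sign, so \<open>compact_control\<close> is
  applied twice: to pairs in \<open>K_stat\<close> with the gap as penalty, then to all pairs in the
  ball with the distances as penalty. \<Lambda> depends only on \<open>g\<close> and
  \<open>R\<close>, whereas \<open>C1\<close> and \<open>C2\<close> vary with \<open>e\<close>; thus
  a single gap serves every \<open>e\<close>.\<close>

lemma det_gap_bound: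
  assumes g0: "g 0 = 0" and "0 < R"
  obtains \<Lambda> where "\<And>e. 0 < e \<Longrightarrow> \<exists>C1\<ge>0. \<exists>C2\<ge>0. \<forall>A\<in>cball 0 R. \<forall>B\<in>cball 0 R.
    \<bar>det_rows 1 2 A - det_rows 1 2 B\<bar> \<le> e + C1 * gap \<Lambda> A B + C2 * (infdist A (K_stat g) + infdist B (K_stat g))"
proof -
  have dR: "\<bar>det_rows 1 2 A\<bar> \<le> 2 * R\<^sup>2" if "A \<in> cball 0 R" for A :: "real^2^6"
    using that by (intro det_rows_bound) simp
  have "0 < 2 * R\<^sup>2" using \<open>0 < R\<close> by simp
  from gap_nonneg[OF this] obtain \<Lambda> where
    \<Lambda>: "\<And>A B. A \<in> K_stat g \<Longrightarrow> B \<in> K_stat g \<Longrightarrow> \<bar>det_rows 1 2 A\<bar> \<le> 2 * R\<^sup>2 \<Longrightarrow> \<bar>det_rows 1 2 B\<bar> \<le> 2 * R\<^sup>2 \<Longrightarrow> 0 \<le> gap \<Lambda> A B"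
    "\<And>A B. A \<in> K_stat g \<Longrightarrow> B \<in> K_stat g \<Longrightarrow> \<bar>det_rows 1 2 A\<bar> \<le> 2 * R\<^sup>2 \<Longrightarrow> \<bar>det_rows 1 2 B\<bar> \<le> 2 * R\<^sup>2 \<Longrightarrow> gap \<Lambda> A B = 0 \<Longrightarrow>
      det_rows 1 2 A = det_rows 1 2 B" by metis
  have clo: "closed (K_stat g)" by (rule closed_K_stat[OF continuous_derivs(1,2)])
  have ne: "K_stat g \<noteq> {}" using zero_in_K_stat[of g, OF g0] by auto
  define P where "P = (cball 0 R :: (real^2^6) set) \<times> (cball 0 R :: (real^2^6) set)"
  have P: "compact P" unfolding P_def by (intro compact_Times compact_cball)
  define Q where "Q = P \<inter> K_stat g \<times> K_stat g"
  have Q: "compact Q" unfolding Q_def by (intro compact_Int_closed P closed_Times clo)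
  show thesis
  proof (rule that)
    fix e :: real assume "0 < e"
    have "\<exists>C1\<ge>0. \<forall>z\<in>Q. \<bar>det_rows 1 2 (fst z) - det_rows 1 2 (snd z)\<bar> \<le> e / 2 + C1 * gap \<Lambda> (fst z) (snd z)"
    proof (rule compact_control[OF Q])
      show "0 \<le> gap \<Lambda> (fst z) (snd z)" if "z \<in> Q" for z
        using that by (intro \<Lambda>(1) dR) (auto simp: Q_def P_def)
      show "\<bar>det_rows 1 2 (fst z) - det_rows 1 2 (snd z)\<bar> < e / 2" if "z \<in> Q" "gap \<Lambda> (fst z) (snd z) = 0" for z
      proof -
        have "det_rows 1 2 (fst z) = det_rows 1 2 (snd z)"
          using that(1) by (intro \<Lambda>(2) dR that(2)) (auto simp: Q_def P_def)
        then show ?thesis using \<open>0 < e\<close> by simp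
      qed
    qed (use \<open>0 < e\<close> in \<open>auto intro!: continuous_intros\<close>)
    then obtain C1 where C1: "C1 \<ge> 0" "\<And>z. z \<in> Q \<Longrightarrow> \<bar>det_rows 1 2 (fst z) - det_rows 1 2 (snd z)\<bar> \<le> e / 2 + C1 * gap \<Lambda> (fst z) (snd z)"
      by blast
    have "\<exists>C2\<ge>0. \<forall>z\<in>P. \<bar>det_rows 1 2 (fst z) - det_rows 1 2 (snd z)\<bar> - C1 * gap \<Lambda> (fst z) (snd z)
        \<le> e + C2 * (infdist (fst z) (K_stat g) + infdist (snd z) (K_stat g))"
    proof (rule compact_control[OF P])
      fix z assume z: "z \<in> P" "infdist (fst z) (K_stat g) + infdist (snd z) (K_stat g) = 0"
      then have "infdist (fst z) (K_stat g) = 0" "infdist (snd z) (K_stat g) = 0"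
        using infdist_nonneg[of "fst z" "K_stat g"] infdist_nonneg[of "snd z" "K_stat g"] by linarith+
      then have "fst z \<in> K_stat g" "snd z \<in> K_stat g"
        using in_closed_iff_infdist_zero[OF clo ne] by auto
      then have "z \<in> Q" using z(1) by (cases z) (auto simp: Q_def)
      then show "\<bar>det_rows 1 2 (fst z) - det_rows 1 2 (snd z)\<bar> - C1 * gap \<Lambda> (fst z) (snd z) < e"
        using C1(2)[of z] \<open>0 < e\<close> by linarith
    qed (use \<open>0 < e\<close> in \<open>auto intro!: continuous_intros infdist_nonneg add_nonneg_nonneg\<close>)
    then obtain C2 where C2: "C2 \<ge> 0" "\<And>z. z \<in> P \<Longrightarrow> \<bar>det_rows 1 2 (fst z) - det_rows 1 2 (snd z)\<bar> - C1 * gap \<Lambda> (fst z) (snd z)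
        \<le> e + C2 * (infdist (fst z) (K_stat g) + infdist (snd z) (K_stat g))" by blast
    have "\<bar>det_rows 1 2 A - det_rows 1 2 B\<bar> \<le> e + C1 * gap \<Lambda> A B + C2 * (infdist A (K_stat g) + infdist B (K_stat g))"
      if "A \<in> cball 0 R" "B \<in> cball 0 R" for A B
      using C2(2)[of "(A, B)"] that by (simp add: P_def)
    then show "\<exists>C1\<ge>0. \<exists>C2\<ge>0. \<forall>A\<in>cball 0 R. \<forall>B\<in>cball 0 R.
      \<bar>det_rows 1 2 A - det_rows 1 2 B\<bar> \<le> e + C1 * gap \<Lambda> A B + C2 * (infdist A (K_stat g) + infdist B (K_stat g))"
      using C1(1) C2(1) by blast
  qed
qed

end

section \<open>Strong convergence of the determinants\<close>

text \<open>Integrability is bundled with convergence of the integrals, so that linear combinations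
  with many terms can be treated term by term.\<close>

definition iconv :: "'a measure \<Rightarrow> (nat \<Rightarrow> 'a \<Rightarrow> real) \<Rightarrow> ('a \<Rightarrow> real) \<Rightarrow> bool" where
  "iconv M f F \<longleftrightarrow> (\<forall>n. integrable M (f n)) \<and> integrable M F \<and>
     (\<lambda>n. \<integral>x. f n x \<partial>M) \<longlonglongrightarrow> (\<integral>x. F x \<partial>M)"

lemma iconv_const: "integrable M F \<Longrightarrow> iconv M (\<lambda>n. F) F"
  by (simp add: iconv_def)

lemma iconv_add: "iconv M f F \<Longrightarrow> iconv M h H \<Longrightarrow> iconv M (\<lambda>n x. f n x + h n x) (\<lambda>x. F x + H x)"
  by (auto simp: iconv_def intro: tendsto_add)

lemma iconv_diff: "iconv M f F \<Longrightarrow> iconv M h H \<Longrightarrow> iconv M (\<lambda>n x. f n x - h n x) (\<lambda>x. F x - H x)"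
  by (auto simp: iconv_def intro: tendsto_diff)

lemma iconv_cmult: "iconv M f F \<Longrightarrow> iconv M (\<lambda>n x. c * f n x) (\<lambda>x. c * F x)"
  by (auto simp: iconv_def intro: tendsto_mult)

lemma iconv_wconv:
  fixes \<psi> F :: "'a::euclidean_space \<Rightarrow> real"
  assumes w: "wconv \<Omega> f F" and \<psi>: "integrable lebesgue \<psi>" "\<And>x. x \<notin> \<Omega> \<Longrightarrow> \<psi> x = 0"
    and f: "\<And>n. f n \<in> borel_measurable lebesgue" "\<And>n. AE x in lebesgue. \<bar>f n x\<bar> \<le> N"
    and F: "F \<in> borel_measurable lebesgue" "AE x in lebesgue. \<bar>F x\<bar> \<le> N"
  shows "iconv lebesgue (\<lambda>n x. \<psi> x * f n x) (\<lambda>x. \<psi> x * F x)"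
  unfolding iconv_def
proof (intro conjI allI)
  show "integrable lebesgue (\<lambda>x. \<psi> x * f n x)" for n by (rule integrable_mult_bounded[OF \<psi>(1) f])
  show "integrable lebesgue (\<lambda>x. \<psi> x * F x)" by (rule integrable_mult_bounded[OF \<psi>(1) F])
  show "(\<lambda>n. \<integral>x. \<psi> x * f n x \<partial>lebesgue) \<longlonglongrightarrow> (\<integral>x. \<psi> x * F x \<partial>lebesgue)"
    by (rule w[unfolded wconv_def, rule_format, OF \<psi>])
qed

section \<open>Matrix fields with weakly convergent entries and minors\<close>

lemma borel_measurable_component:
  fixes f :: "'a \<Rightarrow> real^2^6"
  assumes "f \<in> borel_measurable M" shows "(\<lambda>x. f x $ i $ j) \<in> borel_measurable M"
proof -
  have "continuous_on UNIV (\<lambda>X::real^2^6. X $ i $ j)" by (intro continuous_intros)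
  from borel_measurable_continuous_on[OF this assms] show ?thesis .
qed

lemma borel_measurable_det_rows:
  fixes f :: "'a \<Rightarrow> real^2^6"
  assumes "f \<in> borel_measurable M" shows "(\<lambda>x. det_rows i j (f x)) \<in> borel_measurable M"
proof -
  have "continuous_on UNIV (\<lambda>X::real^2^6. det_rows i j X)" by (intro continuous_intros)
  from borel_measurable_continuous_on[OF this assms] show ?thesis .
qed

lemma borel_measurable_infdist:
  fixes f :: "'a \<Rightarrow> real^2^6"
  assumes "f \<in> borel_measurable M" shows "(\<lambda>x. infdist (f x) K) \<in> borel_measurable M"
proof -
  have "continuous_on UNIV (\<lambda>X::real^2^6. infdist X K)" by (intro continuous_intros)
  from borel_measurable_continuous_on[OF this assms] show ?thesis .
qed

text \<open>All that is kept of the gradients: bounded matrix fields whose entries and minors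
  converge weakly and whose distance to \<open>K_stat\<close> tends to zero in mean on one compact
  set.\<close>

locale weak_gradient_limit =
  fixes g :: "real \<Rightarrow> real" and \<Omega> C :: "'a::euclidean_space set"
    and A :: "nat \<Rightarrow> 'a \<Rightarrow> real^2^6" and B :: "'a \<Rightarrow> real^2^6" and R :: real
  assumes C2: "C2 g" and pos: "\<And>t. 0 < deriv (deriv g) t" and g0: "g 0 = 0" and R: "0 < R"
    and C: "compact C" "C \<subseteq> \<Omega>"
    and mA: "\<And>n. A n \<in> borel_measurable lebesgue" and mB: "B \<in> borel_measurable lebesgue"
    and bA: "\<And>n. AE x in lebesgue. norm (A n x) \<le> R" and bB: "AE x in lebesgue. norm (B x) \<le> R"
    and w1: "\<And>i j. wconv \<Omega> (\<lambda>n x. A n x $ i $ j) (\<lambda>x. B x $ i $ j)"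
    and w2: "\<And>i j. wconv \<Omega> (\<lambda>n x. det_rows i j (A n x)) (\<lambda>x. det_rows i j (B x))"
    and E: "(\<lambda>n. \<integral>x. indicator C x * infdist (A n x) (K_stat g) \<partial>lebesgue) \<longlonglongrightarrow> 0"
begin

abbreviation \<chi>C :: "'a \<Rightarrow> real" where "\<chi>C \<equiv> indicator C"

lemma integrable_indicator: "integrable lebesgue \<chi>C"
  using lmeasurable_compact[OF C(1)] by (intro integrable_real_indicator) (auto simp: fmeasurable_def)

lemma integrable_cut:
  "c \<in> borel_measurable lebesgue \<Longrightarrow> AE x in lebesgue. \<bar>c x\<bar> \<le> N \<Longrightarrow> integrable lebesgue (\<lambda>x. \<chi>C x * c x)"
  by (rule integrable_mult_bounded[OF integrable_indicator])

lemma AE_component_bound: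
  assumes "AE x in lebesgue. norm (Q x :: real^2^6) \<le> R" shows "AE x in lebesgue. \<bar>Q x $ i $ j\<bar> \<le> R"
  using assms by eventually_elim (rule component_bound)

lemma AE_det_rows_bound:
  assumes "AE x in lebesgue. norm (Q x :: real^2^6) \<le> R" shows "AE x in lebesgue. \<bar>det_rows i j (Q x)\<bar> \<le> 2 * R\<^sup>2"
  using assms by eventually_elim (rule det_rows_bound)

lemma iconv_component:
  assumes "c \<in> borel_measurable lebesgue" "AE x in lebesgue. \<bar>c x\<bar> \<le> N"
  shows "iconv lebesgue (\<lambda>n x. (\<chi>C x * c x) * A n x $ i $ j) (\<lambda>x. (\<chi>C x * c x) * B x $ i $ j)"
  by (rule iconv_wconv[OF w1 integrable_cut[OF assms] _ borel_measurable_component[OF mA] AE_component_bound[OF bA]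
    borel_measurable_component[OF mB] AE_component_bound[OF bB]]) (use C(2) in \<open>auto simp: indicator_def\<close>)

lemma iconv_det_rows:
  assumes "c \<in> borel_measurable lebesgue" "AE x in lebesgue. \<bar>c x\<bar> \<le> N"
  shows "iconv lebesgue (\<lambda>n x. (\<chi>C x * c x) * det_rows i j (A n x)) (\<lambda>x. (\<chi>C x * c x) * det_rows i j (B x))"
  by (rule iconv_wconv[OF w2 integrable_cut[OF assms] _ borel_measurable_det_rows[OF mA] AE_det_rows_bound[OF bA]
    borel_measurable_det_rows[OF mB] AE_det_rows_bound[OF bB]]) (use C(2) in \<open>auto simp: indicator_def\<close>)

text \<open>With \<open>Q\<close> fixed, \<open>gap\<close> is affine in the entries and minors of
  its second argument, with bounded coefficients taken from \<open>Q\<close>; cut off to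
  \<open>C\<close>, these are admissible test functions.\<close>

lemma iconv_gap:
  assumes mQ: "Q \<in> borel_measurable lebesgue" and bQ: "AE x in lebesgue. norm (Q x) \<le> R"
  shows "iconv lebesgue (\<lambda>n x. \<chi>C x * gap \<Lambda> (Q x) (A n x)) (\<lambda>x. \<chi>C x * gap \<Lambda> (Q x) (B x))"
proof -
  have eq: "\<chi>C x * gap \<Lambda> (Q x) Y = 2 * \<Lambda> * (\<chi>C x * det_rows 5 6 (Q x) + (\<chi>C x * 1) * det_rows 5 6 Y
      - ((\<chi>C x * Q x $ 5 $ 1) * Y $ 6 $ 2 - (\<chi>C x * Q x $ 5 $ 2) * Y $ 6 $ 1
        + (\<chi>C x * Q x $ 6 $ 2) * Y $ 5 $ 1 - (\<chi>C x * Q x $ 6 $ 1) * Y $ 5 $ 2))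
    - ((\<chi>C x * det_rows 1 2 (Q x)) * det_rows 3 4 Y + (\<chi>C x * det_rows 3 4 (Q x)) * det_rows 1 2 Y
      - (\<chi>C x * det_rows 1 3 (Q x)) * det_rows 2 4 Y - (\<chi>C x * det_rows 2 4 (Q x)) * det_rows 1 3 Y
      + (\<chi>C x * det_rows 1 4 (Q x)) * det_rows 2 3 Y + (\<chi>C x * det_rows 2 3 (Q x)) * det_rows 1 4 Y)" for x Y
    unfolding gap_def pluecker_def by (simp add: algebra_simps)
  note c = borel_measurable_component[OF mQ] AE_component_bound[OF bQ]
  note d = borel_measurable_det_rows[OF mQ] AE_det_rows_bound[OF bQ]
  have 1: "(\<lambda>x::'a. 1::real) \<in> borel_measurable lebesgue" "AE x::'a in lebesgue. \<bar>1::real\<bar> \<le> 1" by auto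
  show ?thesis
    unfolding eq
    by (intro iconv_diff iconv_add iconv_cmult iconv_const integrable_cut[OF d] iconv_component[OF c] iconv_det_rows[OF d] iconv_det_rows[OF 1])
qed

abbreviation dist_K :: "nat \<Rightarrow> 'a \<Rightarrow> real" where "dist_K n x \<equiv> infdist (A n x) (K_stat g)"

lemma AE_dist_K: "AE x in lebesgue. \<bar>dist_K n x\<bar> \<le> R"
  using bA[of n]
proof eventually_elim
  case (elim x)
  have "infdist (A n x) (K_stat g) \<le> dist (A n x) 0" by (rule infdist_le[OF zero_in_K_stat[of g, OF g0]])
  then show ?case using elim by (simp add: infdist_nonneg)
qed

lemma integrable_dist_K: "integrable lebesgue (\<lambda>x. \<chi>C x * dist_K n x)"
  by (rule integrable_cut[OF borel_measurable_infdist[OF mA] AE_dist_K])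

abbreviation det_err :: "nat \<Rightarrow> 'a \<Rightarrow> real" where
  "det_err n x \<equiv> \<bar>det_rows 1 2 (A n x) - det_rows 1 2 (B x)\<bar>"

lemma AE_det_err: "AE x in lebesgue. \<bar>det_err n x\<bar> \<le> 4 * R\<^sup>2"
  using bA[of n] bB
proof eventually_elim
  case (elim x)
  then show ?case using det_rows_bound[OF elim(1), of 1 2] det_rows_bound[OF elim(2), of 1 2] by linarith
qed

lemma integrable_det_err: "integrable lebesgue (\<lambda>x. \<chi>C x * det_err n x)"
  by (rule integrable_cut[OF _ AE_det_err])
    (intro borel_measurable_abs borel_measurable_diff borel_measurable_det_rows mA mB)

text \<open>Testing \<open>d\<^sub>n - d\<^sub>m\<close> with the sign of \<open>d\<^sub>n - d\<close> and letting first \<open>m\<close>, then \<open>n\<close> tend to infinity turns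
  the weak convergence of the two arguments of \<^const>\<open>gap\<close> into strong convergence of the determinants.\<close>

lemma det_strong: "(\<lambda>n. \<integral>x. \<chi>C x * det_err n x \<partial>lebesgue) \<longlonglongrightarrow> 0"
proof -
  obtain \<Lambda> where \<Lambda>: "\<And>e. 0 < e \<Longrightarrow> \<exists>C1\<ge>0. \<exists>C2\<ge>0. \<forall>X\<in>cball 0 R. \<forall>Y\<in>cball 0 R.
    \<bar>det_rows 1 2 X - det_rows 1 2 Y\<bar> \<le> e + C1 * gap \<Lambda> X Y + C2 * (infdist X (K_stat g) + infdist Y (K_stat g))"
    using det_gap_bound[OF C2 pos g0 R] by metis
  define V where "V = (\<integral>x. \<chi>C x \<partial>lebesgue)"
  have "0 \<le> V" unfolding V_def by (intro Bochner_Integration.integral_nonneg) simp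
  define H where "H n = (\<integral>x. \<chi>C x * gap \<Lambda> (A n x) (B x) \<partial>lebesgue)" for n
  define En where "En n = (\<integral>x. \<chi>C x * dist_K n x \<partial>lebesgue)" for n
  have limH: "H \<longlonglongrightarrow> 0"
  proof -
    have "H \<longlonglongrightarrow> (\<integral>x. \<chi>C x * gap \<Lambda> (B x) (B x) \<partial>lebesgue)"
      \<comment> \<open>The symmetry of \<open>gap\<close> moves the varying argument to the second
        place.\<close>
      using iconv_gap[OF mB bB, of \<Lambda>] unfolding iconv_def H_def by (simp add: gap_commute)
    then show ?thesis by (simp add: gap_self)
  qed
  have limE: "En \<longlonglongrightarrow> 0" using E by (simp add: En_def[abs_def])
  \<comment> \<open>\<open>H\<close> and \<open>En\<close> do not involve \<open>e\<close>, and
    \<open>C1\<close>, \<open>C2\<close> do not involve \<open>n\<close>, so \<open>n\<close> may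
    tend to infinity before \<open>e\<close> tends to zero.\<close>
  have bound: "\<exists>C1 C2. \<forall>n. (\<integral>x. \<chi>C x * det_err n x \<partial>lebesgue) \<le> e * V + C1 * H n + C2 * En n" if e: "0 < e" for e
  proof -
    obtain C1 C2 where C12: "0 \<le> C1" "0 \<le> C2" "\<And>X Y. X \<in> cball 0 R \<Longrightarrow> Y \<in> cball 0 R \<Longrightarrow>
      \<bar>det_rows 1 2 X - det_rows 1 2 Y\<bar> \<le> e + C1 * gap \<Lambda> X Y + C2 * (infdist X (K_stat g) + infdist Y (K_stat g))"
      using \<Lambda>[OF e] by blast
    have "(\<integral>x. \<chi>C x * det_err n x \<partial>lebesgue) \<le> e * V + C1 * H n + C2 * En n" for n
    proof -
      \<comment> \<open>For fixed \<open>n\<close> the sign is a fixed bounded function, hence a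
        legitimate weight in the weak limit over \<open>m\<close>.\<close>
      define s where "s x = sgn (det_rows 1 2 (A n x) - det_rows 1 2 (B x))" for x
      have s: "s \<in> borel_measurable lebesgue" "AE x in lebesgue. \<bar>s x\<bar> \<le> 1"
      proof -
        show "s \<in> borel_measurable lebesgue"
          unfolding s_def[abs_def]
          by (intro measurable_compose[OF _ borel_measurable_sgn] borel_measurable_diff borel_measurable_det_rows mA mB)
      qed (simp add: s_def abs_sgn_eq)
      have i0: "integrable lebesgue (\<lambda>x. (\<chi>C x * s x) * det_rows 1 2 (A n x))"
        by (rule integrable_mult_bounded[OF integrable_cut[OF s] borel_measurable_det_rows[OF mA] AE_det_rows_bound[OF bA]])
      have ic: "iconv lebesgue (\<lambda>m x. (\<chi>C x * s x) * det_rows 1 2 (A n x) - (\<chi>C x * s x) * det_rows 1 2 (A m x))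
        (\<lambda>x. (\<chi>C x * s x) * det_rows 1 2 (A n x) - (\<chi>C x * s x) * det_rows 1 2 (B x))"
        by (intro iconv_diff iconv_const i0 iconv_det_rows[OF s])
      have gp: "iconv lebesgue (\<lambda>m x. \<chi>C x * gap \<Lambda> (A n x) (A m x)) (\<lambda>x. \<chi>C x * gap \<Lambda> (A n x) (B x))"
        by (rule iconv_gap[OF mA bA])
      have eq: "\<chi>C x * det_err n x = (\<chi>C x * s x) * det_rows 1 2 (A n x) - (\<chi>C x * s x) * det_rows 1 2 (B x)" for x
        by (simp add: s_def sgn_if abs_if algebra_simps)
      have "(\<integral>x. (\<chi>C x * s x) * det_rows 1 2 (A n x) - (\<chi>C x * s x) * det_rows 1 2 (A m x) \<partial>lebesgue)
        \<le> e * V + C1 * (\<integral>x. \<chi>C x * gap \<Lambda> (A n x) (A m x) \<partial>lebesgue) + C2 * (En n + En m)" for m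
      proof -
        have ig: "integrable lebesgue (\<lambda>x. \<chi>C x * gap \<Lambda> (A n x) (A m x))" using gp by (simp add: iconv_def)
        have "(\<integral>x. (\<chi>C x * s x) * det_rows 1 2 (A n x) - (\<chi>C x * s x) * det_rows 1 2 (A m x) \<partial>lebesgue)
          \<le> (\<integral>x. e * \<chi>C x + C1 * (\<chi>C x * gap \<Lambda> (A n x) (A m x)) + C2 * (\<chi>C x * dist_K n x + \<chi>C x * dist_K m x) \<partial>lebesgue)"
        proof (rule integral_mono_AE)
          show "integrable lebesgue (\<lambda>x. (\<chi>C x * s x) * det_rows 1 2 (A n x) - (\<chi>C x * s x) * det_rows 1 2 (A m x))"
            using ic by (simp add: iconv_def)
          show "integrable lebesgue (\<lambda>x. e * \<chi>C x + C1 * (\<chi>C x * gap \<Lambda> (A n x) (A m x)) + C2 * (\<chi>C x * dist_K n x + \<chi>C x * dist_K m x))"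
            by (intro Bochner_Integration.integrable_add integrable_mult_right integrable_indicator ig integrable_dist_K)
          show "AE x in lebesgue. (\<chi>C x * s x) * det_rows 1 2 (A n x) - (\<chi>C x * s x) * det_rows 1 2 (A m x)
            \<le> e * \<chi>C x + C1 * (\<chi>C x * gap \<Lambda> (A n x) (A m x)) + C2 * (\<chi>C x * dist_K n x + \<chi>C x * dist_K m x)"
            using bA[of n] bA[of m]
          proof eventually_elim
            case (elim x)
            have "s x * (det_rows 1 2 (A n x) - det_rows 1 2 (A m x)) \<le> \<bar>det_rows 1 2 (A n x) - det_rows 1 2 (A m x)\<bar>"
              by (auto simp: s_def sgn_if)
            also have "\<dots> \<le> e + C1 * gap \<Lambda> (A n x) (A m x) + C2 * (dist_K n x + dist_K m x)"
              using elim by (intro C12(3)) auto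
            finally show ?case by (auto simp: indicator_def algebra_simps)
          qed
        qed
        also have "\<dots> = e * V + C1 * (\<integral>x. \<chi>C x * gap \<Lambda> (A n x) (A m x) \<partial>lebesgue) + C2 * (En n + En m)"
          using integrable_indicator ig integrable_dist_K[of n] integrable_dist_K[of m] by (simp add: V_def En_def)
        finally show ?thesis .
      qed
      moreover have "(\<lambda>m. \<integral>x. (\<chi>C x * s x) * det_rows 1 2 (A n x) - (\<chi>C x * s x) * det_rows 1 2 (A m x) \<partial>lebesgue)
        \<longlonglongrightarrow> (\<integral>x. \<chi>C x * det_err n x \<partial>lebesgue)"
        using ic unfolding iconv_def eq by simp
      moreover have "(\<lambda>m. e * V + C1 * (\<integral>x. \<chi>C x * gap \<Lambda> (A n x) (A m x) \<partial>lebesgue) + C2 * (En n + En m))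
        \<longlonglongrightarrow> e * V + C1 * H n + C2 * (En n + 0)"
        using gp unfolding iconv_def H_def by (intro tendsto_intros limE) simp
      ultimately show ?thesis using LIMSEQ_le by fastforce
    qed
    then show ?thesis by blast
  qed
  show ?thesis
  proof (rule LIMSEQ_I)
    fix r :: real assume "0 < r"
    define e where "e = r / (2 * (V + 1))"
    have e: "0 < e" "e * V < r" using \<open>0 < r\<close> \<open>0 \<le> V\<close> by (auto simp: e_def field_simps add_nonneg_pos)
    obtain C1 C2 where b: "\<And>n. (\<integral>x. \<chi>C x * det_err n x \<partial>lebesgue) \<le> e * V + C1 * H n + C2 * En n"
      using bound[OF e(1)] by blast
    have "(\<lambda>n. e * V + C1 * H n + C2 * En n) \<longlonglongrightarrow> e * V + C1 * 0 + C2 * 0"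
      by (intro tendsto_intros limH limE)
    then have "\<forall>\<^sub>F n in sequentially. e * V + C1 * H n + C2 * En n < r"
      using e(2) by (intro order_tendstoD(2)) auto
    then obtain N where N: "\<And>n. n \<ge> N \<Longrightarrow> e * V + C1 * H n + C2 * En n < r" by (auto simp: eventually_sequentially)
    have "norm ((\<integral>x. \<chi>C x * det_err n x \<partial>lebesgue) - 0) < r" if "n \<ge> N" for n
    proof -
      have "0 \<le> (\<integral>x. \<chi>C x * det_err n x \<partial>lebesgue)" by (intro Bochner_Integration.integral_nonneg) auto
      then show ?thesis using b[of n] N[OF that] by simp
    qed
    then show "\<exists>N. \<forall>n\<ge>N. norm ((\<integral>x. \<chi>C x * det_err n x \<partial>lebesgue) - 0) < r" by blast
  qed
qed

text \<open>Every equation defining \<^const>\<open>K_stat\<close> is affine in the matrix, with coefficients depending on the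
  determinant only; it passes to the limit because the determinants converge strongly.\<close>

lemma affine_equation_limit:
  assumes c: "continuous_on UNIV c" and b: "continuous_on UNIV b"
    and eq: "\<And>X. X \<in> K_stat g \<Longrightarrow> X $ i $ j = c (det_rows 1 2 X) * X $ k $ l + b (det_rows 1 2 X)"
  shows "AE x in lebesgue. x \<in> C \<longrightarrow> B x $ i $ j = c (det_rows 1 2 (B x)) * B x $ k $ l + b (det_rows 1 2 (B x))"
proof -
  \<comment> \<open>The residual of the equation with its coefficients frozen at an independent
    \<open>t\<close>. At \<open>t = d x\<close>, the determinant of the limit, they no longer depend
    on \<open>n\<close>, and the residual is affine in the matrix.\<close>
  define \<rho> :: "real^2^6 \<Rightarrow> real \<Rightarrow> real" where "\<rho> X t = X $ i $ j - (c t * X $ k $ l + b t)" for X t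
  define d where "d x = det_rows 1 2 (B x)" for x
  define T where "T = 2 * R\<^sup>2"
  have dT: "AE x in lebesgue. \<bar>d x\<bar> \<le> T" unfolding d_def T_def by (rule AE_det_rows_bound[OF bB])
  have md: "d \<in> borel_measurable lebesgue" unfolding d_def[abs_def] by (rule borel_measurable_det_rows[OF mB])
  have bdc: "\<exists>N. AE x in lebesgue. \<bar>f (d x)\<bar> \<le> N" and mc: "(\<lambda>x. f (d x)) \<in> borel_measurable lebesgue"
    if f: "continuous_on UNIV f" for f :: "real \<Rightarrow> real"
  proof -
    have "compact (f ` {-T..T})" by (intro compact_continuous_image continuous_on_subset[OF f]) auto
    then obtain N where N: "\<And>t. \<bar>t\<bar> \<le> T \<Longrightarrow> \<bar>f t\<bar> \<le> N"
      by (fastforce dest!: compact_imp_bounded simp: bounded_iff abs_le_iff)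
    then have "AE x in lebesgue. \<bar>f (d x)\<bar> \<le> N" using dT by (auto elim!: eventually_mono)
    then show "\<exists>N. AE x in lebesgue. \<bar>f (d x)\<bar> \<le> N" by blast
    show "(\<lambda>x. f (d x)) \<in> borel_measurable lebesgue" by (rule borel_measurable_continuous_on[OF f md])
  qed
  obtain Nc Nb where Nc: "AE x in lebesgue. \<bar>c (d x)\<bar> \<le> Nc" and Nb: "AE x in lebesgue. \<bar>b (d x)\<bar> \<le> Nb"
    using bdc[OF c] bdc[OF b] by blast
  define s where "s x = sgn (\<rho> (B x) (d x))" for x
  have m\<rho>: "(\<lambda>x. \<rho> (B x) (d x)) \<in> borel_measurable lebesgue"
    unfolding \<rho>_def
    by (intro borel_measurable_diff borel_measurable_add borel_measurable_times mc c b borel_measurable_component mB)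
  have s: "s \<in> borel_measurable lebesgue" "AE x in lebesgue. \<bar>s x\<bar> \<le> 1"
  proof -
    show "s \<in> borel_measurable lebesgue" unfolding s_def[abs_def] by (intro measurable_compose[OF _ borel_measurable_sgn] m\<rho>)
  qed (simp add: s_def abs_sgn_eq)
  have ms: "(\<lambda>x. s x * c (d x)) \<in> borel_measurable lebesgue" "(\<lambda>x. s x * b (d x)) \<in> borel_measurable lebesgue"
    using s(1) mc[OF c] mc[OF b] by auto
  have bs: "AE x in lebesgue. \<bar>s x * f x\<bar> \<le> N" if "AE x in lebesgue. \<bar>f x\<bar> \<le> N" for f :: "'a \<Rightarrow> real" and N
    using that
  proof eventually_elim
    case (elim x)
    have "\<bar>s x * f x\<bar> \<le> \<bar>f x\<bar>" by (auto simp: s_def sgn_if)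
    then show ?case using elim by linarith
  qed
  have ic: "iconv lebesgue
    (\<lambda>n x. (\<chi>C x * s x) * A n x $ i $ j - ((\<chi>C x * (s x * c (d x))) * A n x $ k $ l + \<chi>C x * (s x * b (d x))))
    (\<lambda>x. (\<chi>C x * s x) * B x $ i $ j - ((\<chi>C x * (s x * c (d x))) * B x $ k $ l + \<chi>C x * (s x * b (d x))))"
    by (intro iconv_diff iconv_add iconv_const iconv_component[OF s] iconv_component[OF ms(1) bs[OF Nc]] integrable_cut[OF ms(2) bs[OF Nb]])
  have eqn: "(\<chi>C x * s x) * Y $ i $ j - ((\<chi>C x * (s x * c (d x))) * Y $ k $ l + \<chi>C x * (s x * b (d x)))
    = \<chi>C x * (s x * \<rho> Y (d x))" for Y x
    by (simp add: \<rho>_def algebra_simps)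
  have ic': "iconv lebesgue (\<lambda>n x. \<chi>C x * (s x * \<rho> (A n x) (d x))) (\<lambda>x. \<chi>C x * (s x * \<rho> (B x) (d x)))"
    using ic unfolding eqn .
  have sB: "s x * \<rho> (B x) (d x) = \<bar>\<rho> (B x) (d x)\<bar>" for x by (simp add: s_def sgn_if)
  define I where "I = (\<integral>x. \<chi>C x * \<bar>\<rho> (B x) (d x)\<bar> \<partial>lebesgue)"
  have limI: "(\<lambda>n. \<integral>x. \<chi>C x * (s x * \<rho> (A n x) (d x)) \<partial>lebesgue) \<longlonglongrightarrow> I"
    using ic' unfolding iconv_def sB I_def by simp
  have iI: "integrable lebesgue (\<lambda>x. \<chi>C x * \<bar>\<rho> (B x) (d x)\<bar>)" using ic' unfolding iconv_def sB by simp
  define V where "V = (\<integral>x. \<chi>C x \<partial>lebesgue)"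
  have "0 \<le> V" unfolding V_def by (intro Bochner_Integration.integral_nonneg) simp
  have clo: "closed (K_stat g)" by (rule closed_K_stat[OF continuous_derivs(1,2)[OF C2 pos]])
  have ne: "K_stat g \<noteq> {}" using zero_in_K_stat[of g, OF g0] by auto
  have small: "I \<le> e * V" if e: "0 < e" for e
  proof -
    \<comment> \<open>If both penalties vanish, the matrix lies in \<open>K_stat\<close> and has
      determinant \<open>t\<close>, so its residual is zero; elsewhere the distance and the
      determinant error control it.\<close>
    have "\<exists>N\<ge>0. \<forall>z\<in>cball 0 R \<times> {-T..T}. \<bar>\<rho> (fst z) (snd z)\<bar> \<le> e + N * (infdist (fst z) (K_stat g) + \<bar>det_rows 1 2 (fst z) - snd z\<bar>)"
    proof (rule compact_control)
      show "compact (cball (0::real^2^6) R \<times> {-T..T})" by (intro compact_Times compact_cball compact_Icc)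
      show "continuous_on (cball 0 R \<times> {-T..T}) (\<lambda>z. \<bar>\<rho> (fst z) (snd z)\<bar>)"
        unfolding \<rho>_def by (intro continuous_intros continuous_on_compose2[OF c] continuous_on_compose2[OF b]) auto
      show "continuous_on (cball 0 R \<times> {-T..T}) (\<lambda>z. infdist (fst z) (K_stat g) + \<bar>det_rows 1 2 (fst z) - snd z\<bar>)"
        by (intro continuous_intros)
      show "0 \<le> infdist (fst z) (K_stat g) + \<bar>det_rows 1 2 (fst z) - snd z\<bar>" for z :: "(real^2^6) \<times> real"
        by (simp add: infdist_nonneg)
      show "\<bar>\<rho> (fst z) (snd z)\<bar> < e" if "infdist (fst z) (K_stat g) + \<bar>det_rows 1 2 (fst z) - snd z\<bar> = 0" for z
      proof -
        have "infdist (fst z) (K_stat g) = 0" "det_rows 1 2 (fst z) = snd z"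
          using that infdist_nonneg[of "fst z" "K_stat g"] by linarith+
        then have "fst z \<in> K_stat g" using in_closed_iff_infdist_zero[OF clo ne] by blast
        from eq[OF this] have "\<rho> (fst z) (snd z) = 0" by (simp add: \<rho>_def \<open>det_rows 1 2 (fst z) = snd z\<close>)
        then show ?thesis using e by simp
      qed
    qed (use e in simp)
    then obtain N where N: "0 \<le> N" "\<And>X t. norm X \<le> R \<Longrightarrow> \<bar>t\<bar> \<le> T \<Longrightarrow> \<bar>\<rho> X t\<bar> \<le> e + N * (infdist X (K_stat g) + \<bar>det_rows 1 2 X - t\<bar>)"
      by (fastforce simp: abs_le_iff)
    have "(\<integral>x. \<chi>C x * (s x * \<rho> (A n x) (d x)) \<partial>lebesgue)
      \<le> e * V + N * ((\<integral>x. \<chi>C x * dist_K n x \<partial>lebesgue) + (\<integral>x. \<chi>C x * det_err n x \<partial>lebesgue))" for n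
    proof -
      have "(\<integral>x. \<chi>C x * (s x * \<rho> (A n x) (d x)) \<partial>lebesgue)
        \<le> (\<integral>x. e * \<chi>C x + N * (\<chi>C x * dist_K n x + \<chi>C x * det_err n x) \<partial>lebesgue)"
      proof (rule integral_mono_AE)
        show "integrable lebesgue (\<lambda>x. \<chi>C x * (s x * \<rho> (A n x) (d x)))" using ic' by (simp add: iconv_def)
        show "integrable lebesgue (\<lambda>x. e * \<chi>C x + N * (\<chi>C x * dist_K n x + \<chi>C x * det_err n x))"
          by (intro Bochner_Integration.integrable_add integrable_mult_right integrable_indicator integrable_dist_K integrable_det_err)
        show "AE x in lebesgue. \<chi>C x * (s x * \<rho> (A n x) (d x)) \<le> e * \<chi>C x + N * (\<chi>C x * dist_K n x + \<chi>C x * det_err n x)"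
          using bA[of n] dT
        proof eventually_elim
          case (elim x)
          have "s x * \<rho> (A n x) (d x) \<le> \<bar>\<rho> (A n x) (d x)\<bar>" by (auto simp: s_def sgn_if)
          also have "\<dots> \<le> e + N * (dist_K n x + det_err n x)" using N(2)[OF elim] by (simp add: d_def)
          finally show ?case by (auto simp: indicator_def)
        qed
      qed
      also have "\<dots> = e * V + N * ((\<integral>x. \<chi>C x * dist_K n x \<partial>lebesgue) + (\<integral>x. \<chi>C x * det_err n x \<partial>lebesgue))"
        using integrable_indicator integrable_dist_K[of n] integrable_det_err[of n] by (simp add: V_def)
      finally show ?thesis .
    qed
    moreover have "(\<lambda>n. e * V + N * ((\<integral>x. \<chi>C x * dist_K n x \<partial>lebesgue) + (\<integral>x. \<chi>C x * det_err n x \<partial>lebesgue)))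
      \<longlonglongrightarrow> e * V + N * (0 + 0)"
      by (intro tendsto_intros E det_strong)
    ultimately show ?thesis using limI LIMSEQ_le by fastforce
  qed
  have "I \<le> 0"
  proof (rule field_le_epsilon)
    fix r :: real assume "0 < r"
    have "I \<le> r / (V + 1) * V" using \<open>0 < r\<close> \<open>0 \<le> V\<close> by (intro small) simp
    also have "\<dots> \<le> r" using \<open>0 < r\<close> \<open>0 \<le> V\<close> by (simp add: field_simps)
    finally show "I \<le> 0 + r" by simp
  qed
  moreover have "0 \<le> I" unfolding I_def by (intro Bochner_Integration.integral_nonneg) auto
  ultimately have "I = 0" by simp
  then have "AE x in lebesgue. \<chi>C x * \<bar>\<rho> (B x) (d x)\<bar> = 0"
    unfolding I_def using integral_nonneg_eq_0_iff_AE[OF iI] by auto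
  then show ?thesis
    by eventually_elim (auto simp: \<rho>_def d_def)
qed

lemma limit_in_K_stat: "AE x in lebesgue. x \<in> C \<longrightarrow> B x \<in> K_stat g"
proof -
  note cont = continuous_derivs[OF C2 pos]
  have n: "continuous_on UNIV (\<lambda>t. - zval g t)" by (intro continuous_intros cont)
  have z: "continuous_on UNIV (\<lambda>t::real. 0 :: real)" by (intro continuous_intros)
  \<comment> \<open>All equations are forced into the one shape of
    \<open>affine_equation_limit\<close>; where no entry occurs on the right,
    \<open>X $ 1 $ 1\<close> with coefficient 0 is a filler.\<close>
  have K: "X $ 3 $ j = deriv g (det_rows 1 2 X) * X $ 1 $ j + 0" "X $ 4 $ j = deriv g (det_rows 1 2 X) * X $ 2 $ j + 0"
    "X $ 5 $ 1 = 0 * X $ 1 $ 1 + 0" "X $ 5 $ 2 = 0 * X $ 1 $ 1 + - zval g (det_rows 1 2 X)"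
    "X $ 6 $ 1 = 0 * X $ 1 $ 1 + zval g (det_rows 1 2 X)" "X $ 6 $ 2 = 0 * X $ 1 $ 1 + 0"
    if "X \<in> K_stat g" for X j
    using that unfolding K_stat_iff by auto
  have "AE x in lebesgue. \<forall>j. x \<in> C \<longrightarrow> B x $ 3 $ j = deriv g (det_rows 1 2 (B x)) * B x $ 1 $ j + 0"
    unfolding AE_all_countable by (intro allI affine_equation_limit[OF cont(2) z K(1)])
  moreover have "AE x in lebesgue. \<forall>j. x \<in> C \<longrightarrow> B x $ 4 $ j = deriv g (det_rows 1 2 (B x)) * B x $ 2 $ j + 0"
    unfolding AE_all_countable by (intro allI affine_equation_limit[OF cont(2) z K(2)])
  moreover have "AE x in lebesgue. x \<in> C \<longrightarrow> B x $ 5 $ 1 = 0 * B x $ 1 $ 1 + 0"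
    by (rule affine_equation_limit[OF z z K(3)])
  moreover have "AE x in lebesgue. x \<in> C \<longrightarrow> B x $ 5 $ 2 = 0 * B x $ 1 $ 1 + - zval g (det_rows 1 2 (B x))"
    by (rule affine_equation_limit[OF z n K(4)])
  moreover have "AE x in lebesgue. x \<in> C \<longrightarrow> B x $ 6 $ 1 = 0 * B x $ 1 $ 1 + zval g (det_rows 1 2 (B x))"
    by (rule affine_equation_limit[OF z cont(3) K(5)])
  moreover have "AE x in lebesgue. x \<in> C \<longrightarrow> B x $ 6 $ 2 = 0 * B x $ 1 $ 1 + 0"
    by (rule affine_equation_limit[OF z z K(6)])
  ultimately show ?thesis by eventually_elim (simp add: K_stat_iff)
qed

end

section \<open>Application to the gradients\<close>

text \<open>Testing with a scalar function times the constant \<open>b\<close> extracts one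
  component. Agreement on \<open>\<Omega>\<close> is all that is asked of \<open>h\<close> and
  \<open>H\<close>, so components of extensions qualify.\<close>

lemma wconv_inner:
  fixes f :: "nat \<Rightarrow> 'a::euclidean_space \<Rightarrow> 'b::euclidean_space"
  assumes w: "Linf_weak_star \<Omega> f F"
    and h: "\<And>n x. x \<in> \<Omega> \<Longrightarrow> h n x = f n x \<bullet> b" and H: "\<And>x. x \<in> \<Omega> \<Longrightarrow> H x = F x \<bullet> b"
  shows "wconv \<Omega> h H"
  unfolding wconv_def
proof (intro allI impI)
  fix \<psi> :: "'a \<Rightarrow> real"
  assume \<psi>: "integrable lebesgue \<psi>" and off: "\<forall>x. x \<notin> \<Omega> \<longrightarrow> \<psi> x = 0"
  have cut: "indicator \<Omega> x *\<^sub>R (\<psi> x *\<^sub>R b) = \<psi> x *\<^sub>R b" for x using off by (auto simp: indicator_def)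
  have "set_integrable lebesgue \<Omega> (\<lambda>x. \<psi> x *\<^sub>R b)"
    unfolding set_integrable_def cut using \<psi> by simp
  with w have "(\<lambda>n. LINT x:\<Omega>|lebesgue. f n x \<bullet> (\<psi> x *\<^sub>R b)) \<longlonglongrightarrow> (LINT x:\<Omega>|lebesgue. F x \<bullet> (\<psi> x *\<^sub>R b))"
    unfolding Linf_weak_star_def by blast
  moreover have "indicator \<Omega> x *\<^sub>R (f n x \<bullet> (\<psi> x *\<^sub>R b)) = \<psi> x * h n x" for n x
    using h[of x n] off by (cases "x \<in> \<Omega>") auto
  moreover have "indicator \<Omega> x *\<^sub>R (F x \<bullet> (\<psi> x *\<^sub>R b)) = \<psi> x * H x" for x
    using H[of x] off by (cases "x \<in> \<Omega>") auto
  ultimately show "(\<lambda>n. \<integral>x. \<psi> x * h n x \<partial>lebesgue) \<longlonglongrightarrow> (\<integral>x. \<psi> x * H x \<partial>lebesgue)"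
    unfolding set_lebesgue_integral_def by (simp only:)
qed

lemma borel_measurable_matrix:
  fixes f :: "'m::finite \<Rightarrow> 'n::finite \<Rightarrow> 'a \<Rightarrow> real"
  assumes "\<And>i j. f i j \<in> borel_measurable M"
  shows "(\<lambda>x. \<chi> i j. f i j x) \<in> borel_measurable M"
proof -
  have "(\<chi> i j. f i j x) = (\<Sum>i\<in>UNIV. \<Sum>j\<in>UNIV. f i j x *\<^sub>R axis i (axis j 1))" for x
  proof -
    have ax: "axis k (axis l (1::real)) $ i $ j = (if k = i then if l = j then 1 else 0 else 0)" for k i :: 'm and l j :: 'n
      by (simp add: axis_def)
    have "(\<Sum>k\<in>UNIV. \<Sum>l\<in>UNIV. f k l x *\<^sub>R axis k (axis l (1::real))) $ i $ j = f i j x" for i :: 'm and j :: 'n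
    proof -
      have "(\<Sum>k\<in>UNIV. \<Sum>l\<in>UNIV. f k l x *\<^sub>R axis k (axis l (1::real))) $ i $ j
          = (\<Sum>k\<in>UNIV. \<Sum>l\<in>UNIV. f k l x * (axis k (axis l (1::real)) $ i $ j))" by simp
      also have "\<dots> = (\<Sum>k\<in>UNIV. if k = i then \<Sum>l\<in>UNIV. if l = j then f k l x else 0 else 0)"
        unfolding ax by (intro sum.cong refl) (auto simp: if_distrib[of "\<lambda>c. _ * c"] cong: if_cong)
      also have "\<dots> = f i j x" by simp
      finally show ?thesis .
    qed
    then show ?thesis by (simp add: vec_eq_iff)
  qed
  then show ?thesis using assms by simp
qed

text \<open>The crude bound by the sum of the absolute values of all twelve entries.\<close>

lemma norm_matrix_le:
  fixes X :: "real^2^6"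
  assumes "\<And>i j. \<bar>X $ i $ j\<bar> \<le> L"
  shows "norm X \<le> 12 * L"
proof -
  have "norm X \<le> (\<Sum>i\<in>UNIV. norm (X $ i))" unfolding norm_vec_def by (rule L2_set_le_sum) simp
  also have "\<dots> \<le> (\<Sum>i\<in>(UNIV :: 6 set). 2 * L)"
  proof (rule sum_mono)
    fix i :: 6
    have "norm (X $ i) \<le> (\<Sum>j\<in>UNIV. \<bar>X $ i $ j\<bar>)" by (rule norm_le_l1_cart)
    also have "\<dots> \<le> 2 * L" using assms[of i 1] assms[of i 2] by (simp add: sum_2)
    finally show "norm (X $ i) \<le> 2 * L" .
  qed
  finally show ?thesis by simp
qed

theorem theorem5:
  fixes g :: "real \<Rightarrow> real"
    and \<Omega> :: "(real^2) set"
    and u :: "nat \<Rightarrow> real^2 \<Rightarrow> real^6"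
    and v :: "real^2 \<Rightarrow> real^6"
  assumes "C2 g"
    and "\<And>t. deriv (deriv g) t > 0"
    and "g 0 = 0" and "deriv g 0 = 0"
    and "open \<Omega>" and "bounded \<Omega>" and "convex \<Omega>"
    and "\<exists>L. \<forall>n. L-lipschitz_on \<Omega> (u n)"
    and "L1loc_tendsto \<Omega> (\<lambda>n x. infdist (Jac (u n) x) (K_stat g)) (\<lambda>x. 0)"
    and "\<exists>M. M-lipschitz_on \<Omega> v"
    and "W1inf_weak_star \<Omega> u v"
  shows "L1loc_tendsto \<Omega> (\<lambda>n x. det_rows 1 2 (Jac (u n) x)) (\<lambda>x. det_rows 1 2 (Jac v x))
    \<and> (AE x\<in>\<Omega> in lebesgue. Jac v x \<in> K_stat g)"
proof -
  obtain L1 L2 where L12: "\<And>n. L1-lipschitz_on \<Omega> (u n)" "L2-lipschitz_on \<Omega> v"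
    using assms(8,10) by blast
  define L where "L = max L1 L2"
  have "0 \<le> L" using lipschitz_on_nonneg[OF L12(2)] by (simp add: L_def)
  have comp: "L-lipschitz_on \<Omega> (\<lambda>x. f x $ i)" if "L'-lipschitz_on \<Omega> f" "L' \<le> L" for f :: "real^2 \<Rightarrow> real^6" and i L'
  proof (rule lipschitz_onI)
    fix x y assume "x \<in> \<Omega>" "y \<in> \<Omega>"
    have "dist (f x $ i) (f y $ i) \<le> dist (f x) (f y)" by (rule dist_vec_nth_le)
    also have "\<dots> \<le> L * dist x y"
      using lipschitz_onD[OF lipschitz_on_mono[OF that(1) order_refl that(2)] \<open>x \<in> \<Omega>\<close> \<open>y \<in> \<Omega>\<close>] .
    finally show "dist (f x $ i) (f y $ i) \<le> L * dist x y" .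
  qed fact
  \<comment> \<open>Extending componentwise keeps the common constant \<open>L\<close> for all
    \<open>n\<close> and \<open>i\<close>.\<close>
  have "\<exists>F. L-lipschitz_on UNIV F \<and> (\<forall>x\<in>\<Omega>. F x = u n x $ i)" for n i
    using lipschitz_extension[OF comp[OF L12(1)]] by (metis L_def max.cobounded1)
  then obtain U where U: "\<And>n i. L-lipschitz_on UNIV (U n i)" "\<And>n i x. x \<in> \<Omega> \<Longrightarrow> U n i x = u n x $ i"
    by metis
  have "\<exists>F. L-lipschitz_on UNIV F \<and> (\<forall>x\<in>\<Omega>. F x = v x $ i)" for i
    using lipschitz_extension[OF comp[OF L12(2)]] by (metis L_def max.cobounded2)
  then obtain W where W: "\<And>i. L-lipschitz_on UNIV (W i)" "\<And>i x. x \<in> \<Omega> \<Longrightarrow> W i x = v x $ i"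
    by metis
  define D :: "(6 \<Rightarrow> real^2 \<Rightarrow> real) \<Rightarrow> real^2 \<Rightarrow> real^2^6" where "D F x = (\<chi> i j. dderiv (axis j 1) (F i) x)" for F x
  have D: "D F x $ i $ j = dderiv (axis j 1) (F i) x" for F x i j by (simp add: D_def)
  \<comment> \<open>On the open set \<open>\<Omega>\<close> partial derivatives do not notice the
    extension.\<close>
  have JD: "Jac f x = D F x" if "x \<in> \<Omega>" "\<And>i x. x \<in> \<Omega> \<Longrightarrow> F i x = f x $ i" for f F x
  proof -
    have "dderiv (axis j 1) (F i) x = dderiv (axis j 1) (\<lambda>y. f y $ i) x" for i j
      using \<open>open \<Omega>\<close> that by (rule dderiv_cong)
    then show ?thesis by (simp add: vec_eq_iff D Jac_def dderiv_def)
  qed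
  note JU = JD[where F = "U _", OF _ U(2)] and JW = JD[where F = W, OF _ W(2)]
  have detD: "(\<lambda>x. det_rows i j (D F x)) = minor (axis 1 1) (axis 2 1) (F i) (F j)" for F i j
    by (rule ext) (simp add: det_rows_eq D minor_def)
  have mD: "D F \<in> borel_measurable lebesgue" if "\<And>i. L-lipschitz_on UNIV (F i)" for F
    unfolding D_def[abs_def] by (intro borel_measurable_matrix borel_measurable_dderiv[where L = L] that)
  \<comment> \<open>Twelve entries bounded by \<open>L\<close>; the added 1 keeps \<open>R\<close>
    positive when \<open>L = 0\<close>.\<close>
  define R where "R = 12 * L + 1"
  have bD: "AE x in lebesgue. norm (D F x) \<le> R" if "\<And>i. L-lipschitz_on UNIV (F i)" for F
  proof -
    have "AE x in lebesgue. \<forall>i j. \<bar>dderiv (axis j 1) (F i) x\<bar> \<le> L * norm (axis j (1::real) :: real^2)"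
      unfolding AE_all_countable by (intro allI AE_dderiv_bound that)
    then show ?thesis
    proof eventually_elim
      case (elim x)
      have "norm (D F x) \<le> 12 * L" using elim by (intro norm_matrix_le) (simp add: D)
      then show ?case by (simp add: R_def)
    qed
  qed
  have ws: "Linf_weak_star \<Omega> u v" "Linf_weak_star \<Omega> (\<lambda>n. Jac (u n)) (Jac v)"
    using assms(11) by (auto simp: W1inf_weak_star_def)
  have wU: "wconv \<Omega> (\<lambda>n. U n i) (W i)" for i
    by (rule wconv_inner[OF ws(1), where b = "axis i 1"]) (simp_all add: U(2) W(2) inner_axis)
  have wD: "wconv \<Omega> (\<lambda>n x. D (U n) x $ i $ j) (\<lambda>x. D W x $ i $ j)" for i j
    by (rule wconv_inner[OF ws(2), where b = "axis i (axis j 1)"]) (simp_all add: JU JW inner_axis)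
  have wD': "wconv \<Omega> (\<lambda>n. dderiv (axis j 1) (U n i)) (dderiv (axis j 1) (W i))" for i j
    using wD[of i j] by (simp add: D)
  have wdet: "wconv \<Omega> (\<lambda>n x. det_rows i j (D (U n) x)) (\<lambda>x. det_rows i j (D W x))" for i j
    unfolding detD by (rule minor_wconv[OF assms(5,6) U(1) W(1) U(1) W(1) wU wD' wD'])
  have loc: "weak_gradient_limit g \<Omega> C (\<lambda>n. D (U n)) (D W) R" if C: "compact C" "C \<subseteq> \<Omega>" for C
  proof
    have "(\<lambda>n. LINT x:C|lebesgue. \<bar>infdist (Jac (u n) x) (K_stat g) - 0\<bar>) \<longlonglongrightarrow> 0"
      using assms(9) C unfolding L1loc_tendsto_def by blast
    moreover have "indicator C x *\<^sub>R \<bar>infdist (Jac (u n) x) (K_stat g) - 0\<bar> = indicator C x * infdist (D (U n) x) (K_stat g)" for n x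
      using JU[of x n] C(2) by (cases "x \<in> C") (auto simp: infdist_nonneg)
    ultimately show "(\<lambda>n. \<integral>x. indicator C x * infdist (D (U n) x) (K_stat g) \<partial>lebesgue) \<longlonglongrightarrow> 0"
      unfolding set_lebesgue_integral_def by (simp only:)
  qed (use C \<open>0 \<le> L\<close> assms(1-3) in \<open>auto simp: R_def intro: wD wdet mD bD[unfolded R_def] U(1) W(1)\<close>)
  have int: "set_integrable lebesgue C (\<lambda>x. det_rows 1 2 (Jac (u n) x))"
    "set_integrable lebesgue C (\<lambda>x. det_rows 1 2 (Jac v x))"
    "(\<lambda>n. LINT x:C|lebesgue. \<bar>det_rows 1 2 (Jac (u n) x) - det_rows 1 2 (Jac v x)\<bar>) \<longlonglongrightarrow> 0"
    if C: "compact C" "C \<subseteq> \<Omega>" for C n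
  proof -
    interpret weak_gradient_limit g \<Omega> C "\<lambda>n. D (U n)" "D W" R by (rule loc[OF C])
    have u: "indicator C x *\<^sub>R det_rows 1 2 (Jac (u n) x) = indicator C x * det_rows 1 2 (D (U n) x)" for x n
      using JU[of x n] C(2) by (cases "x \<in> C") auto
    have v: "indicator C x *\<^sub>R det_rows 1 2 (Jac v x) = indicator C x * det_rows 1 2 (D W x)" for x
      using JW[of x] C(2) by (cases "x \<in> C") auto
    show "set_integrable lebesgue C (\<lambda>x. det_rows 1 2 (Jac (u n) x))"
      unfolding set_integrable_def u by (rule integrable_cut[OF borel_measurable_det_rows[OF mA] AE_det_rows_bound[OF bA]])
    show "set_integrable lebesgue C (\<lambda>x. det_rows 1 2 (Jac v x))"
      unfolding set_integrable_def v by (rule integrable_cut[OF borel_measurable_det_rows[OF mB] AE_det_rows_bound[OF bB]])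
    have "indicator C x *\<^sub>R \<bar>det_rows 1 2 (Jac (u n) x) - det_rows 1 2 (Jac v x)\<bar> = indicator C x * \<bar>det_rows 1 2 (D (U n) x) - det_rows 1 2 (D W x)\<bar>" for x n
      using JU[of x n] JW[of x] C(2) by (cases "x \<in> C") auto
    then show "(\<lambda>n. LINT x:C|lebesgue. \<bar>det_rows 1 2 (Jac (u n) x) - det_rows 1 2 (Jac v x)\<bar>) \<longlonglongrightarrow> 0"
      unfolding set_lebesgue_integral_def using det_strong by (simp only:)
  qed
  \<comment> \<open>Membership in \<open>K_stat\<close> is known almost everywhere on each compact
    subset; an exhaustion by countably many of them reaches almost every point of
    \<open>\<Omega>\<close>.\<close>
  obtain C where C: "\<And>n::nat. compact (C n)" "\<And>n. C n \<subseteq> \<Omega>" "(\<Union>n. C n) = \<Omega>"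
    using open_Union_compact_subsets[OF \<open>open \<Omega>\<close>] by metis
  have "AE x in lebesgue. \<forall>n. x \<in> C n \<longrightarrow> D W x \<in> K_stat g"
    unfolding AE_all_countable by (intro allI weak_gradient_limit.limit_in_K_stat[OF loc[OF C(1,2)]])
  then have "AE x\<in>\<Omega> in lebesgue. Jac v x \<in> K_stat g"
    by eventually_elim (use C(3) JW in auto)
  then show ?thesis
    unfolding L1loc_tendsto_def L1loc_def using int by blast
qed

end
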